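(* Let $R$ be $\mathbb{Z}$ or a field of characteristic $0$, let $(\mathbf{x},\rho,B)$ be a generalized seed over $R$, and let $A$ be either the generalized cluster algebra $\mathcal{A}(\mathbf{x},\rho,B)$ or the generalized upper cluster algebra $\mathcal{U}(\mathbf{x},\rho,B)$. Then $A$ is an FF-domain. In particular, it is atomic.
   Context: Here $[a,b]$ denotes the set of integers $x$ with $a\le x\le b$; $[x]_+=\max(x,0)$; $\mathbf{q}(R)$ is the quotient field of $R$. Let $n,m\ge 0$ be integers with $n+m>0$, and let the ambient field $\mathcal{F}$ be the rational function field in $n+m$ independent variables over $\mathbf{q}(R)$. An exchange matrix is an $(n+m)\times n$ integer matrix $B=(b_{ij})$ whose submatrix on the first $n$ rows is skew-symmetrizable, i.e. becomes skew-symmetric after left multiplication by some diagonal matrix with positive integer diagonal entries. Fix positive integers $d_1,\dots,d_n$ such that $\beta_{ji}:=b_{ji}/d_i\in\mathbb{Z}$ for all $i\in[1,n]$, $j\in[1,n+m]$. A generalized seed of rank $n$ is a triple $(\mathbf{x},\rho,B)$ where $\mathbf{x}=\{x_1,\dots,x_{n+m}\}\subseteq\mathcal{F}$ is a cluster, i.e. a set of $n+m$ elements algebraically independent over $R$ ($x_1,\dots,x_n$ are the cluster variables and $x_{n+1},\dots,x_{n+m}$ the frozen variables); $B$ is an exchange matrix; and $\rho=\{\rho_i\mid i\in[1,n]\}$ with $\rho_i=\{\rho_{i,0},\dots,\rho_{i,d_i}\}$, $\rho_{i,0}=\rho_{i,d_i}=1$ and $\rho_{i,j}$ a monomial (with coefficient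 in $R$) in $R[x_{n+1},\dots,x_{n+m}]$ for $j\in[1,d_i-1]$. Its exchange polynomials are, for $i\in[1,n]$, $$f_i=\sum_{j=0}^{d_i}\rho_{i,j}\prod_{k=1}^{n+m}x_k^{\,j[\beta_{ki}]_++(d_i-j)[-\beta_{ki}]_+}\in R[\mathbf{x}].$$ The mutation of $(\mathbf{x},\rho,B)$ in direction $i\in[1,n]$ is the generalized seed $\mu_i(\mathbf{x},\rho,B)=(\mathbf{x}_i,\rho',B_i)$ (with the same $d_1,\dots,d_n$), where $\mathbf{x}_i=(\mathbf{x}\setminus\{x_i\})\cup\{x_i'\}$ with $x_i'=f_i/x_i$; $\rho'$ is obtained from $\rho$ by replacing $\rho_i$ by $\rho_i'$, $\rho'_{i,j}=\rho_{i,d_i-j}$; and $B_i=(b'_{kl})$ with $b'_{kl}=-b_{kl}$ if $k=i$ or $l=i$, and $b'_{kl}=b_{kl}+[b_{il}]_+b_{ki}+b_{il}[-b_{ki}]_+$ otherwise. Two generalized seeds are mutation-equivalent if one is obtained from the other by a finite sequence of mutations. For a cluster $\mathbf{y}$, $L_{\mathbf{y}}=R[y_1^{\pm1},\dots,y_{n+m}^{\pm1}]$. The generalized cluster algebra $\mathcal{A}(\mathbf{x},\rho,B)$ is the $R$-subalgebra of $\mathcal{F}$ generated by $x_{n+1}^{\pm1},\dots,x_{n+m}^{\pm1}$ and all cluster variables of all generalized seeds mutation-equivalent to $(\mathbf{x},\rho,B)$. The generalized upper cluster algebra $\mathcal{U}(\mathbf{x},\rho,B)$ is the intersection $\bigcap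 L_{\mathbf{y}}$ over the clusters $\mathbf{y}$ of all generalized seeds mutation-equivalent to $(\mathbf{x},\rho,B)$. A non-zero non-unit $u$ of a domain $A$ is an atom if $u=ab$ with $a,b\in A$ implies that $a$ or $b$ is a unit. A domain is atomic if every non-zero non-unit is a finite product of atoms. It is an FF-domain (finite factorization domain) if it is atomic and every non-zero non-unit factors into atoms in only finitely many ways up to order and associates. *)

theory Defs
  imports
    "HOL-Algebra.Algebraic_Closure_Type"
    "HOL-Algebra.Generated_Rings"
    "HOL-Algebra.Generated_Fields"
    "HOL-Algebra.Ring_Divisibility"
    "HOL-Library.Poly_Mapping"
begin

text \<open>
  The ambient field is a whole type of class \<open>field\<close>; the ground ring \<open>R\<close> and all algebras over it
  are subsets of that type. A subset \<open>A\<close> is regarded as a ring in its own right in the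
  form \<open>ring_on A\<close>.
\<close>

abbreviation ambient :: "'a::field ring"
  where "ambient \<equiv> ring_of_type_algebra"

abbreviation ring_on :: "'a::field set \<Rightarrow> 'a ring"
  where "ring_on A \<equiv> ambient \<lparr>carrier := A\<rparr>"


section \<open>Factorization in domains\<close>

text \<open>
  On the cancellative monoid \<open>mult_of D\<close> of non-zero elements, \<open>factors\<close> uses the library's
  \<open>irreducible\<close>, which in a domain is exactly the notion of an atom. Having finitely many
  factorizations up to order and associates means that finitely many of them represent all
  of them modulo \<open>essentially_equal\<close>.
\<close>

definition atomic_domain :: "'a ring \<Rightarrow> bool" where
  "atomic_domain D \<longleftrightarrow> domain D \<and>
    (\<forall>a \<in> carrier (mult_of D) - Units D.
      \<exists>fs. set fs \<subseteq> carrier (mult_of D) \<and> factors (mult_of D) fs a)"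

definition ff_domain :: "'a ring \<Rightarrow> bool" where
  "ff_domain D \<longleftrightarrow> atomic_domain D \<and>
    (\<forall>a \<in> carrier (mult_of D) - Units D.
      \<exists>\<F>. finite \<F> \<and>
        (\<forall>fs. set fs \<subseteq> carrier (mult_of D) \<and> factors (mult_of D) fs a \<longrightarrow>
          (\<exists>gs \<in> \<F>. essentially_equal (mult_of D) fs gs)))"


section \<open>Algebraic independence and rational function fields\<close>

definition quotient_field :: "'a::field set \<Rightarrow> 'a set" where
  "quotient_field R = {a / b | a b. a \<in> R \<and> b \<in> R \<and> b \<noteq> 0}"

text \<open>
  Polynomials in variables \<open>X\<^sub>k\<close> with \<open>k :: nat\<close> are finitely supported functions from exponent
  vectors to coefficients.
\<close>

definition poly_eval :: "((nat \<Rightarrow>\<^sub>0 nat) \<Rightarrow>\<^sub>0 'a::field) \<Rightarrow> (nat \<Rightarrow> 'a) \<Rightarrow> 'a" where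
  "poly_eval p x =
    (\<Sum>\<alpha> \<in> Poly_Mapping.keys p. Poly_Mapping.lookup p \<alpha> *
      (\<Prod>k \<in> Poly_Mapping.keys \<alpha>. x k ^ Poly_Mapping.lookup \<alpha> k))"

definition algebraically_independent :: "'a::field set \<Rightarrow> nat \<Rightarrow> (nat \<Rightarrow> 'a) \<Rightarrow> bool" where
  "algebraically_independent R N x \<longleftrightarrow>
    (\<forall>p :: (nat \<Rightarrow>\<^sub>0 nat) \<Rightarrow>\<^sub>0 'a.
      range (Poly_Mapping.lookup p) \<subseteq> R \<longrightarrow>
      (\<forall>\<alpha> \<in> Poly_Mapping.keys p. Poly_Mapping.keys \<alpha> \<subseteq> {1..N}) \<longrightarrow>
      poly_eval p x = 0 \<longrightarrow> p = 0)"

text \<open>The whole ambient type is a rational function field over \<open>K\<close> in \<open>N\<close> variables.\<close>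

definition ambient_rational_function_field :: "'a::field set \<Rightarrow> nat \<Rightarrow> bool" where
  "ambient_rational_function_field K N \<longleftrightarrow>
    (\<exists>t :: nat \<Rightarrow> 'a. algebraically_independent K N t \<and>
      generate_field ambient (K \<union> t ` {1..N}) = UNIV)"


section \<open>Generalized seeds\<close>

text \<open>
  A seed is a triple \<open>(x, \<rho>, B)\<close>. All indices are 1-based as in the literature, so only
  \<open>x k\<close> for \<open>k \<in> {1..n+m}\<close>, \<open>\<rho> i j\<close> for \<open>i \<in> {1..n}\<close>, \<open>j \<in> {0..d i}\<close> and
  \<open>B k l\<close> for \<open>k \<in> {1..n+m}\<close>, \<open>l \<in> {1..n}\<close> are meaningful; other values are never used.
\<close>

type_synonym 'a seed = "(nat \<Rightarrow> 'a) \<times> (nat \<Rightarrow> nat \<Rightarrow> 'a) \<times> (nat \<Rightarrow> nat \<Rightarrow> int)"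

definition pos_part :: "int \<Rightarrow> int" where
  "pos_part a = max a 0"

definition skew_symmetrizable :: "nat \<Rightarrow> (nat \<Rightarrow> nat \<Rightarrow> int) \<Rightarrow> bool" where
  "skew_symmetrizable n B \<longleftrightarrow>
    (\<exists>\<delta> :: nat \<Rightarrow> int. (\<forall>i \<in> {1..n}. \<delta> i > 0) \<and>
      (\<forall>i \<in> {1..n}. \<forall>j \<in> {1..n}. \<delta> i * B i j = - (\<delta> j * B j i)))"

definition frozen_monomial :: "'a::field set \<Rightarrow> nat \<Rightarrow> nat \<Rightarrow> (nat \<Rightarrow> 'a) \<Rightarrow> 'a \<Rightarrow> bool" where
  "frozen_monomial R n m x r \<longleftrightarrow>
    (\<exists>c \<in> R. \<exists>e :: nat \<Rightarrow> nat. r = c * (\<Prod>k \<in> {n+1..n+m}. x k ^ e k))"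

fun generalized_seed :: "'a::field set \<Rightarrow> nat \<Rightarrow> nat \<Rightarrow> (nat \<Rightarrow> nat) \<Rightarrow> 'a seed \<Rightarrow> bool" where
  "generalized_seed R n m d (x, \<rho>, B) \<longleftrightarrow>
    algebraically_independent R (n + m) x \<and>
    skew_symmetrizable n B \<and>
    (\<forall>i \<in> {1..n}. d i > 0 \<and> (\<forall>j \<in> {1..n+m}. int (d i) dvd B j i)) \<and>
    (\<forall>i \<in> {1..n}. \<rho> i 0 = 1 \<and> \<rho> i (d i) = 1 \<and>
      (\<forall>j \<in> {1..d i - 1}. frozen_monomial R n m x (\<rho> i j)))"

text \<open>The division is exact in a generalized seed: \<open>beta d B k i = B k i / d i\<close>.\<close>

definition beta :: "(nat \<Rightarrow> nat) \<Rightarrow> (nat \<Rightarrow> nat \<Rightarrow> int) \<Rightarrow> nat \<Rightarrow> nat \<Rightarrow> int" where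
  "beta d B k i = B k i div int (d i)"

fun exchange_polynomial :: "nat \<Rightarrow> nat \<Rightarrow> (nat \<Rightarrow> nat) \<Rightarrow> 'a::field seed \<Rightarrow> nat \<Rightarrow> 'a" where
  "exchange_polynomial n m d (x, \<rho>, B) i =
    (\<Sum>j = 0..d i. \<rho> i j *
      (\<Prod>k = 1..n+m. x k ^ nat (int j * pos_part (beta d B k i)
                                + int (d i - j) * pos_part (- beta d B k i))))"

definition mutate_matrix :: "nat \<Rightarrow> (nat \<Rightarrow> nat \<Rightarrow> int) \<Rightarrow> nat \<Rightarrow> nat \<Rightarrow> int" where
  "mutate_matrix i B k l =
    (if k = i \<or> l = i then - B k l
     else B k l + pos_part (B i l) * B k i + B i l * pos_part (- B k i))"

fun mutate :: "nat \<Rightarrow> nat \<Rightarrow> (nat \<Rightarrow> nat) \<Rightarrow> nat \<Rightarrow> 'a::field seed \<Rightarrow> 'a seed" where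
  "mutate n m d i (x, \<rho>, B) =
    (x(i := exchange_polynomial n m d (x, \<rho>, B) i / x i),
     \<rho>(i := (\<lambda>j. \<rho> i (d i - j))),
     mutate_matrix i B)"

text \<open>
  A mutation is a step between two generalized seeds. The explicit requirement on \<open>S'\<close> is only
  relevant in the degenerate case where an exchange polynomial vanishes (for instance
  \<open>d i = 2\<close>, \<open>\<rho> i 1 = - 2\<close> and \<open>B k i = 0\<close> for all \<open>k\<close>): then \<open>mutate\<close> would produce
  the element 0, and there is no mutation in that direction.
\<close>

definition mutation_step ::
    "'a::field set \<Rightarrow> nat \<Rightarrow> nat \<Rightarrow> (nat \<Rightarrow> nat) \<Rightarrow> 'a seed \<Rightarrow> 'a seed \<Rightarrow> bool" where
  "mutation_step R n m d S S' \<longleftrightarrow>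
    generalized_seed R n m d S \<and> generalized_seed R n m d S' \<and>
    (\<exists>i \<in> {1..n}. S' = mutate n m d i S)"

definition mutation_equivalent ::
    "'a::field set \<Rightarrow> nat \<Rightarrow> nat \<Rightarrow> (nat \<Rightarrow> nat) \<Rightarrow> 'a seed \<Rightarrow> 'a seed \<Rightarrow> bool" where
  "mutation_equivalent R n m d = (mutation_step R n m d)\<^sup>*\<^sup>*"


section \<open>Generalized cluster algebras and upper cluster algebras\<close>

definition laurent_ring :: "'a::field set \<Rightarrow> nat \<Rightarrow> (nat \<Rightarrow> 'a) \<Rightarrow> 'a set" where
  "laurent_ring R N y =
    generate_ring ambient (R \<union> y ` {1..N} \<union> (\<lambda>k. inverse (y k)) ` {1..N})"

definition generalized_cluster_algebra ::
    "'a::field set \<Rightarrow> nat \<Rightarrow> nat \<Rightarrow> (nat \<Rightarrow> nat) \<Rightarrow> 'a seed \<Rightarrow> 'a set" where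
  "generalized_cluster_algebra R n m d S =
    generate_ring ambient
      (R \<union> fst S ` {n+1..n+m} \<union> (\<lambda>k. inverse (fst S k)) ` {n+1..n+m}
       \<union> {fst S' i | S' i. mutation_equivalent R n m d S S' \<and> i \<in> {1..n}})"

definition generalized_upper_cluster_algebra ::
    "'a::field set \<Rightarrow> nat \<Rightarrow> nat \<Rightarrow> (nat \<Rightarrow> nat) \<Rightarrow> 'a seed \<Rightarrow> 'a set" where
  "generalized_upper_cluster_algebra R n m d S =
    \<Inter> {laurent_ring R (n + m) (fst S') | S'. mutation_equivalent R n m d S S'}"

end

theory Submission
  imports Defs
begin

text \<open>
  A domain \<open>A\<close> is an FF-domain as soon as every non-zero element has only finitely many divisors up to
  units. This holds for Laurent polynomial rings \<open>L\<close> over \<open>R\<close>: leading coefficients leave finitely many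
  choices, and a polynomial over a field has finitely many monic divisors. If \<open>A \<subseteq> L\<close>, the divisors in
  \<open>A\<close> of an element are thus known up to a Laurent monomial, and it remains to bound the exponent of each
  \<open>x\<^sub>i\<close> that is not a unit of \<open>A\<close>. For this, \<open>A\<close> lies in \<open>G\<^sub>i[x\<^sub>i, f\<^sub>i/x\<^sub>i]\<close>, where \<open>G\<^sub>i\<close> is the Laurent ring in
  the other variables. If \<open>f\<^sub>i\<close> is not a unit of \<open>G\<^sub>i\<close>, division by a high power of \<open>x\<^sub>i\<close> would require
  divisibility by a high power of \<open>f\<^sub>i\<close> in \<open>G\<^sub>i\<close>. If \<open>f\<^sub>i\<close> is a unit of \<open>G\<^sub>i\<close>, it only involves frozen variables
  and \<open>x\<^sub>i\<close> is a unit of \<open>A\<close>.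

  For the generalized cluster algebra the inclusion in \<open>G\<^sub>i[x\<^sub>i, f\<^sub>i/x\<^sub>i]\<close> is a strong form of the Laurent
  phenomenon. The upper bounds of Berenstein, Fomin and Zelevinsky are invariant under mutation if the
  exchange polynomials for non-adjacent directions are coprime. Coprimality is achieved by adjoining frozen
  variables that make the columns of \<open>B\<close> linearly independent; these are afterwards specialized to 1.
\<close>

section \<open>Subrings of a field\<close>

text \<open>Coprimality of exchange polynomials has to be used over an arbitrary ground subring,
  without unique factorization. It enters as the statement that one of them is a non-zero-divisor
  modulo the other, and is proved with gradings: independent columns supply a grading in which the
  element \<open>yhat\<close> of one direction has positive degree and those of all other directions
  have degree 0. The other exchange polynomials are then homogeneous, whereas the chosen one has a
  monomial, hence a unit, as its top component. The coefficients \<open>\<rho>\<close> may involve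
  the old frozen variables, which must therefore have degree 0; this is why the independence has to
  come from new variables. The other obstacle is a vanishing exchange polynomial. For the generic
  seed it never occurs, so that seed can follow every path of mutations. For the given seed it
  blocks the mutation in its direction. The variable is then a unit of the upper cluster algebra,
  while in the cluster algebra its exponent is bounded inside the polynomial ring
  \<open>G\<^sub>i[x\<^sub>i]\<close>.\<close>

abbreviation rgen :: "'a::field set \<Rightarrow> 'a set"
  where "rgen H \<equiv> generate_ring ambient H"

text \<open>Closure is stated with the operations of the type class, so that the arithmetic of the
  field is available without the record operations of \<open>ambient\<close>.\<close>

definition is_subring :: "'a::field set \<Rightarrow> bool" where
  "is_subring A \<longleftrightarrow> 1 \<in> A \<and> (\<forall>a\<in>A. - a \<in> A) \<and> (\<forall>a\<in>A. \<forall>b\<in>A. a + b \<in> A \<and> a * b \<in> A)"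

lemma ambient_simps [simp]:
  "carrier ambient = UNIV" "\<one>\<^bsub>ambient\<^esub> = 1" "\<zero>\<^bsub>ambient\<^esub> = 0"
  "a \<otimes>\<^bsub>ambient\<^esub> b = a * b" "a \<oplus>\<^bsub>ambient\<^esub> b = a + b"
  by (simp_all add: ring_of_type_algebra_def)

lemma ambient_a_inv [simp]: "\<ominus>\<^bsub>ambient\<^esub> (a::'a::field) = - a"
proof -
  interpret ring "ambient :: 'a ring" by (rule ring_from_type_algebra)
  show ?thesis by (rule minus_equality) auto
qed

lemma subringD:
  assumes "is_subring A"
  shows subring_1: "1 \<in> A" and subring_0: "0 \<in> A"
    and subring_minus: "a \<in> A \<Longrightarrow> - a \<in> A"
    and subring_add: "a \<in> A \<Longrightarrow> b \<in> A \<Longrightarrow> a + b \<in> A"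
    and subring_mult: "a \<in> A \<Longrightarrow> b \<in> A \<Longrightarrow> a * b \<in> A"
proof -
  have "1 + (- 1) \<in> A" using assms unfolding is_subring_def by blast
  then show "0 \<in> A" by simp
qed (use assms in \<open>auto simp: is_subring_def\<close>)

lemma subring_diff: "is_subring A \<Longrightarrow> a \<in> A \<Longrightarrow> b \<in> A \<Longrightarrow> a - b \<in> A"
  using subring_add[of A a "- b"] subring_minus[of A b] by simp

lemma subring_power: "is_subring A \<Longrightarrow> a \<in> A \<Longrightarrow> a ^ n \<in> A"
  by (induction n) (auto simp: subringD)

lemma subring_sum: "is_subring A \<Longrightarrow> (\<And>i. i \<in> I \<Longrightarrow> f i \<in> A) \<Longrightarrow> sum f I \<in> A"
  by (induction I rule: infinite_finite_induct) (auto simp: subringD)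

lemma subring_prod: "is_subring A \<Longrightarrow> (\<And>i. i \<in> I \<Longrightarrow> f i \<in> A) \<Longrightarrow> prod f I \<in> A"
  by (induction I rule: infinite_finite_induct) (auto simp: subringD)

lemma subring_powi:
  assumes "is_subring A" "a \<in> A" "inverse a \<in> A" shows "a powi e \<in> A"
  unfolding power_int_def using assms by (auto intro: subring_power)

lemma is_subring_rgen [simp]: "is_subring (rgen H)"
  using generate_ring.one[of ambient H] generate_ring.a_inv[of _ ambient H]
    generate_ring.eng_add[of _ ambient H] generate_ring.eng_mult[of _ ambient H]
  unfolding is_subring_def by simp

lemmas rgen_incl = generate_ring.incl[of _ _ ambient]

lemma rgen_least:
  assumes "is_subring A" "H \<subseteq> A" shows "rgen H \<subseteq> A"
proof
  fix y assume "y \<in> rgen H"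
  then show "y \<in> A" by induction (use assms in \<open>auto simp: subringD\<close>)
qed

lemma rgen_mono: "H \<subseteq> H' \<Longrightarrow> rgen H \<subseteq> rgen H'"
  by (rule rgen_least) (auto intro: rgen_incl)

lemma rgen_subring: "is_subring A \<Longrightarrow> rgen A = A"
  using rgen_least[of A A] by (auto intro: rgen_incl)

text \<open>Unlike in \<open>laurent_ring\<close>, the variables range over an arbitrary index set,
  so that single variables can be left out or adjoined, and \<open>R\<close> may itself be such a
  ring.\<close>

definition lring :: "'a::field set \<Rightarrow> nat set \<Rightarrow> (nat \<Rightarrow> 'a) \<Rightarrow> 'a set" where
  "lring R I x = rgen (R \<union> x ` I \<union> (\<lambda>k. inverse (x k)) ` I)"

lemma laurent_ring_eq: "laurent_ring R N y = lring R {1..N} y"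
  by (simp add: laurent_ring_def lring_def)

lemma is_subring_lring [simp]: "is_subring (lring R I x)"
  by (simp add: lring_def)

lemma lring_base: "r \<in> R \<Longrightarrow> r \<in> lring R I x"
  and lring_var: "k \<in> I \<Longrightarrow> x k \<in> lring R I x"
  and lring_inv: "k \<in> I \<Longrightarrow> inverse (x k) \<in> lring R I x"
  unfolding lring_def by (auto intro: rgen_incl)

lemma lring_powi: "k \<in> I \<Longrightarrow> x k powi e \<in> lring R I x"
  by (simp add: subring_powi lring_var lring_inv)

lemma lring_least:
  assumes "is_subring A" "R \<subseteq> A" "\<And>k. k \<in> I \<Longrightarrow> x k \<in> A" "\<And>k. k \<in> I \<Longrightarrow> inverse (x k) \<in> A"
  shows "lring R I x \<subseteq> A"
  unfolding lring_def by (rule rgen_least) (use assms in auto)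

lemma lring_mono: "I \<subseteq> J \<Longrightarrow> lring R I x \<subseteq> lring R J x"
  unfolding lring_def by (rule rgen_mono) auto

lemma lring_cong: "(\<And>k. k \<in> I \<Longrightarrow> x k = y k) \<Longrightarrow> lring R I x = lring R I y"
  unfolding lring_def by (metis (no_types, lifting) image_cong)

lemma lring_lring: "lring (lring R J x) I x = lring R (J \<union> I) x"
proof
  show "lring (lring R J x) I x \<subseteq> lring R (J \<union> I) x"
    by (rule lring_least) (use lring_mono[of J "J \<union> I"] in \<open>auto intro: lring_var lring_inv\<close>)
  show "lring R (J \<union> I) x \<subseteq> lring (lring R J x) I x"
    by (rule lring_least) (auto intro: lring_base lring_var lring_inv)
qed

lemma lring_insert: "lring R (insert k I) x = lring (lring R I x) {k} x"
  by (simp add: lring_lring)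

lemma lring_empty: "is_subring R \<Longrightarrow> lring R {} x = R"
  by (simp add: lring_def rgen_subring)


section \<open>Polynomials over a subring\<close>

text \<open>Polynomials over the subring are singled out among those over the field, so that
  division and factorization over the field remain available.\<close>

definition coeffs_in :: "'a::field set \<Rightarrow> 'a poly \<Rightarrow> bool" where
  "coeffs_in C p \<longleftrightarrow> (\<forall>i. coeff p i \<in> C)"

lemma coeffs_in_0 [simp]: "is_subring C \<Longrightarrow> coeffs_in C 0"
  by (simp add: coeffs_in_def subringD)

lemma coeffs_in_add: "is_subring C \<Longrightarrow> coeffs_in C p \<Longrightarrow> coeffs_in C q \<Longrightarrow> coeffs_in C (p + q)"
  by (simp add: coeffs_in_def subringD)

lemma coeffs_in_diff: "is_subring C \<Longrightarrow> coeffs_in C p \<Longrightarrow> coeffs_in C q \<Longrightarrow> coeffs_in C (p - q)"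
  by (simp add: coeffs_in_def subring_diff)

lemma coeffs_in_mult: "is_subring C \<Longrightarrow> coeffs_in C p \<Longrightarrow> coeffs_in C q \<Longrightarrow> coeffs_in C (p * q)"
  by (simp add: coeffs_in_def coeff_mult subring_sum subring_mult)

lemma coeffs_in_monom: "is_subring C \<Longrightarrow> c \<in> C \<Longrightarrow> coeffs_in C (monom c n)"
  by (simp add: coeffs_in_def subringD)

lemma coeffs_in_smult: "is_subring C \<Longrightarrow> c \<in> C \<Longrightarrow> coeffs_in C p \<Longrightarrow> coeffs_in C (smult c p)"
  by (simp add: coeffs_in_def subringD)

lemma coeffs_in_sum: "is_subring C \<Longrightarrow> (\<And>i. i \<in> I \<Longrightarrow> coeffs_in C (f i)) \<Longrightarrow> coeffs_in C (sum f I)"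
  by (simp add: coeffs_in_def coeff_sum subring_sum)

lemma coeffs_in_power: "is_subring C \<Longrightarrow> coeffs_in C p \<Longrightarrow> coeffs_in C (p ^ n)"
  by (induction n)
     (auto intro: coeffs_in_mult simp: coeffs_in_def[of C 1] subringD coeff_1)

lemma coeffs_in_pCons: "is_subring C \<Longrightarrow> coeffs_in C (pCons a p) \<longleftrightarrow> a \<in> C \<and> coeffs_in C p"
  by (auto simp: coeffs_in_def coeff_pCons split: nat.splits)

lemma coeffs_in_mono: "C \<subseteq> C' \<Longrightarrow> coeffs_in C p \<Longrightarrow> coeffs_in C' p"
  by (auto simp: coeffs_in_def)

lemma poly_in_subring: "is_subring C \<Longrightarrow> coeffs_in C p \<Longrightarrow> t \<in> C \<Longrightarrow> poly p t \<in> C"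
  by (auto simp: poly_altdef coeffs_in_def intro!: subring_sum subring_mult subring_power)

text \<open>In \<^term>\<open>weighted C f K p\<close> the truncated difference \<open>K - j\<close> vanishes for \<open>j \<ge> K\<close>.
  The extreme case \<open>f = 1\<close> describes Laurent polynomials, and \<open>f = 0\<close> ordinary polynomials.\<close>

definition weighted :: "'a::field set \<Rightarrow> 'a \<Rightarrow> nat \<Rightarrow> 'a poly \<Rightarrow> bool" where
  "weighted C f K p \<longleftrightarrow> (\<forall>j. \<exists>c\<in>C. coeff p j = c * f ^ (K - j))"

lemma weightedD: "weighted C f K p \<Longrightarrow> \<exists>c\<in>C. coeff p j = c * f ^ (K - j)"
  by (simp add: weighted_def)

lemma weighted_coeffs_in:
  assumes "is_subring C" "f \<in> C" "weighted C f K p" shows "coeffs_in C p"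
  unfolding coeffs_in_def
  by (metis assms subring_mult subring_power weightedD)

lemma weighted_add:
  assumes "is_subring C" "weighted C f K p" "weighted C f K q" shows "weighted C f K (p + q)"
  unfolding weighted_def coeff_add
  by (metis assms distrib_right subring_add weightedD)

text \<open>For i \<le> j the truncated differences satisfy (K - i) + (L - (j - i)) \<ge> K + L - j,
  so each summand of the j-th coefficient of the product carries enough factors \<open>f\<close>.
  The surplus exponent is \<open>e\<close>.\<close>

lemma weighted_mult:
  assumes C: "is_subring C" and f: "f \<in> C" and "weighted C f K p" "weighted C f L q"
  shows "weighted C f (K + L) (p * q)"
  unfolding weighted_def
proof
  fix j
  define S where "S = {y. \<exists>c\<in>C. y = c * f ^ (K + L - j)}"
  have add: "a \<in> S \<Longrightarrow> b \<in> S \<Longrightarrow> a + b \<in> S" for a b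
    unfolding S_def by (clarsimp) (metis C distrib_right subring_add)
  have zero: "0 \<in> S" using subring_0[OF C] by (force simp: S_def)
  have "coeff p i * coeff q (j - i) \<in> S" if "i \<le> j" for i :: nat
  proof -
    obtain c where c: "c \<in> C" "coeff p i = c * f ^ (K - i)" using assms(3) weightedD by blast
    obtain c' where c': "c' \<in> C" "coeff q (j - i) = c' * f ^ (L - (j - i))"
      using assms(4) weightedD by blast
    define e where "e = (K - i) + (L - (j - i)) - (K + L - j)"
    have e: "(K - i) + (L - (j - i)) = e + (K + L - j)" using that unfolding e_def by linarith
    have "coeff p i * coeff q (j - i) = c * c' * f ^ ((K - i) + (L - (j - i)))"
      by (simp add: c c' power_add)
    also have "\<dots> = (c * c' * f ^ e) * f ^ (K + L - j)"
      unfolding e by (simp add: power_add)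
    finally have "coeff p i * coeff q (j - i) = (c * c' * f ^ e) * f ^ (K + L - j)" .
    moreover have "c * c' * f ^ e \<in> C" using C f c c' by (simp add: subring_mult subring_power)
    ultimately show ?thesis unfolding S_def by blast
  qed
  then have "(\<Sum>i\<in>A. coeff p i * coeff q (j - i)) \<in> S" if "A \<subseteq> {..j}" for A
    using that
  proof (induction A rule: infinite_finite_induct)
    case (insert a A)
    then show ?case by (subst sum.insert) (auto intro!: add)
  qed (use zero in simp_all)
  then show "\<exists>c\<in>C. coeff (p * q) j = c * f ^ (K + L - j)"
    unfolding coeff_mult S_def by blast
qed

lemma weighted_monom:
  assumes "is_subring C" "c \<in> C" "K \<le> j" shows "weighted C f K (monom c j)"
  unfolding weighted_def
proof
  fix i show "\<exists>d\<in>C. coeff (monom c j) i = d * f ^ (K - i)"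
    using assms by (cases "i = j") (auto intro: bexI[of _ c] bexI[of _ 0] simp: subringD)
qed

lemma weighted_monom':
  assumes "is_subring C" "c \<in> C" shows "weighted C f K (monom (c * f ^ (K - j)) j)"
  unfolding weighted_def
proof
  fix i show "\<exists>d\<in>C. coeff (monom (c * f ^ (K - j)) j) i = d * f ^ (K - i)"
    using assms by (cases "i = j") (auto intro: bexI[of _ c] bexI[of _ 0] simp: subringD)
qed

text \<open>An element of C[t, f/t] is a Laurent polynomial in t in which the coefficient of each
  negative power t^(-e) is divisible by f^e; multiplying by t^K turns this into the condition
  \<open>weighted\<close>. Uniqueness of \<open>p\<close> for given \<open>K\<close> comes only with
  transcendence of \<open>t\<close>.\<close>

lemma rgen_pair_iff:
  fixes t f :: "'a::field"
  assumes C: "is_subring C" and f: "f \<in> C" and t: "t \<noteq> 0"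
  shows "y \<in> rgen (C \<union> {t, f / t}) \<longleftrightarrow> (\<exists>K p. y * t ^ K = poly p t \<and> weighted C f K p)"
    (is "_ \<longleftrightarrow> ?P y")
proof
  have raise: "\<exists>p'. y * t ^ (K + L) = poly p' t \<and> weighted C f (K + L) p'"
    if "y * t ^ K = poly p t" "weighted C f K p" for y K L p
    by (rule exI[of _ "p * monom 1 L"])
       (use that weighted_mult[OF C f that(2) weighted_monom[OF C subring_1[OF C] order_refl, of f L]]
         in \<open>simp add: power_add poly_monom mult_ac\<close>)
  show "?P y" if "y \<in> rgen (C \<union> {t, f / t})"
  proof -
    have "is_subring {y. ?P y}"
      unfolding is_subring_def
    proof (intro conjI ballI)
      have "weighted C f 0 1"
        using weighted_monom[OF C subring_1[OF C], of 0 0 f] by (simp add: monom_0 one_pCons)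
      moreover have "(1::'a) * t ^ 0 = poly 1 t" by simp
      ultimately show "1 \<in> {y. ?P y}" by blast
      fix a assume "a \<in> {y. ?P y}"
      then obtain K p where p: "a * t ^ K = poly p t" "weighted C f K p" by blast
      have "weighted C f K (- p)" unfolding weighted_def coeff_minus
        by (metis p(2) C minus_mult_left subring_minus weightedD)
      then show "- a \<in> {y. ?P y}" using p(1) by (force intro!: exI[of _ K] exI[of _ "- p"])
      fix b assume "b \<in> {y. ?P y}"
      then obtain L q where q: "b * t ^ L = poly q t" "weighted C f L q" by blast
      obtain p' where p': "a * t ^ (K + L) = poly p' t" "weighted C f (K + L) p'"
        using raise[OF p] by blast
      obtain q' where q': "b * t ^ (K + L) = poly q' t" "weighted C f (K + L) q'"
        using raise[OF q, of K] by (metis add.commute)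
      have "(a + b) * t ^ (K + L) = poly (p' + q') t" using p' q' by (simp add: distrib_right)
      then show "a + b \<in> {y. ?P y}" using weighted_add[OF C p'(2) q'(2)] by blast
      have "(a * b) * t ^ (K + L) = poly (p * q) t"
        by (simp add: p(1)[symmetric] q(1)[symmetric] power_add mult_ac)
      then show "a * b \<in> {y. ?P y}" using weighted_mult[OF C f p(2) q(2)] by blast
    qed
    moreover have "C \<union> {t, f / t} \<subseteq> {y. ?P y}"
    proof -
      have "?P c" if "c \<in> C" for c
        by (rule exI[of _ 0], rule exI[of _ "monom c 0"])
           (use that C in \<open>auto simp: poly_monom intro: weighted_monom\<close>)
      moreover have "?P t"
        by (rule exI[of _ 0], rule exI[of _ "monom 1 1"])
           (use C in \<open>auto simp: poly_monom subringD intro: weighted_monom\<close>)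
      moreover have "?P (f / t)"
        by (rule exI[of _ 1], rule exI[of _ "monom (1 * f ^ (1 - 0)) 0"], rule conjI)
           (use t in \<open>simp add: poly_monom\<close>, rule weighted_monom'[OF C subring_1[OF C]])
      ultimately show ?thesis by auto
    qed
    ultimately show "?P y" using rgen_least that by blast
  qed
  assume "?P y"
  then obtain K p where p: "y * t ^ K = poly p t" "weighted C f K p" by blast
  let ?D = "rgen (C \<union> {t, f / t})"
  have D: "is_subring ?D" by simp
  have "y = poly p t / t ^ K" using p(1) t by (simp add: field_simps)
  also have "\<dots> = (\<Sum>j\<le>degree p. coeff p j * t ^ j / t ^ K)"
    by (simp add: poly_altdef sum_divide_distrib)
  also have "\<dots> \<in> ?D"
  proof (rule subring_sum[OF D])
    fix j
    obtain c where c: "c \<in> C" "coeff p j = c * f ^ (K - j)" using p(2) weightedD by blast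
    show "coeff p j * t ^ j / t ^ K \<in> ?D"
    proof (cases "j \<le> K")
      case True
      then have "t ^ K = t ^ j * t ^ (K - j)" by (simp flip: power_add)
      then have "coeff p j * t ^ j / t ^ K = c * (f / t) ^ (K - j)"
        using t c(2) by (simp add: power_divide)
      then show ?thesis using c(1) by (auto intro!: subring_mult subring_power D intro: rgen_incl)
    next
      case False
      then have "t ^ j = t ^ K * t ^ (j - K)" by (simp flip: power_add)
      then have "coeff p j * t ^ j / t ^ K = c * t ^ (j - K)"
        using t c(2) False by simp
      then show ?thesis using c(1) by (auto intro!: subring_mult subring_power D intro: rgen_incl)
    qed
  qed
  finally show "y \<in> ?D" .
qed

lemma weighted_1: "weighted C 1 K p \<longleftrightarrow> coeffs_in C p"
  by (simp add: weighted_def coeffs_in_def)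

lemma lring_singleton: "is_subring R \<Longrightarrow> lring R {k} x = rgen (R \<union> {x k, 1 / x k})"
  by (simp add: lring_def insert_commute inverse_eq_divide)

section \<open>Transcendence and algebraic independence\<close>

definition transc :: "'a::field set \<Rightarrow> 'a \<Rightarrow> bool" where
  "transc C t \<longleftrightarrow> (\<forall>p. coeffs_in C p \<longrightarrow> poly p t = 0 \<longrightarrow> p = 0)"

lemma transcD: "transc C t \<Longrightarrow> coeffs_in C p \<Longrightarrow> poly p t = 0 \<Longrightarrow> p = 0"
  by (simp add: transc_def)

lemma transc_antimono: "C' \<subseteq> C \<Longrightarrow> transc C t \<Longrightarrow> transc C' t"
  unfolding transc_def using coeffs_in_mono by blast

lemma transc_nonzero:
  assumes "is_subring C" "transc C t" shows "t \<noteq> 0"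
proof
  assume "t = 0"
  moreover have "coeffs_in C [:0, 1:]" using assms(1) by (simp add: coeffs_in_pCons subringD)
  ultimately show False using transcD[OF assms(2), of "[:0, 1:]"] by simp
qed

lemma transc_eqD:
  assumes "is_subring C" "transc C t" "coeffs_in C p" "coeffs_in C q" "poly p t = poly q t"
  shows "p = q"
  using transcD[OF assms(2), of "p - q"] assms by (simp add: coeffs_in_diff)

lemma common_denominator:
  assumes "finite J" "is_subring C" "t \<noteq> 0"
    "\<And>j. j \<in> J \<Longrightarrow> y j \<in> rgen (C \<union> {t, 1 / t})"
  shows "\<exists>K. \<forall>j\<in>J. \<exists>p. y j * t ^ K = poly p t \<and> coeffs_in C p"
  using assms(1,4)
proof (induction J rule: finite_induct)
  case (insert a J)
  then obtain K where K: "\<forall>j\<in>J. \<exists>p. y j * t ^ K = poly p t \<and> coeffs_in C p" by auto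
  obtain L p where p: "y a * t ^ L = poly p t" "coeffs_in C p"
    using insert.prems[of a] rgen_pair_iff[of C 1 t "y a"] assms(2,3) by (auto simp: subringD weighted_1)
  have raise: "\<exists>p'. z * t ^ (m + n) = poly p' t \<and> coeffs_in C p'"
    if "z * t ^ m = poly q t" "coeffs_in C q" for z m n q
  proof (intro exI conjI)
    show "z * t ^ (m + n) = poly (q * monom 1 n) t"
      by (simp add: power_add poly_monom that(1)[symmetric] mult.assoc)
    show "coeffs_in C (q * monom 1 n)"
      by (intro coeffs_in_mult coeffs_in_monom assms(2) that(2) subring_1)
  qed
  have "\<exists>p. y j * t ^ (K + L) = poly p t \<and> coeffs_in C p" if j: "j \<in> insert a J" for j
  proof (cases "j = a")
    case True
    then show ?thesis using raise[OF p, of K] by (simp add: add.commute)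
  next
    case False
    then show ?thesis using K raise j by blast
  qed
  then show ?case by blast
qed auto

text \<open>A relation for s over G[t, 1/t] becomes, after clearing powers of t, a vanishing double
  sum of powers of s and t. Read as a polynomial in t it has coefficients in G[s], which vanish by
  transcendence of t; each of them is a relation for s over G and hence trivial.\<close>

lemma transc_exchange:
  assumes G: "is_subring G" and s: "transc G s" and t: "transc (rgen (G \<union> {s, 1 / s})) t"
  shows "transc (rgen (G \<union> {t, 1 / t})) s"
  unfolding transc_def
proof (intro allI impI)
  let ?S = "rgen (G \<union> {s, 1 / s})"
  have S: "is_subring ?S" by simp
  have GS: "G \<subseteq> ?S" by (auto intro: rgen_incl)
  have t0: "t \<noteq> 0" using transc_nonzero[OF _ t] by simp
  fix P assume P: "coeffs_in (rgen (G \<union> {t, 1 / t})) P" and "poly P s = 0"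
  obtain K where "\<forall>j\<in>{..degree P}. \<exists>p. coeff P j * t ^ K = poly p t \<and> coeffs_in G p"
    using common_denominator[of "{..degree P}" G t "coeff P"] G t0 P by (auto simp: coeffs_in_def)
  then obtain q where q: "\<And>j. j \<le> degree P \<Longrightarrow> coeff P j * t ^ K = poly (q j) t"
    "\<And>j. j \<le> degree P \<Longrightarrow> coeffs_in G (q j)" by (metis atMost_iff)
  define Q where "Q = (\<Sum>j\<le>degree P. smult (s ^ j) (q j))"
  have "coeffs_in ?S Q"
    unfolding Q_def
    by (intro coeffs_in_sum coeffs_in_smult subring_power S coeffs_in_mono[OF GS q(2)])
       (auto intro: rgen_incl)
  moreover have "poly Q t = poly P s * t ^ K"
    unfolding Q_def poly_sum poly_altdef[of P] sum_distrib_right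
    by (intro sum.cong) (auto simp: q(1)[symmetric])
  then have "poly Q t = 0" using \<open>poly P s = 0\<close> by simp
  ultimately have "Q = 0" using transcD[OF t] by blast
  have q0: "coeff (q j) i = 0" if "j \<le> degree P" for i j
  proof -
    \<comment> \<open>The coefficient of the i-th power of t in the double sum, as a polynomial in
      s.\<close>
    define r where "r = (\<Sum>j\<le>degree P. monom (coeff (q j) i) j)"
    have "coeffs_in G r" unfolding r_def
      by (intro coeffs_in_sum coeffs_in_monom G) (use q(2) in \<open>simp add: coeffs_in_def\<close>)
    moreover have "poly r s = coeff Q i"
      by (simp add: r_def Q_def poly_sum coeff_sum poly_monom mult.commute)
    ultimately have "r = 0" using transcD[OF s] \<open>Q = 0\<close> by simp
    moreover have "coeff r j = coeff (q j) i"
      using that by (simp add: r_def coeff_sum)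
    ultimately show ?thesis by simp
  qed
  have "coeff P j = 0" for j
  proof (cases "j \<le> degree P")
    case True
    then have "q j = 0" using q0 by (intro poly_eqI) auto
    then show ?thesis using q(1)[OF True] t0 by simp
  qed (simp add: coeff_eq_0)
  then show "P = 0" by (intro poly_eqI) auto
qed

text \<open>Algebraic independence, one variable at a time over the Laurent ring in the remaining
  ones; for I = {1..N} it agrees with the official notion by
  \<open>algebraically_independent_iff_ind\<close>. This form allows arguments with univariate
  polynomials.\<close>

definition ind :: "'a::field set \<Rightarrow> nat set \<Rightarrow> (nat \<Rightarrow> 'a) \<Rightarrow> bool" where
  "ind R I x \<longleftrightarrow> (\<forall>k\<in>I. transc (lring R (I - {k}) x) (x k))"

lemma ind_transc: "ind R I x \<Longrightarrow> k \<in> I \<Longrightarrow> J \<subseteq> I - {k} \<Longrightarrow> transc (lring R J x) (x k)"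
  unfolding ind_def by (meson lring_mono transc_antimono)

lemma ind_nonzero: "ind R I x \<Longrightarrow> k \<in> I \<Longrightarrow> x k \<noteq> 0"
  by (rule transc_nonzero[of "lring R (I - {k}) x"]) (auto intro: ind_transc)

lemma ind_subset: "ind R I x \<Longrightarrow> J \<subseteq> I \<Longrightarrow> ind R J x"
  unfolding ind_def by (meson Diff_mono lring_mono order_refl subsetD transc_antimono)

lemma ind_lring:
  assumes "ind R (J \<union> I) x" "J \<inter> I = {}" shows "ind (lring R J x) I x"
  unfolding ind_def lring_lring
proof
  fix k assume "k \<in> I"
  then have "J \<union> (I - {k}) = J \<union> I - {k}" using assms(2) by auto
  then show "transc (lring R (J \<union> (I - {k})) x) (x k)"
    using assms(1) \<open>k \<in> I\<close> by (auto simp: ind_def)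
qed

lemma lring_insert_rgen: "lring R (insert k I) x = rgen (lring R I x \<union> {x k, 1 / x k})"
  by (subst lring_insert, rule lring_singleton) auto

text \<open>For an old index \<open>j\<close> the roles of \<open>x j\<close> and of the new
  variable \<open>x k\<close> are interchanged by \<open>transc_exchange\<close>.\<close>

lemma ind_insert:
  assumes "ind R I x" "k \<notin> I" "transc (lring R I x) (x k)"
  shows "ind R (insert k I) x"
  unfolding ind_def
proof
  fix j assume j: "j \<in> insert k I"
  show "transc (lring R (insert k I - {j}) x) (x j)"
  proof (cases "j = k")
    case True
    then show ?thesis using assms by simp
  next
    case False
    then have "I = insert j (I - {j})" "insert k I - {j} = insert k (I - {j})" using j by auto
    then show ?thesis
      using transc_exchange[of "lring R (I - {j}) x" "x j" "x k"] assms(1,3) j False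
      by (metis ind_def insertE is_subring_lring lring_insert_rgen)
  qed
qed

lemma ind_update:
  assumes "ind R I x" "i \<in> I" "transc (lring R (I - {i}) x) t"
  shows "ind R I (x(i := t))"
proof -
  have eq: "lring R J (x(i := t)) = lring R J x" if "i \<notin> J" for J
    by (rule lring_cong) (use that in auto)
  have "ind R (I - {i}) (x(i := t))"
    using ind_subset[OF assms(1), of "I - {i}"] unfolding ind_def
    by (simp add: eq)
  then have "ind R (insert i (I - {i})) (x(i := t))"
    by (rule ind_insert) (use assms(3) in \<open>simp_all add: eq\<close>)
  then show ?thesis using assms(2) by (simp add: insert_absorb)
qed

text \<open>Multiplying a relation for f/t by a power of t reverses its coefficients, the j-th one
  acquiring the factor f^j; the result is a relation for t.\<close>

lemma transc_divide:
  assumes C: "is_subring C" and t: "transc C t" and f: "f \<in> C" "f \<noteq> 0"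
  shows "transc C (f / t)"
  unfolding transc_def
proof (intro allI impI)
  fix p assume p: "coeffs_in C p" "poly p (f / t) = 0"
  have t0: "t \<noteq> 0" using transc_nonzero[OF C t] .
  define q where "q = (\<Sum>j\<le>degree p. monom (coeff p j * f ^ j) (degree p - j))"
  have "coeffs_in C q" unfolding q_def
    by (intro coeffs_in_sum coeffs_in_monom subring_mult subring_power C f(1))
       (use p in \<open>simp add: coeffs_in_def\<close>)
  moreover have "poly q t = poly p (f / t) * t ^ degree p"
    unfolding q_def poly_sum poly_altdef[of p] sum_distrib_right
  proof (rule sum.cong)
    fix j assume "j \<in> {..degree p}"
    then have "t ^ degree p = t ^ j * t ^ (degree p - j)" by (simp flip: power_add)
    then show "poly (monom (coeff p j * f ^ j) (degree p - j)) t = coeff p j * (f / t) ^ j * t ^ degree p"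
      using t0 by (simp add: poly_monom power_divide)
  qed simp
  ultimately have "q = 0" using transcD[OF t] p by simp
  have "coeff q (degree p - i) = coeff p i * f ^ i" if "i \<le> degree p" for i
  proof -
    have "coeff q (degree p - i) = (\<Sum>j\<le>degree p. if j = i then coeff p j * f ^ j else 0)"
      unfolding q_def coeff_sum by (intro sum.cong) (use that in auto)
    then show ?thesis using that by simp
  qed
  then have "coeff p i = 0" for i
    using \<open>q = 0\<close> f(2) by (cases "i \<le> degree p") (auto simp: coeff_eq_0)
  then show "p = 0" by (intro poly_eqI) auto
qed

subsection \<open>Comparison with polynomial evaluation\<close>

definition monom_eval :: "(nat \<Rightarrow>\<^sub>0 nat) \<Rightarrow> (nat \<Rightarrow> 'a::field) \<Rightarrow> 'a" where
  "monom_eval \<alpha> x = (\<Prod>k \<in> Poly_Mapping.keys \<alpha>. x k ^ Poly_Mapping.lookup \<alpha> k)"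

lemma monom_eval_superset:
  assumes "finite S" "Poly_Mapping.keys \<alpha> \<subseteq> S"
  shows "monom_eval \<alpha> x = (\<Prod>k\<in>S. x k ^ Poly_Mapping.lookup \<alpha> k)"
  unfolding monom_eval_def by (rule prod.mono_neutral_left) (use assms in \<open>auto simp: in_keys_iff\<close>)

lemma monom_eval_0 [simp]: "monom_eval 0 x = 1"
  by (simp add: monom_eval_def)

lemma monom_eval_add: "monom_eval (\<alpha> + \<beta>) x = monom_eval \<alpha> x * monom_eval \<beta> x"
proof -
  let ?S = "Poly_Mapping.keys \<alpha> \<union> Poly_Mapping.keys \<beta>"
  show ?thesis
    using keys_add[of \<alpha> \<beta>]
    by (simp add: monom_eval_superset[of ?S] lookup_add power_add prod.distrib)
qed

lemma monom_eval_single [simp]: "monom_eval (Poly_Mapping.single k j) x = x k ^ j"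
  by (subst monom_eval_superset[of "{k}"]) (auto split: if_splits)

lemma monom_eval_nonzero:
  "(\<And>k. k \<in> Poly_Mapping.keys \<alpha> \<Longrightarrow> x k \<noteq> 0) \<Longrightarrow> monom_eval \<alpha> x \<noteq> 0"
  by (simp add: monom_eval_def)

lemma poly_eval_superset:
  assumes "finite S" "Poly_Mapping.keys p \<subseteq> S"
  shows "poly_eval p x = (\<Sum>\<alpha>\<in>S. Poly_Mapping.lookup p \<alpha> * monom_eval \<alpha> x)"
  unfolding poly_eval_def monom_eval_def
  by (rule sum.mono_neutral_left) (use assms in \<open>auto simp: in_keys_iff\<close>)

lemma poly_eval_0 [simp]: "poly_eval 0 x = 0"
  by (simp add: poly_eval_def)

lemma poly_eval_add: "poly_eval (p + q) x = poly_eval p x + poly_eval q x"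
proof -
  let ?S = "Poly_Mapping.keys p \<union> Poly_Mapping.keys q"
  show ?thesis
    using keys_add[of p q]
    by (simp add: poly_eval_superset[of ?S] lookup_add distrib_right sum.distrib)
qed

lemma poly_eval_sum: "poly_eval (\<Sum>i\<in>A. p i) x = (\<Sum>i\<in>A. poly_eval (p i) x)"
  by (induction A rule: infinite_finite_induct) (auto simp: poly_eval_add)

lemma poly_eval_uminus: "poly_eval (- p) x = - poly_eval p x"
  using poly_eval_add[of p "- p" x] by (simp add: minus_unique[symmetric])

lemma poly_eval_single [simp]: "poly_eval (Poly_Mapping.single \<alpha> c) x = c * monom_eval \<alpha> x"
  by (subst poly_eval_superset[of "{\<alpha>}"]) (auto split: if_splits)

lemma poly_mapping_expand:
  "(p :: 'k \<Rightarrow>\<^sub>0 'a::comm_monoid_add) =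
    (\<Sum>\<alpha>\<in>Poly_Mapping.keys p. Poly_Mapping.single \<alpha> (Poly_Mapping.lookup p \<alpha>))"
proof (rule poly_mapping_eqI)
  fix \<beta>
  have "Poly_Mapping.lookup (\<Sum>\<alpha>\<in>Poly_Mapping.keys p. Poly_Mapping.single \<alpha> (Poly_Mapping.lookup p \<alpha>)) \<beta>
      = (\<Sum>\<alpha>\<in>Poly_Mapping.keys p. if \<alpha> = \<beta> then Poly_Mapping.lookup p \<alpha> else 0)"
    unfolding lookup_sum by (intro sum.cong) (auto simp: lookup_single when_def)
  also have "\<dots> = Poly_Mapping.lookup p \<beta>" by (simp add: in_keys_iff)
  finally show "Poly_Mapping.lookup p \<beta> = Poly_Mapping.lookup
      (\<Sum>\<alpha>\<in>Poly_Mapping.keys p. Poly_Mapping.single \<alpha> (Poly_Mapping.lookup p \<alpha>)) \<beta>" by simp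
qed

lemma poly_eval_mult: "poly_eval (p * q) x = poly_eval p x * poly_eval q x"
proof -
  have 1: "poly_eval (Poly_Mapping.single \<alpha> c * q) x = c * monom_eval \<alpha> x * poly_eval q x" for \<alpha> c
  proof -
    have "poly_eval (Poly_Mapping.single \<alpha> c * q) x =
      poly_eval (\<Sum>\<beta>\<in>Poly_Mapping.keys q. Poly_Mapping.single (\<alpha> + \<beta>) (c * Poly_Mapping.lookup q \<beta>)) x"
      by (subst poly_mapping_expand[of q]) (simp add: sum_distrib_left mult_single)
    also have "\<dots> = c * monom_eval \<alpha> x * poly_eval q x"
      by (simp add: poly_eval_sum monom_eval_add poly_eval_superset[of "Poly_Mapping.keys q" q]
          sum_distrib_left mult_ac)
    finally show ?thesis .
  qed
  have "poly_eval (p * q) x =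
    poly_eval (\<Sum>\<alpha>\<in>Poly_Mapping.keys p. Poly_Mapping.single \<alpha> (Poly_Mapping.lookup p \<alpha>) * q) x"
    by (subst poly_mapping_expand[of p]) (simp add: sum_distrib_right)
  also have "\<dots> = poly_eval p x * poly_eval q x"
    by (simp add: poly_eval_sum 1 poly_eval_superset[of "Poly_Mapping.keys p" p] sum_distrib_right)
  finally show ?thesis .
qed

lemma poly_eval_1 [simp]: "poly_eval 1 x = 1"
  by (metis monom_eval_0 mult_1 poly_eval_single single_one)


lemma lookup_mult_single:
  fixes p :: "(nat \<Rightarrow>\<^sub>0 nat) \<Rightarrow>\<^sub>0 'a::field"
  shows "Poly_Mapping.lookup (p * Poly_Mapping.single \<beta> c) \<gamma> =
    (\<Sum>\<alpha>\<in>Poly_Mapping.keys p. if \<alpha> + \<beta> = \<gamma> then Poly_Mapping.lookup p \<alpha> * c else 0)"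
proof -
  have "p * Poly_Mapping.single \<beta> c =
    (\<Sum>\<alpha>\<in>Poly_Mapping.keys p. Poly_Mapping.single (\<alpha> + \<beta>) (Poly_Mapping.lookup p \<alpha> * c))"
    by (subst poly_mapping_expand[of p]) (simp add: sum_distrib_right mult_single)
  then show ?thesis
    by (simp add: lookup_sum) (intro sum.cong, auto simp: lookup_single when_def)
qed

lemma lookup_mult_single_add:
  fixes p :: "(nat \<Rightarrow>\<^sub>0 nat) \<Rightarrow>\<^sub>0 'a::field"
  shows "Poly_Mapping.lookup (p * Poly_Mapping.single \<beta> c) (\<gamma> + \<beta>) = Poly_Mapping.lookup p \<gamma> * c"
  unfolding lookup_mult_single by (simp add: in_keys_iff)

definition poly_over :: "'a::field set \<Rightarrow> nat set \<Rightarrow> ((nat \<Rightarrow>\<^sub>0 nat) \<Rightarrow>\<^sub>0 'a) \<Rightarrow> bool" where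
  "poly_over R I p \<longleftrightarrow> (\<forall>\<alpha>. Poly_Mapping.lookup p \<alpha> \<in> R) \<and>
    (\<forall>\<alpha>\<in>Poly_Mapping.keys p. Poly_Mapping.keys \<alpha> \<subseteq> I)"

lemma algebraically_independent_iff:
  "algebraically_independent R N x \<longleftrightarrow> (\<forall>p. poly_over R {1..N} p \<longrightarrow> poly_eval p x = 0 \<longrightarrow> p = 0)"
  unfolding algebraically_independent_def poly_over_def by (auto simp: image_subset_iff)

lemma poly_over_single:
  "is_subring R \<Longrightarrow> c \<in> R \<Longrightarrow> Poly_Mapping.keys \<alpha> \<subseteq> I \<Longrightarrow> poly_over R I (Poly_Mapping.single \<alpha> c)"
  by (auto simp: poly_over_def lookup_single when_def subringD split: if_splits)

lemma poly_over_add: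
  "is_subring R \<Longrightarrow> poly_over R I p \<Longrightarrow> poly_over R I q \<Longrightarrow> poly_over R I (p + q)"
  using keys_add[of p q] by (fastforce simp: poly_over_def lookup_add subringD)

lemma poly_over_sum:
  "is_subring R \<Longrightarrow> (\<And>i. i \<in> A \<Longrightarrow> poly_over R I (p i)) \<Longrightarrow> poly_over R I (\<Sum>i\<in>A. p i)"
  by (induction A rule: infinite_finite_induct)
     (auto intro: poly_over_add simp: poly_over_def[of _ _ 0] subringD)

lemma poly_over_uminus: "is_subring R \<Longrightarrow> poly_over R I p \<Longrightarrow> poly_over R I (- p)"
  by (auto simp: poly_over_def subringD)

lemma poly_over_mult:
  assumes R: "is_subring R" and p: "poly_over R I p" and q: "poly_over R I q"
  shows "poly_over R I (p * q)"
proof -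
  have "p * q = (\<Sum>\<alpha>\<in>Poly_Mapping.keys p. \<Sum>\<beta>\<in>Poly_Mapping.keys q.
      Poly_Mapping.single (\<alpha> + \<beta>) (Poly_Mapping.lookup p \<alpha> * Poly_Mapping.lookup q \<beta>))"
    by (subst poly_mapping_expand[of p], subst poly_mapping_expand[of q])
       (simp add: sum_product mult_single)
  also have "poly_over R I \<dots>"
  proof (intro poly_over_sum poly_over_single R subring_mult)
    fix \<alpha> \<beta> assume "\<alpha> \<in> Poly_Mapping.keys p" "\<beta> \<in> Poly_Mapping.keys q"
    then show "Poly_Mapping.keys (\<alpha> + \<beta>) \<subseteq> I"
      using keys_add[of \<alpha> \<beta>] p q unfolding poly_over_def by blast
  qed (use p q in \<open>auto simp: poly_over_def\<close>)
  finally show ?thesis .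
qed

lemma poly_eval_in_lring:
  assumes "poly_over R I p" shows "poly_eval p x \<in> lring R I x"
  unfolding poly_eval_def
proof (intro subring_sum subring_mult subring_prod subring_power is_subring_lring)
  fix \<alpha> assume \<alpha>: "\<alpha> \<in> Poly_Mapping.keys p"
  show "Poly_Mapping.lookup p \<alpha> \<in> lring R I x"
    using assms by (auto simp: poly_over_def intro: lring_base)
  fix k assume "k \<in> Poly_Mapping.keys \<alpha>"
  then show "x k \<in> lring R I x" using assms \<alpha> by (auto simp: poly_over_def intro!: lring_var)
qed

text \<open>The elements that admit a monomial denominator form a subring containing all
  generators.\<close>

lemma lring_fraction:
  assumes R: "is_subring R" and nz: "\<And>k. k \<in> I \<Longrightarrow> x k \<noteq> 0" and y: "y \<in> lring R I x"
  shows "\<exists>\<alpha> p. Poly_Mapping.keys \<alpha> \<subseteq> I \<and> poly_over R I p \<and> y * monom_eval \<alpha> x = poly_eval p x"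
    (is "?P y")
proof -
  have base: "?P y" if "y = poly_eval p x" "poly_over R I p" for y p
    by (rule exI[of _ 0], rule exI[of _ p]) (use that in simp)
  have "is_subring {y. ?P y}"
    unfolding is_subring_def
  proof (intro conjI ballI)
    show "1 \<in> {y. ?P y}"
      using base[of 1 "Poly_Mapping.single 0 1"] poly_over_single[OF R subring_1[OF R], of 0 I]
      by simp
    fix a assume "a \<in> {y. ?P y}"
    then obtain \<alpha> p where p: "Poly_Mapping.keys \<alpha> \<subseteq> I" "poly_over R I p" "a * monom_eval \<alpha> x = poly_eval p x"
      by blast
    have "- a * monom_eval \<alpha> x = poly_eval (- p) x" by (simp add: poly_eval_uminus p(3)[symmetric])
    then show "- a \<in> {y. ?P y}" using p(1) poly_over_uminus[OF R p(2)] by blast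
    fix b assume "b \<in> {y. ?P y}"
    then obtain \<beta> q where q: "Poly_Mapping.keys \<beta> \<subseteq> I" "poly_over R I q" "b * monom_eval \<beta> x = poly_eval q x"
      by blast
    have keys: "Poly_Mapping.keys (\<alpha> + \<beta>) \<subseteq> I" using keys_add[of \<alpha> \<beta>] p(1) q(1) by blast
    have "(a + b) * monom_eval (\<alpha> + \<beta>) x =
      poly_eval (p * Poly_Mapping.single \<beta> 1 + q * Poly_Mapping.single \<alpha> 1) x"
      by (simp add: poly_eval_add poly_eval_mult monom_eval_add p(3)[symmetric] q(3)[symmetric] algebra_simps)
    moreover have "poly_over R I (p * Poly_Mapping.single \<beta> 1 + q * Poly_Mapping.single \<alpha> 1)"
      by (intro poly_over_add poly_over_mult poly_over_single R p q subring_1)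
    ultimately show "a + b \<in> {y. ?P y}" using keys by blast
    have "a * b * monom_eval (\<alpha> + \<beta>) x = poly_eval (p * q) x"
      by (simp add: poly_eval_mult monom_eval_add p(3)[symmetric] q(3)[symmetric])
    then show "a * b \<in> {y. ?P y}" using keys poly_over_mult[OF R p(2) q(2)] by blast
  qed
  moreover have "?P r" if "r \<in> R" for r
    by (rule base[of _ "Poly_Mapping.single 0 r"]) (use that R in \<open>auto intro: poly_over_single\<close>)
  moreover have "?P (x k)" if "k \<in> I" for k
    by (rule base[of _ "Poly_Mapping.single (Poly_Mapping.single k 1) 1"])
       (use that R in \<open>auto intro: poly_over_single subring_1\<close>)
  moreover have "?P (inverse (x k))" if "k \<in> I" for k
    by (rule exI[of _ "Poly_Mapping.single k 1"], rule exI[of _ "Poly_Mapping.single 0 1"])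
       (use that nz poly_over_single[OF R subring_1[OF R], of 0 I] in auto)
  ultimately have "lring R I x \<subseteq> {y. ?P y}" by (intro lring_least) auto
  then show ?thesis using y by blast
qed

text \<open>The \<open>P j\<close> do not involve the variable \<open>k\<close>, so their multiples
  by different powers of it have disjoint supports and nothing can cancel.\<close>

lemma poly_over_separate:
  fixes P :: "nat \<Rightarrow> (nat \<Rightarrow>\<^sub>0 nat) \<Rightarrow>\<^sub>0 'a::field"
  assumes "finite J" "\<And>j. j \<in> J \<Longrightarrow> poly_over R I (P j)" "k \<notin> I"
    and 0: "(\<Sum>j\<in>J. P j * Poly_Mapping.single (Poly_Mapping.single k j) 1) = 0" and j: "j \<in> J"
  shows "P j = 0"
proof (rule ccontr)
  assume "P j \<noteq> 0"
  then obtain \<gamma> where \<gamma>: "\<gamma> \<in> Poly_Mapping.keys (P j)" by (metis keys_eq_empty all_not_in_conv)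
  have k0: "Poly_Mapping.lookup \<alpha> k = 0" if "\<alpha> \<in> Poly_Mapping.keys (P i)" "i \<in> J" for \<alpha> i
    using assms(2)[OF that(2)] that(1) assms(3) unfolding poly_over_def
    by (meson in_keys_iff subsetD)
  have other: "Poly_Mapping.lookup (P i * Poly_Mapping.single (Poly_Mapping.single k i) 1)
      (\<gamma> + Poly_Mapping.single k j) = 0" if i: "i \<in> J" "i \<noteq> j" for i
    unfolding lookup_mult_single
  proof (intro sum.neutral ballI)
    fix \<alpha> assume \<alpha>: "\<alpha> \<in> Poly_Mapping.keys (P i)"
    have "\<alpha> + Poly_Mapping.single k i \<noteq> \<gamma> + Poly_Mapping.single k j"
    proof
      assume "\<alpha> + Poly_Mapping.single k i = \<gamma> + Poly_Mapping.single k j"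
      then have "Poly_Mapping.lookup (\<alpha> + Poly_Mapping.single k i) k =
        Poly_Mapping.lookup (\<gamma> + Poly_Mapping.single k j) k" by simp
      then show False using k0[OF \<alpha> i(1)] k0[OF \<gamma> j] i(2) by (simp add: lookup_add)
    qed
    then show "(if \<alpha> + Poly_Mapping.single k i = \<gamma> + Poly_Mapping.single k j
      then Poly_Mapping.lookup (P i) \<alpha> * 1 else 0) = 0" by simp
  qed
  have "0 = Poly_Mapping.lookup (\<Sum>i\<in>J. P i * Poly_Mapping.single (Poly_Mapping.single k i) 1)
      (\<gamma> + Poly_Mapping.single k j)" unfolding 0 by simp
  also have "\<dots> = (\<Sum>i\<in>J. if i = j then Poly_Mapping.lookup (P j) \<gamma> else 0)"
    unfolding lookup_sum
    by (intro sum.cong) (auto simp: other lookup_mult_single_add)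
  also have "\<dots> = Poly_Mapping.lookup (P j) \<gamma>" using assms(1) j by simp
  finally show False using \<gamma> by (simp add: in_keys_iff)
qed

text \<open>A relation for \<open>x k\<close> over the Laurent ring in the other variables is
  multiplied by a common monomial denominator. This gives a polynomial relation between all
  variables, whose parts for different powers of \<open>x k\<close> are separated by
  \<open>poly_over_separate\<close>.\<close>

lemma algebraically_independent_imp_ind:
  assumes R: "is_subring R" and alg: "algebraically_independent R N x"
  shows "ind R {1..N} x"
  unfolding ind_def transc_def
proof (intro ballI allI impI)
  have alg: "p = 0" if "poly_over R {1..N} p" "poly_eval p x = 0" for p
    using alg that by (simp add: algebraically_independent_iff)
  have nz: "x k \<noteq> 0" if "k \<in> {1..N}" for k
  proof
    assume "x k = 0"
    then have "Poly_Mapping.single (Poly_Mapping.single k (1::nat)) (1::'a) = 0"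
      using that \<open>x k = 0\<close> by (intro alg poly_over_single[OF R] subring_1[OF R]) auto
    then show False by (metis keys_single keys_zero insert_not_empty zero_neq_one)
  qed
  fix k p assume k: "k \<in> {1..N}" and p: "coeffs_in (lring R ({1..N} - {k}) x) p" "poly p (x k) = 0"
  let ?I = "{1..N} - {k}"
  have "\<exists>\<alpha> P. Poly_Mapping.keys \<alpha> \<subseteq> ?I \<and> poly_over R ?I P \<and> coeff p j * monom_eval \<alpha> x = poly_eval P x" for j
    by (rule lring_fraction[OF R]) (use p(1) nz in \<open>auto simp: coeffs_in_def\<close>)
  then obtain \<alpha> P where \<alpha>: "\<And>j. Poly_Mapping.keys (\<alpha> j) \<subseteq> ?I" and P: "\<And>j. poly_over R ?I (P j)"
    and eq: "\<And>j. coeff p j * monom_eval (\<alpha> j) x = poly_eval (P j) x" by metis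
  \<comment> \<open>\<open>A\<close> is the product of all denominators, written as a sum of
    exponent vectors, and \<open>A' j\<close> is the cofactor of the j-th one.\<close>
  define A where "A = (\<Sum>j\<le>degree p. \<alpha> j)"
  define A' where "A' j = (\<Sum>i\<in>{..degree p}-{j}. \<alpha> i)" for j
  have sumkeys: "Poly_Mapping.keys (\<Sum>i\<in>S. \<alpha> i) \<subseteq> ?I" for S
  proof (induction S rule: infinite_finite_induct)
    case (insert i S)
    then show ?case using keys_add[of "\<alpha> i" "sum \<alpha> S"] \<alpha>[of i] by auto
  qed auto
  have A: "A = \<alpha> j + A' j" if "j \<le> degree p" for j
    unfolding A_def A'_def by (rule sum.remove) (use that in auto)
  have A0: "monom_eval A x \<noteq> 0"
    by (rule monom_eval_nonzero) (use sumkeys[of "{..degree p}"] nz in \<open>auto simp: A_def\<close>)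
  define Q where "Q j = P j * Poly_Mapping.single (A' j) 1" for j
  have Q: "poly_over R ?I (Q j)" for j
    unfolding Q_def A'_def by (intro poly_over_mult poly_over_single R P subring_1 sumkeys)
  have evQ: "poly_eval (Q j) x = coeff p j * monom_eval A x" if "j \<le> degree p" for j
    by (simp add: Q_def poly_eval_mult A[OF that] monom_eval_add eq[symmetric])
  define T where "T = (\<Sum>j\<le>degree p. Q j * Poly_Mapping.single (Poly_Mapping.single k j) 1)"
  have "poly_over R {1..N} (Q j)" for j using Q[of j] by (fastforce simp: poly_over_def)
  then have "poly_over R {1..N} T"
    unfolding T_def using k by (intro poly_over_sum poly_over_mult poly_over_single R subring_1) auto
  moreover have "poly_eval T x = (\<Sum>j\<le>degree p. coeff p j * x k ^ j) * monom_eval A x"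
    unfolding T_def poly_eval_sum sum_distrib_right
    by (intro sum.cong) (simp_all add: poly_eval_mult evQ)
  then have "poly_eval T x = 0" using p(2) by (simp add: poly_altdef)
  ultimately have "T = 0" by (rule alg)
  have "Q j = 0" if "j \<le> degree p" for j
    using poly_over_separate[of "{..degree p}" R ?I Q k j] Q \<open>T = 0\<close> that unfolding T_def by simp
  then have "coeff p j = 0" for j
    using evQ[of j] A0 by (cases "j \<le> degree p") (auto simp: coeff_eq_0)
  then show "p = 0" by (intro poly_eqI) auto
qed

text \<open>Sorting the monomials of \<open>P\<close> by their exponent at \<open>k\<close> makes
  \<open>P\<close> a polynomial in \<open>x k\<close> over the Laurent ring of the other variables.
  Its coefficients vanish, and the induction hypothesis applies to each group
  \<open>Q j\<close>.\<close>

lemma ind_imp_poly_eval_inj: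
  fixes x :: "nat \<Rightarrow> 'a::field"
  assumes R: "is_subring R" and "finite I"
  shows "ind R I x \<Longrightarrow> poly_over R I P \<Longrightarrow> poly_eval P x = 0 \<Longrightarrow> P = 0"
  using assms(2)
proof (induction I arbitrary: P rule: finite_induct)
  case empty
  then have sub: "Poly_Mapping.keys P \<subseteq> {0}" by (auto simp: poly_over_def)
  then have "poly_eval P x = Poly_Mapping.lookup P 0"
    by (subst poly_eval_superset[of "{0}"]) auto
  then show ?case using sub empty by (metis in_keys_iff keys_eq_empty subset_singletonD insertI1)
next
  case (insert k I)
  \<comment> \<open>\<open>u\<close> deletes the variable \<open>k\<close> from an exponent
    vector.\<close>
  define u where "u \<alpha> = Poly_Mapping.update k 0 \<alpha>" for \<alpha> :: "nat \<Rightarrow>\<^sub>0 nat"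
  have u_lookup: "Poly_Mapping.lookup (u \<alpha>) i = (if i = k then 0 else Poly_Mapping.lookup \<alpha> i)" for \<alpha> i
    by (simp add: u_def lookup_update)
  have u_split: "u \<alpha> + Poly_Mapping.single k (Poly_Mapping.lookup \<alpha> k) = \<alpha>" for \<alpha>
    by (rule poly_mapping_eqI) (auto simp: lookup_add u_lookup lookup_single when_def)
  have u_keys: "Poly_Mapping.keys (u \<alpha>) \<subseteq> I" if "\<alpha> \<in> Poly_Mapping.keys P" for \<alpha>
  proof
    fix i assume "i \<in> Poly_Mapping.keys (u \<alpha>)"
    then have "i \<noteq> k" "i \<in> Poly_Mapping.keys \<alpha>" by (auto simp: in_keys_iff u_lookup split: if_splits)
    then show "i \<in> I" using insert.prems(2) that by (auto simp: poly_over_def)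
  qed
  define S where "S j = {\<alpha> \<in> Poly_Mapping.keys P. Poly_Mapping.lookup \<alpha> k = j}" for j
  define Q where "Q j = (\<Sum>\<alpha>\<in>S j. Poly_Mapping.single (u \<alpha>) (Poly_Mapping.lookup P \<alpha>))" for j
  have Q: "poly_over R I (Q j)" for j
    unfolding Q_def using insert.prems(2) u_keys
    by (intro poly_over_sum poly_over_single R) (auto simp: poly_over_def S_def)
  define p where "p = (\<Sum>\<alpha>\<in>Poly_Mapping.keys P.
    monom (Poly_Mapping.lookup P \<alpha> * monom_eval (u \<alpha>) x) (Poly_Mapping.lookup \<alpha> k))"
  have coeff_p: "coeff p j = poly_eval (Q j) x" for j
  proof -
    have "coeff p j = (\<Sum>\<alpha>\<in>Poly_Mapping.keys P.
        if Poly_Mapping.lookup \<alpha> k = j then Poly_Mapping.lookup P \<alpha> * monom_eval (u \<alpha>) x else 0)"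
      unfolding p_def coeff_sum by (intro sum.cong) auto
    also have "\<dots> = (\<Sum>\<alpha>\<in>S j. Poly_Mapping.lookup P \<alpha> * monom_eval (u \<alpha>) x)"
      unfolding S_def by (rule sum.inter_filter[symmetric]) simp
    finally show ?thesis by (simp add: Q_def poly_eval_sum)
  qed
  have "coeffs_in (lring R I x) p"
    unfolding coeffs_in_def coeff_p using poly_eval_in_lring[OF Q] by blast
  moreover have "poly p (x k) = poly_eval P x"
    unfolding p_def poly_sum poly_eval_superset[OF finite_keys order_refl]
  proof (intro sum.cong refl)
    fix \<alpha>
    show "poly (monom (Poly_Mapping.lookup P \<alpha> * monom_eval (u \<alpha>) x) (Poly_Mapping.lookup \<alpha> k)) (x k) =
      Poly_Mapping.lookup P \<alpha> * monom_eval \<alpha> x"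
      by (subst (5) u_split[of \<alpha>, symmetric]) (simp only: monom_eval_add poly_monom monom_eval_single mult.assoc)
  qed
  moreover have "transc (lring R I x) (x k)"
    using insert.prems(1) insert.hyps by (auto intro: ind_transc)
  ultimately have "p = 0" using transcD insert.prems(3) by metis
  then have "poly_eval (Q j) x = 0" for j by (simp flip: coeff_p)
  then have Q0: "Q j = 0" for j
    using insert.IH[OF ind_subset[OF insert.prems(1)] Q] by blast
  have "Poly_Mapping.lookup P \<alpha> = 0" for \<alpha>
  proof (rule ccontr)
    assume "Poly_Mapping.lookup P \<alpha> \<noteq> 0"
    define j where "j = Poly_Mapping.lookup \<alpha> k"
    have \<alpha>: "\<alpha> \<in> S j" using \<open>Poly_Mapping.lookup P \<alpha> \<noteq> 0\<close> by (simp add: S_def j_def in_keys_iff)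
    have "0 = Poly_Mapping.lookup (Q j) (u \<alpha>)" by (simp add: Q0)
    also have "\<dots> = (\<Sum>\<beta>\<in>S j. if \<beta> = \<alpha> then Poly_Mapping.lookup P \<alpha> else 0)"
      unfolding Q_def lookup_sum
    proof (intro sum.cong refl)
      fix \<beta> assume "\<beta> \<in> S j"
      then have "u \<beta> = u \<alpha> \<longleftrightarrow> \<beta> = \<alpha>"
        using u_split[of \<alpha>] u_split[of \<beta>] by (auto simp: S_def j_def)
      then show "Poly_Mapping.lookup (Poly_Mapping.single (u \<beta>) (Poly_Mapping.lookup P \<beta>)) (u \<alpha>) =
        (if \<beta> = \<alpha> then Poly_Mapping.lookup P \<alpha> else 0)"
        by (auto simp: lookup_single when_def)
    qed
    also have "\<dots> = Poly_Mapping.lookup P \<alpha>" using \<alpha> by (simp add: S_def)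
    finally show False using \<open>Poly_Mapping.lookup P \<alpha> \<noteq> 0\<close> by simp
  qed
  then show "P = 0" by (intro poly_mapping_eqI) simp
qed

lemma algebraically_independent_iff_ind:
  "is_subring R \<Longrightarrow> algebraically_independent R N x \<longleftrightarrow> ind R {1..N} x"
  using algebraically_independent_imp_ind[of R N x] ind_imp_poly_eval_inj[of R "{1..N}" x]
  by (auto simp: algebraically_independent_iff)

section \<open>Localizations and regular pairs\<close>

definition loc :: "'a::field set \<Rightarrow> 'a \<Rightarrow> 'a set" where
  "loc D g = {y. \<exists>K. y * g ^ K \<in> D}"

lemma loc_base: "y \<in> D \<Longrightarrow> y \<in> loc D g"
  unfolding loc_def by (auto intro: exI[of _ 0])

text \<open>For \<open>g ^ K = 0\<close> the quotient is 0 by convention, and the hypothesis on 0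
  then gives membership.\<close>

lemma loc_divide:
  assumes "y \<in> D" "0 \<in> D" shows "y / g ^ K \<in> loc D g"
  unfolding loc_def using assms by (cases "g ^ K = 0") (auto intro!: exI[of _ K])

lemma is_subring_loc:
  assumes D: "is_subring D" and g: "g \<in> D" shows "is_subring (loc D g)"
  unfolding is_subring_def
proof (intro conjI ballI)
  show "1 \<in> loc D g" by (intro loc_base subring_1 D)
  fix a assume "a \<in> loc D g"
  then obtain K where K: "a * g ^ K \<in> D" by (auto simp: loc_def)
  show "- a \<in> loc D g" using subring_minus[OF D K] by (auto simp: loc_def intro!: exI[of _ K])
  fix b assume "b \<in> loc D g"
  then obtain L where L: "b * g ^ L \<in> D" by (auto simp: loc_def)
  have "(a + b) * g ^ (K + L) = (a * g ^ K) * g ^ L + (b * g ^ L) * g ^ K"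
    by (simp add: power_add algebra_simps)
  also have "\<dots> \<in> D" by (intro subring_add subring_mult subring_power D K L g)
  finally show "a + b \<in> loc D g" by (auto simp: loc_def)
  have "(a * b) * g ^ (K + L) = (a * g ^ K) * (b * g ^ L)"
    by (simp add: power_add algebra_simps)
  also have "\<dots> \<in> D" by (intro subring_mult D K L)
  finally show "a * b \<in> loc D g" by (auto simp: loc_def)
qed

text \<open>This is D[1/a] \<inter> D[1/b] = D for comaximal a and b. If K and L are exponents that
  clear the denominators of y, then y * a and y * b need a smaller total exponent, and y is their
  combination with the coefficients u and v.\<close>

lemma loc_comaximal:
  assumes D: "is_subring D" and "a \<in> D" "b \<in> D" "u \<in> D" "v \<in> D" "u * a + v * b = 1"
    and "y \<in> loc D a" "y \<in> loc D b"
  shows "y \<in> D"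
proof -
  have "y \<in> D" if "y * a ^ K \<in> D" "y * b ^ L \<in> D" for K L y
    using that
  proof (induction "K + L" arbitrary: K L y)
    case (Suc n)
    show ?case
    proof (cases K; cases L)
      fix K' L' assume K': "K = Suc K'" and L': "L = Suc L'"
      have "y * a \<in> D"
      proof (rule Suc.hyps(1)[of K' L])
        have "y * a * b ^ L = a * (y * b ^ L)" by (simp add: mult_ac)
        then show "y * a * b ^ L \<in> D" using subring_mult[OF D assms(2) Suc.prems(2)] by argo
      qed (use Suc K' in \<open>auto simp: mult_ac\<close>)
      moreover have "y * b \<in> D"
      proof (rule Suc.hyps(1)[of K L'])
        have "y * b * a ^ K = b * (y * a ^ K)" by (simp add: mult_ac)
        then show "y * b * a ^ K \<in> D" using subring_mult[OF D assms(3) Suc.prems(1)] by argo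
      qed (use Suc L' in \<open>auto simp: mult_ac\<close>)
      ultimately have "u * (y * a) + v * (y * b) \<in> D"
        using subring_add[OF D subring_mult[OF D assms(4)] subring_mult[OF D assms(5)]] by blast
      also have "u * (y * a) + v * (y * b) = y * (u * a + v * b)" by (simp add: algebra_simps)
      finally show ?thesis using assms(6) by simp
    qed (use Suc.prems in auto)
  qed simp
  then show ?thesis using assms(7,8) by (auto simp: loc_def)
qed

text \<open>\<open>p\<close> is a non-zero-divisor modulo \<open>f\<close>.\<close>

definition regular :: "'a::field set \<Rightarrow> 'a \<Rightarrow> 'a \<Rightarrow> bool" where
  "regular C p f \<longleftrightarrow> (\<forall>u\<in>C. \<forall>v\<in>C. p * u = f * v \<longrightarrow> (\<exists>h\<in>C. u = f * h))"

text \<open>Factors p are removed one at a time against a single f; then that f is cancelled and b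
  decreases.\<close>

lemma regular_power:
  assumes C: "is_subring C" and p: "p \<in> C" and f: "f \<in> C" "f \<noteq> 0" and reg: "regular C p f"
  shows "u \<in> C \<Longrightarrow> v \<in> C \<Longrightarrow> p ^ K * u = f ^ b * v \<Longrightarrow> \<exists>h\<in>C. u = f ^ b * h"
proof (induction b arbitrary: u)
  case (Suc b)
  have one: "\<exists>h\<in>C. u = f * h" if "u \<in> C" "v \<in> C" "p ^ K * u = f * v" for u v
    using that
  proof (induction K arbitrary: v)
    case (Suc K)
    have "p * (p ^ K * u) = f * v" using Suc.prems(3) by (simp add: mult_ac)
    moreover have "p ^ K * u \<in> C" using C p Suc.prems by (intro subring_mult subring_power)
    ultimately obtain h where "h \<in> C" "p ^ K * u = f * h"
      using reg Suc.prems(2) unfolding regular_def by blast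
    then show ?case using Suc.IH Suc.prems(1) by blast
  qed auto
  have "\<exists>h\<in>C. u = f * h"
    by (rule one[of u "f ^ b * v"]) (use Suc.prems C f in \<open>auto simp: subring_mult subring_power mult_ac\<close>)
  then obtain u' where u': "u' \<in> C" "u = f * u'" by blast
  have "p ^ K * u' = f ^ b * v" using Suc.prems(3) u'(2) f(2) by (simp add: mult_ac)
  then obtain h where "h \<in> C" "u' = f ^ b * h" using Suc.IH u'(1) Suc.prems(2) by blast
  then show ?case using u'(2) by (auto simp: mult_ac)
qed auto

text \<open>Inverting \<open>t\<close> makes y a Laurent polynomial in t over C. Inverting
  \<open>p\<close> shows that p^L times each coefficient is divisible by the power of f that
  membership requires, and regularity of the pair removes p^L.\<close>

lemma loc_regular:
  assumes C: "is_subring C" and t: "transc C t" and f: "f \<in> C" "f \<noteq> 0" and p: "p \<in> C"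
    and reg: "regular C p f"
    and y: "y \<in> loc (rgen (C \<union> {t, f / t})) t" "y \<in> loc (rgen (C \<union> {t, f / t})) p"
  shows "y \<in> rgen (C \<union> {t, f / t})"
proof -
  let ?D = "rgen (C \<union> {t, f / t})"
  have t0: "t \<noteq> 0" using transc_nonzero[OF C t] .
  note iff = rgen_pair_iff[OF C f(1) t0]
  obtain K where "y * t ^ K \<in> ?D" using y(1) by (auto simp: loc_def)
  then obtain K' P where P': "y * t ^ K * t ^ K' = poly P t" "weighted C f K' P" unfolding iff by blast
  define M where "M = K + K'"
  have P: "y * t ^ M = poly P t" "coeffs_in C P"
    using P' weighted_coeffs_in[OF C f(1)] by (auto simp: M_def power_add mult_ac)
  obtain L where "y * p ^ L \<in> ?D" using y(2) by (auto simp: loc_def)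
  then obtain N Q where Q: "y * p ^ L * t ^ N = poly Q t" "weighted C f N Q" unfolding iff by blast
  have "poly (smult (p ^ L) P * monom 1 N) t = poly (Q * monom 1 M) t"
    by (simp add: poly_monom P(1)[symmetric] Q(1)[symmetric] mult_ac)
  then have eq: "smult (p ^ L) P * monom 1 N = Q * monom 1 M"
    by (intro transc_eqD[OF C t])
       (intro coeffs_in_mult coeffs_in_smult coeffs_in_monom C subring_power p P(2) subring_1
          weighted_coeffs_in[OF C f(1) Q(2)] | assumption)+
  have "weighted C f M P"
    unfolding weighted_def
  proof
    fix j
    have cP: "coeff P j \<in> C" using P(2) by (simp add: coeffs_in_def)
    show "\<exists>c\<in>C. coeff P j = c * f ^ (M - j)"
    proof (cases "j < M")
      case True
      have "p ^ L * coeff P j = coeff (smult (p ^ L) P * monom 1 N) (j + N)"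
        by (simp add: mult.commute[of _ "monom 1 N"] coeff_monom_mult)
      also have "\<dots> = (if M \<le> j + N then coeff Q (j + N - M) else 0)"
        unfolding eq by (simp add: mult.commute[of _ "monom 1 M"] coeff_monom_mult)
      finally have e: "p ^ L * coeff P j = (if M \<le> j + N then coeff Q (j + N - M) else 0)" .
      have "\<exists>c\<in>C. p ^ L * coeff P j = f ^ (M - j) * c"
      proof (cases "M \<le> j + N")
        case True
        obtain c where c: "c \<in> C" "coeff Q (j + N - M) = c * f ^ (N - (j + N - M))"
          using Q(2) weightedD by blast
        have "N - (j + N - M) = M - j" using True \<open>j < M\<close> by linarith
        then show ?thesis using e c True by (auto simp: mult.commute)
      next
        case False
        then show ?thesis using e subring_0[OF C] by (intro bexI[of _ 0]) simp_all
      qed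
      then obtain c where "c \<in> C" "p ^ L * coeff P j = f ^ (M - j) * c" by blast
      then show ?thesis using regular_power[OF C p f reg cP] by (metis mult.commute)
    qed (use cP in auto)
  qed
  then show ?thesis unfolding iff using P(1) by blast
qed

text \<open>Division from the top: the leading coefficient of \<open>q\<close> is that of the
  product divided by the unit \<open>lead_coeff p\<close>, and subtracting this term from
  \<open>q\<close> lowers the degree bound \<open>n\<close>.\<close>

lemma coeffs_in_cofactor:
  assumes C: "is_subring C" and p: "coeffs_in C p" "p \<noteq> 0" "inverse (lead_coeff p) \<in> C"
    and pq: "coeffs_in C (p * q)"
  shows "coeffs_in C q"
proof -
  have "coeffs_in C q" if "\<forall>i\<ge>n. coeff q i = 0" "coeffs_in C (p * q)" for n q
    using that
  proof (induction n arbitrary: q)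
    case 0
    then have "q = 0" by (intro poly_eqI) auto
    then show ?case using C by simp
  next
    case (Suc n)
    show ?case
    proof (cases "coeff q n = 0")
      case True
      then show ?thesis using Suc by (metis Suc_le_eq le_eq_less_or_eq)
    next
      case False
      then have deg: "degree q = n"
        using Suc.prems(1) by (intro antisym degree_le le_degree) (auto simp: Suc_le_eq)
      have "coeff (p * q) (degree p + degree q) \<in> C" using Suc.prems(2) by (simp add: coeffs_in_def)
      then have "inverse (lead_coeff p) * (lead_coeff p * coeff q n) \<in> C"
        using subring_mult[OF C p(3)] coeff_mult_degree_sum[of p q] deg by simp
      then have c: "coeff q n \<in> C" using p(2) by (simp flip: mult.assoc)
      define q' where "q' = q - monom (coeff q n) n"
      have "coeffs_in C q'"
      proof (rule Suc.IH)
        show "\<forall>i\<ge>n. coeff q' i = 0" using Suc.prems(1) by (auto simp: q'_def Suc_le_eq)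
        have "p * q' = p * q - p * monom (coeff q n) n" by (simp add: q'_def algebra_simps)
        then show "coeffs_in C (p * q')"
          using Suc.prems(2) c p(1) C by (simp add: coeffs_in_diff coeffs_in_mult coeffs_in_monom)
      qed
      then have "coeffs_in C (q' + monom (coeff q n) n)"
        using C c by (intro coeffs_in_add coeffs_in_monom)
      then show ?thesis by (simp add: q'_def)
    qed
  qed
  then show ?thesis using pq coeff_eq_0 by (metis Suc_le_eq)
qed

subsection \<open>One-parameter rescaling\<close>

text \<open>\<open>lift R I x w y \<gamma>\<close> says that \<open>\<gamma>\<close> arises from \<open>y\<close> by rescaling every variable \<open>x k\<close> by
  \<open>T powi w k\<close>, where \<open>T\<close> is a new indeterminate. For independent \<open>x\<close> this is a ring homomorphism, which
  records the grading of the Laurent ring by the weights \<open>w\<close>.\<close>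

abbreviation cst :: "'a::field \<Rightarrow> 'a poly fract" where "cst c \<equiv> to_fract [:c:]"

text \<open>The weights may be negative, so \<open>T\<close> has to be invertible; hence fractions
  of polynomials instead of polynomials.\<close>

abbreviation T :: "'a::field poly fract" where "T \<equiv> to_fract [:0, 1:]"

lemma cst_mult: "cst (a * b) = cst a * cst b"
  by (simp flip: to_fract_mult)

lemma cst_add: "cst (a + b) = cst a + cst b"
  by (simp flip: to_fract_add)

lemma cst_minus: "cst (- a) = - cst a"
  by (simp flip: to_fract_uminus)

lemma cst_1: "cst 1 = 1"
  by (simp flip: one_pCons)

lemma cst_power: "cst (a ^ n) = cst a ^ n"
  by (induction n) (simp_all only: power_Suc power_0 cst_1 cst_mult)

lemma cst_inverse: "cst (inverse a) = inverse (cst a)"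
proof (cases "a = 0")
  case False
  then have "a * inverse a = 1" by simp
  then have "cst a * cst (inverse a) = 1" by (simp only: cst_mult[symmetric] cst_1)
  then show ?thesis by (rule inverse_unique[symmetric])
qed simp

lemma T_nonzero [simp]: "T \<noteq> 0"
  by simp

lemma to_fract_power: "to_fract (p ^ n) = to_fract p ^ n"
  by (induction n) auto

lemma to_fract_monom: "to_fract (monom c n) = cst c * T ^ n"
proof -
  have "monom c n = [:c:] * [:0, 1:] ^ n" by (simp add: monom_altdef)
  then show ?thesis by (simp only: to_fract_mult to_fract_power)
qed

inductive lift :: "'a::field set \<Rightarrow> nat set \<Rightarrow> (nat \<Rightarrow> 'a) \<Rightarrow> (nat \<Rightarrow> int) \<Rightarrow> 'a \<Rightarrow> 'a poly fract \<Rightarrow> bool"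
  for R I x w where
  lift_base: "r \<in> R \<Longrightarrow> lift R I x w r (cst r)"
| lift_var: "k \<in> I \<Longrightarrow> lift R I x w (x k) (cst (x k) * T powi w k)"
| lift_inv: "k \<in> I \<Longrightarrow> lift R I x w (inverse (x k)) (cst (inverse (x k)) * T powi (- w k))"
| lift_add: "lift R I x w a \<alpha> \<Longrightarrow> lift R I x w b \<beta> \<Longrightarrow> lift R I x w (a + b) (\<alpha> + \<beta>)"
| lift_mult: "lift R I x w a \<alpha> \<Longrightarrow> lift R I x w b \<beta> \<Longrightarrow> lift R I x w (a * b) (\<alpha> * \<beta>)"

lemma lift_0: "is_subring R \<Longrightarrow> lift R I x w 0 0"
  using lift_base[of 0 R I x w] by (simp add: subringD)

lemma lift_1: "is_subring R \<Longrightarrow> lift R I x w 1 1"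
  using lift_base[of 1 R I x w] by (simp add: subringD cst_1)

lemma lift_uminus: "is_subring R \<Longrightarrow> lift R I x w a \<alpha> \<Longrightarrow> lift R I x w (- a) (- \<alpha>)"
  using lift_mult[OF lift_base[of "- 1" R I x w], of a \<alpha>]
  by (simp only: subringD cst_minus cst_1 mult_minus_left mult_1)

lemma lift_diff: "is_subring R \<Longrightarrow> lift R I x w a \<alpha> \<Longrightarrow> lift R I x w b \<beta> \<Longrightarrow> lift R I x w (a - b) (\<alpha> - \<beta>)"
  using lift_add[OF _ lift_uminus, of R I x w a \<alpha> b \<beta>] by simp

lemma lift_sum:
  assumes "is_subring R"
  shows "(\<And>i. i \<in> A \<Longrightarrow> lift R I x w (f i) (g i)) \<Longrightarrow> lift R I x w (sum f A) (sum g A)"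
  by (induction A rule: infinite_finite_induct) (auto intro: lift_0 assms lift_add)

lemma lift_power: "is_subring R \<Longrightarrow> lift R I x w a \<alpha> \<Longrightarrow> lift R I x w (a ^ n) (\<alpha> ^ n)"
  by (induction n) (auto intro: lift_1 lift_mult)

lemma lift_prod:
  assumes "is_subring R"
  shows "(\<And>i. i \<in> A \<Longrightarrow> lift R I x w (f i) (g i)) \<Longrightarrow> lift R I x w (prod f A) (prod g A)"
  by (induction A rule: infinite_finite_induct) (auto intro: lift_1 assms lift_mult)

text \<open>Totality on the Laurent ring. Single-valuedness depends on the independence of the
  variables and is \<open>lift_functional\<close>.\<close>

lemma lift_exists:
  assumes R: "is_subring R" and "y \<in> lring R I x" shows "\<exists>\<gamma>. lift R I x w y \<gamma>"
proof -
  have "is_subring {y. \<exists>\<gamma>. lift R I x w y \<gamma>}"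
    unfolding is_subring_def
    by (auto intro: lift_1[OF R]) (blast intro: lift_uminus[OF R] lift_add lift_mult)+
  then have "lring R I x \<subseteq> {y. \<exists>\<gamma>. lift R I x w y \<gamma>}"
    by (rule lring_least) (blast intro: lift_base lift_var lift_inv)+
  then show ?thesis using assms(2) by blast
qed

text \<open>Setting T = 1 undoes the rescaling. Once powers of T are cleared, an identity between
  lifts can thus be read as one between polynomials in T and specialized to the Laurent
  ring.\<close>

lemma lift_polynomial:
  assumes R: "is_subring R" and "lift R I x w y \<gamma>"
  shows "\<exists>K q. coeffs_in (lring R I x) q \<and> \<gamma> * T ^ K = to_fract q \<and> poly q 1 = y"
  using assms(2)
proof induction
  let ?L = "lring R I x"
  have L: "is_subring ?L" by simp
  have scaled: "\<exists>K q. coeffs_in ?L q \<and> cst c * T powi e * T ^ K = to_fract q \<and> poly q 1 = c"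
    if "c \<in> ?L" for c e
  proof (intro exI conjI)
    have T: "T powi e * T ^ nat (- e) = T ^ nat e"
      by (cases "e \<ge> 0") (auto simp: power_int_def field_simps)
    show "cst c * T powi e * T ^ nat (- e) = to_fract (monom c (nat e))"
      unfolding mult.assoc T to_fract_monom ..
    show "coeffs_in ?L (monom c (nat e))" using that by (simp add: coeffs_in_monom)
  qed (simp add: poly_monom)
  {
    case (lift_base r)
    then show ?case using scaled[of r 0] by (simp add: lring_base)
  next
    case (lift_var k)
    then show ?case using scaled[of "x k" "w k"] by (simp add: lring_var)
  next
    case (lift_inv k)
    then show ?case using scaled[of "inverse (x k)" "- w k"] by (simp add: lring_inv)
  next
    case (lift_add a \<alpha> b \<beta>)
    then obtain K p M q where
      p: "coeffs_in ?L p" "\<alpha> * T ^ K = to_fract p" "poly p 1 = a" and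
      q: "coeffs_in ?L q" "\<beta> * T ^ M = to_fract q" "poly q 1 = b" by blast
    show ?case
    proof (intro exI conjI)
      show "coeffs_in ?L (p * monom 1 M + q * monom 1 K)"
        by (intro coeffs_in_add coeffs_in_mult coeffs_in_monom L p q subring_1)
      show "(\<alpha> + \<beta>) * T ^ (K + M) = to_fract (p * monom 1 M + q * monom 1 K)"
        by (simp add: p(2)[symmetric] q(2)[symmetric] monom_altdef to_fract_power power_add algebra_simps)
    qed (simp add: p q poly_monom)
  next
    case (lift_mult a \<alpha> b \<beta>)
    then obtain K p M q where
      p: "coeffs_in ?L p" "\<alpha> * T ^ K = to_fract p" "poly p 1 = a" and
      q: "coeffs_in ?L q" "\<beta> * T ^ M = to_fract q" "poly q 1 = b" by blast
    show ?case
    proof (intro exI conjI)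
      show "coeffs_in ?L (p * q)" by (intro coeffs_in_mult L p q)
      show "(\<alpha> * \<beta>) * T ^ (K + M) = to_fract (p * q)"
        by (simp add: p(2)[symmetric] q(2)[symmetric] power_add algebra_simps)
    qed (simp add: p q)
  }
qed

text \<open>Splits off the variable \<open>k\<close>: an element and its lift are represented by two
  polynomials whose coefficients correspond under the lift in the remaining variables, evaluated at
  \<open>x k\<close> and at the rescaled variable \<open>\<tau>\<close>.\<close>

lemma lift_insert:
  assumes R: "is_subring R" and nz: "x k \<noteq> 0" and "lift R (insert k I) x w y \<gamma>"
  defines "\<tau> \<equiv> cst (x k) * T powi w k"
  shows "\<exists>K P Q. (\<forall>j. lift R I x w (coeff P j) (coeff Q j)) \<and>
    y * x k ^ K = poly P (x k) \<and> \<gamma> * \<tau> ^ K = poly Q \<tau>"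
proof -
  define rel where "rel P Q \<longleftrightarrow> (\<forall>j. lift R I x w (coeff P j) (coeff Q j))"
    for P and Q :: "'a poly fract poly"
  have rel_monom: "rel (monom a n) (monom \<alpha> n)" if "lift R I x w a \<alpha>" for a \<alpha> n
    using that R by (auto simp: rel_def lift_0)
  have rel_add: "rel P Q \<Longrightarrow> rel P' Q' \<Longrightarrow> rel (P + P') (Q + Q')" for P Q P' Q'
    by (auto simp: rel_def intro: lift_add)
  have rel_mult: "rel P Q \<Longrightarrow> rel P' Q' \<Longrightarrow> rel (P * P') (Q * Q')" for P Q P' Q'
    by (auto simp: rel_def coeff_mult intro!: lift_sum[OF R] lift_mult)
  have \<tau>0: "\<tau> \<noteq> 0" using nz by (simp add: \<tau>_def)
  have \<tau>inv: "cst (inverse (x k)) * T powi (- w k) * \<tau> = 1"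
    unfolding \<tau>_def cst_inverse using nz by (simp add: power_int_minus field_simps)
  from assms(3) have "\<exists>K P Q. rel P Q \<and> y * x k ^ K = poly P (x k) \<and> \<gamma> * \<tau> ^ K = poly Q \<tau>"
  proof induction
    case (lift_base r)
    then show ?case
      by (intro exI[of _ 0] exI[of _ "monom r 0"] exI[of _ "monom (cst r) 0"])
         (auto intro!: rel_monom lift.lift_base simp: poly_monom)
  next
    case (lift_var i)
    show ?case
    proof (cases "i = k")
      case True
      then show ?thesis
        by (intro exI[of _ 0] exI[of _ "monom 1 1"])
           (auto intro!: rel_monom lift_1 R simp: poly_monom \<tau>_def)
    next
      case False
      then show ?thesis using lift_var
        by (intro exI[of _ 0] exI[of _ "monom (x i) 0"] exI[of _ "monom (cst (x i) * T powi w i) 0"])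
           (auto intro!: rel_monom lift.lift_var simp: poly_monom)
    qed
  next
    case (lift_inv i)
    show ?case
    proof (cases "i = k")
      case True
      then show ?thesis
        using nz \<tau>inv rel_monom[OF lift_1[OF R], of 0]
        by (intro exI[of _ 1] exI[of _ "monom 1 0"]) (auto simp: poly_monom)
    next
      case False
      then show ?thesis using lift_inv
        by (intro exI[of _ 0] exI[of _ "monom (inverse (x i)) 0"]
              exI[of _ "monom (cst (inverse (x i)) * T powi (- w i)) 0"])
           (auto intro!: rel_monom lift.lift_inv simp: poly_monom)
    qed
  next
    case (lift_add a \<alpha> b \<beta>)
    then obtain K P Q M P' Q' where
      p: "rel P Q" "a * x k ^ K = poly P (x k)" "\<alpha> * \<tau> ^ K = poly Q \<tau>" and
      q: "rel P' Q'" "b * x k ^ M = poly P' (x k)" "\<beta> * \<tau> ^ M = poly Q' \<tau>" by blast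
    show ?case
    proof (intro exI conjI)
      show "rel (P * monom 1 M + P' * monom 1 K) (Q * monom 1 M + Q' * monom 1 K)"
        by (intro rel_add rel_mult rel_monom lift_1 R p q)
      show "(a + b) * x k ^ (K + M) = poly (P * monom 1 M + P' * monom 1 K) (x k)"
        by (simp add: p(2)[symmetric] q(2)[symmetric] poly_monom power_add algebra_simps)
      show "(\<alpha> + \<beta>) * \<tau> ^ (K + M) = poly (Q * monom 1 M + Q' * monom 1 K) \<tau>"
        by (simp add: p(3)[symmetric] q(3)[symmetric] poly_monom power_add algebra_simps)
    qed
  next
    case (lift_mult a \<alpha> b \<beta>)
    then obtain K P Q M P' Q' where
      p: "rel P Q" "a * x k ^ K = poly P (x k)" "\<alpha> * \<tau> ^ K = poly Q \<tau>" and
      q: "rel P' Q'" "b * x k ^ M = poly P' (x k)" "\<beta> * \<tau> ^ M = poly Q' \<tau>" by blast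
    show ?case
    proof (intro exI conjI)
      show "rel (P * P') (Q * Q')" by (intro rel_mult p q)
      show "(a * b) * x k ^ (K + M) = poly (P * P') (x k)"
        by (simp add: p(2)[symmetric] q(2)[symmetric] power_add algebra_simps)
      show "(\<alpha> * \<beta>) * \<tau> ^ (K + M) = poly (Q * Q') \<tau>"
        by (simp add: p(3)[symmetric] q(3)[symmetric] power_add algebra_simps)
    qed
  qed
  then show ?thesis by (simp add: rel_def)
qed

lemma lift_in_lring: "is_subring R \<Longrightarrow> lift R I x w y \<gamma> \<Longrightarrow> y \<in> lring R I x"
  using lift_polynomial[of R I x w y \<gamma>] poly_in_subring[of "lring R I x" _ 1]
  by (auto simp: subringD)

text \<open>Lifts can be subtracted, so it suffices to treat the lifts of 0. When one variable is
  split off, its transcendence makes all coefficients of \<open>P\<close> vanish, and the induction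
  hypothesis makes those of \<open>Q\<close> vanish.\<close>

lemma lift_functional:
  assumes R: "is_subring R" and "finite I"
  shows "ind R I x \<Longrightarrow> lift R I x w 0 \<gamma> \<Longrightarrow> \<gamma> = 0"
  using assms(2)
proof (induction I arbitrary: \<gamma> rule: finite_induct)
  case empty
  have "\<gamma> = cst y" if "lift R {} x w y \<gamma>" for y
    using that by induction (simp_all only: cst_add cst_mult, auto)
  then show ?case using empty.prems by fastforce
next
  case (insert k I)
  have nz: "x k \<noteq> 0" using ind_nonzero insert.prems(1) by blast
  let ?\<tau> = "cst (x k) * T powi w k"
  obtain K P Q where PQ: "\<And>j. lift R I x w (coeff P j) (coeff Q j)"
    "0 * x k ^ K = poly P (x k)" "\<gamma> * ?\<tau> ^ K = poly Q ?\<tau>"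
    using lift_insert[OF R nz insert.prems(2)] by blast
  have "coeffs_in (lring R I x) P" using PQ(1) lift_in_lring[OF R] by (meson coeffs_in_def)
  moreover have "transc (lring R I x) (x k)" using insert by (auto intro: ind_transc)
  ultimately have "P = 0" using PQ(2) transcD by fastforce
  then have "coeff Q j = 0" for j
    using PQ(1)[of j] insert.IH[OF ind_subset[OF insert.prems(1)]] by auto
  then have "Q = 0" by (intro poly_eqI) auto
  then show ?case using PQ(3) nz by simp
qed

text \<open>An element which is homogeneous for the weights \<open>w\<close> is regular modulo one whose top component is
  a unit: compare degrees of both sides in \<open>T\<close>.\<close>

lemma regular_if_homogeneous:
  assumes R: "is_subring R" and fin: "finite I" and ind: "ind R I x"
    and p: "lift R I x w p (cst p * T powi a)" "p \<noteq> 0"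
    and f: "lift R I x w f (T powi b * to_fract q)" "coeffs_in (lring R I x) q" "poly q 1 = f"
    and lc: "q \<noteq> 0" "inverse (lead_coeff q) \<in> lring R I x"
  shows "regular (lring R I x) p f"
  unfolding regular_def
proof (intro ballI impI)
  let ?L = "lring R I x"
  have L: "is_subring ?L" by simp
  fix u v assume u: "u \<in> ?L" and v: "v \<in> ?L" and eq: "p * u = f * v"
  obtain \<mu> \<nu> where \<mu>: "lift R I x w u \<mu>" and \<nu>: "lift R I x w v \<nu>"
    using lift_exists[OF R u] lift_exists[OF R v] by blast
  have "lift R I x w (p * u - f * v) (cst p * T powi a * \<mu> - T powi b * to_fract q * \<nu>)"
    by (intro lift_diff lift_mult R p(1) f(1) \<mu> \<nu>)
  then have "lift R I x w 0 (cst p * T powi a * \<mu> - T powi b * to_fract q * \<nu>)" using eq by simp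
  then have e: "cst p * T powi a * \<mu> = T powi b * to_fract q * \<nu>"
    using lift_functional[OF R fin ind] by fastforce
  obtain K m where m: "coeffs_in ?L m" "\<mu> * T ^ K = to_fract m" "poly m 1 = u"
    using lift_polynomial[OF R \<mu>] by blast
  obtain M n where n: "coeffs_in ?L n" "\<nu> * T ^ M = to_fract n" "poly n 1 = v"
    using lift_polynomial[OF R \<nu>] by blast
  \<comment> \<open>The identity \<open>e\<close> is multiplied by the power of \<open>T\<close>
    with exponent nat (- a) + nat (- b) + K + M; \<open>A\<close> and \<open>B\<close> are the
    exponents then left beside \<open>m\<close> and \<open>n\<close>.\<close>
  define A where "A = nat a + nat (- b) + M"
  define B where "B = nat b + nat (- a) + K"
  have Ta: "T powi a * T ^ nat (- a) = (T :: 'a poly fract) ^ nat a" for a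
    by (cases "a \<ge> 0") (auto simp: power_int_def field_simps)
  have "cst p * T ^ A * to_fract m = cst p * T ^ (nat (- b) + M) * (T powi a * T ^ nat (- a)) * (\<mu> * T ^ K)"
    unfolding Ta m(2)[symmetric] A_def by (simp add: power_add mult_ac)
  also have "\<dots> = (cst p * T powi a * \<mu>) * T ^ (nat (- b) + M + nat (- a) + K)"
    by (simp add: power_add mult_ac)
  also have "\<dots> = to_fract q * T ^ (nat (- a) + K) * (T powi b * T ^ nat (- b)) * (\<nu> * T ^ M)"
    unfolding e by (simp add: power_add mult_ac)
  also have "\<dots> = to_fract q * T ^ B * to_fract n"
    unfolding Ta n(2)[symmetric] B_def by (simp add: power_add mult_ac)
  finally have "to_fract ([:p:] * [:0,1:] ^ A * m) = to_fract (q * [:0,1:] ^ B * n)"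
    by (simp only: to_fract_mult to_fract_power)
  then have eqp: "[:p:] * [:0,1:] ^ A * m = q * ([:0,1:] ^ B * n)"
    unfolding to_fract_eq_iff by (simp add: mult_ac)
  \<comment> \<open>Dividing by the scalar \<open>p\<close> may leave the subring; the unit leading
    coefficient of \<open>q\<close> brings the coefficients of \<open>h\<close> back into
    it.\<close>
  define h where "h = smult (inverse p) ([:0,1:] ^ B * n)"
  have "q * h = smult (inverse p) ([:p:] * [:0,1:] ^ A * m)" unfolding eqp by (simp add: h_def)
  then have qh: "q * h = [:0,1:] ^ A * m" using p(2) by simp
  have "coeffs_in ?L ([:0,1:] ^ A * m)"
    by (intro coeffs_in_mult coeffs_in_power L m(1)) (use L in \<open>simp add: coeffs_in_pCons subringD\<close>)
  then have "coeffs_in ?L h"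
    using coeffs_in_cofactor[OF L f(2) lc] qh by simp
  then have "poly h 1 \<in> ?L" using poly_in_subring[OF L] L by (simp add: subringD)
  moreover have "u = f * poly h 1"
    using arg_cong[OF qh, of "\<lambda>r. poly r 1"] by (simp add: f(3) m(3))
  ultimately show "\<exists>h\<in>?L. u = f * h" by blast
qed

section \<open>Exchange polynomials\<close>

declare exchange_polynomial.simps [simp del] mutate.simps [simp del]

definition eexp :: "(nat \<Rightarrow> nat) \<Rightarrow> (nat \<Rightarrow> nat \<Rightarrow> int) \<Rightarrow> nat \<Rightarrow> nat \<Rightarrow> nat \<Rightarrow> nat" where
  "eexp d B i j k = nat (int j * pos_part (beta d B k i) + int (d i - j) * pos_part (- beta d B k i))"

definition eterm :: "nat \<Rightarrow> (nat \<Rightarrow> 'a::field) \<Rightarrow> (nat \<Rightarrow> nat) \<Rightarrow> (nat \<Rightarrow> nat \<Rightarrow> int) \<Rightarrow> nat \<Rightarrow> nat \<Rightarrow> 'a" where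
  "eterm N x d B i j = (\<Prod>k=1..N. x k ^ eexp d B i j k)"

text \<open>The variable usually written with a hat over \<open>y\<close>: the exchange polynomial is, up to a monomial, a
  polynomial in \<open>yhat\<close> with the coefficients \<open>\<rho>\<close>.\<close>

definition yhat :: "nat \<Rightarrow> (nat \<Rightarrow> 'a::field) \<Rightarrow> (nat \<Rightarrow> nat) \<Rightarrow> (nat \<Rightarrow> nat \<Rightarrow> int) \<Rightarrow> nat \<Rightarrow> 'a" where
  "yhat N x d B i = (\<Prod>k=1..N. x k powi beta d B k i)"

lemma exchange_polynomial_eterm:
  "exchange_polynomial n m d (x, \<rho>, B) i = (\<Sum>j=0..d i. \<rho> i j * eterm (n + m) x d B i j)"
  by (simp add: exchange_polynomial.simps eterm_def eexp_def)

lemma pos_part_diff: "pos_part a - pos_part (- a) = a"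
  by (simp add: pos_part_def)

lemma pos_part_nonneg [simp]: "pos_part a \<ge> 0"
  by (simp add: pos_part_def)

lemma pos_part_mult: "a \<ge> 0 \<Longrightarrow> pos_part (a * b) = a * pos_part b"
  by (simp add: pos_part_def max_mult_distrib_left)

text \<open>The exponent is affine in \<open>j\<close> with slope \<open>beta d B k i\<close>, so
  consecutive terms differ by the factor \<open>yhat\<close>, apart from the coefficients.\<close>

lemma int_eexp:
  assumes "j \<le> d i"
  shows "int (eexp d B i j k) = int (d i) * pos_part (- beta d B k i) + int j * beta d B k i"
proof -
  have "int (eexp d B i j k) = int j * pos_part (beta d B k i) + int (d i - j) * pos_part (- beta d B k i)"
    by (simp add: eexp_def)
  also have "\<dots> = int (d i) * pos_part (- beta d B k i) + int j * (pos_part (beta d B k i) - pos_part (- beta d B k i))"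
    using assms by (simp add: of_nat_diff algebra_simps)
  finally show ?thesis by (simp only: pos_part_diff)
qed

lemma eterm_yhat:
  assumes "\<And>k. k \<in> {1..N} \<Longrightarrow> x k \<noteq> 0" "j \<le> d i"
  shows "eterm N x d B i j = eterm N x d B i 0 * yhat N x d B i ^ j"
  unfolding eterm_def yhat_def prod_power_distrib prod.distrib[symmetric]
proof (intro prod.cong refl)
  fix k assume k: "k \<in> {1..N}"
  have "x k ^ eexp d B i j k = x k powi int (eexp d B i j k)" by simp
  also have "int (eexp d B i j k) = int (eexp d B i 0 k) + beta d B k i * int j"
    using assms(2) by (simp add: int_eexp)
  also have "x k powi \<dots> = x k ^ eexp d B i 0 k * (x k powi beta d B k i) ^ j"
    using assms(1)[OF k] by (simp add: power_int_add power_int_mult)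
  finally show "x k ^ eexp d B i j k = x k ^ eexp d B i 0 k * (x k powi beta d B k i) ^ j" .
qed

lemma exchange_polynomial_yhat:
  assumes "\<And>k. k \<in> {1..n+m} \<Longrightarrow> x k \<noteq> 0"
  shows "exchange_polynomial n m d (x, \<rho>, B) i =
    eterm (n + m) x d B i 0 * (\<Sum>j=0..d i. \<rho> i j * yhat (n + m) x d B i ^ j)"
  unfolding exchange_polynomial_eterm sum_distrib_left
proof (intro sum.cong refl)
  fix j assume "j \<in> {0..d i}"
  then have "eterm (n + m) x d B i j = eterm (n + m) x d B i 0 * yhat (n + m) x d B i ^ j"
    using assms by (intro eterm_yhat) auto
  then show "\<rho> i j * eterm (n + m) x d B i j =
    eterm (n + m) x d B i 0 * (\<rho> i j * yhat (n + m) x d B i ^ j)" by (simp add: mult_ac)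
qed

lemma monomial_in_lring:
  assumes "e l = (0::nat)"
  shows "(\<Prod>k=1..N. x k ^ e k) \<in> lring R ({1..N} - {l}) x"
    and "inverse (\<Prod>k=1..N. x k ^ e k) \<in> lring R ({1..N} - {l}) x"
proof -
  have 1: "x k ^ e k \<in> lring R ({1..N} - {l}) x" if "k \<in> {1..N}" for k
    using that assms by (cases "k = l") (auto intro!: subring_power lring_var simp: subringD)
  have 2: "inverse (x k) ^ e k \<in> lring R ({1..N} - {l}) x" if "k \<in> {1..N}" for k
    using that assms by (cases "k = l") (auto intro!: subring_power lring_inv simp: subringD)
  show "(\<Prod>k=1..N. x k ^ e k) \<in> lring R ({1..N} - {l}) x" by (intro subring_prod 1) auto
  show "inverse (\<Prod>k=1..N. x k ^ e k) \<in> lring R ({1..N} - {l}) x"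
    unfolding prod_inversef[symmetric] power_inverse[symmetric] comp_def
    by (intro subring_prod) (use 2 in auto)
qed

lemma yhat_in_lring:
  assumes "beta d B l l = 0" shows "yhat N x d B l \<in> lring R ({1..N} - {l}) x"
  unfolding yhat_def
proof (intro subring_prod is_subring_lring)
  fix k assume "k \<in> {1..N}"
  then show "x k powi beta d B k l \<in> lring R ({1..N} - {l}) x"
    using assms by (cases "k = l") (auto intro!: lring_powi simp: subringD)
qed

lemma monomial_in_rgen:
  assumes l: "l \<in> {1..N}" and D: "is_subring D" "lring R ({1..N} - {l}) x \<subseteq> D" "x l \<in> D"
  shows "(\<Prod>k=1..N. x k ^ e k) \<in> D"
    and "e l > 0 \<Longrightarrow> \<exists>s\<in>D. (\<Prod>k=1..N. x k ^ e k) = x l * s"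
proof -
  have var: "x k \<in> D" if "k \<in> {1..N}" for k
    using that D by (cases "k = l") (auto intro!: subsetD[OF D(2)] lring_var)
  then show "(\<Prod>k=1..N. x k ^ e k) \<in> D" by (intro subring_prod subring_power D(1)) auto
  assume e: "e l > 0"
  have "(\<Prod>k=1..N. x k ^ e k) = x l ^ e l * (\<Prod>k\<in>{1..N}-{l}. x k ^ e k)"
    by (rule prod.remove) (use l in auto)
  also have "x l ^ e l = x l * x l ^ (e l - 1)" using e by (cases "e l") auto
  finally have "(\<Prod>k=1..N. x k ^ e k) = x l * (x l ^ (e l - 1) * (\<Prod>k\<in>{1..N}-{l}. x k ^ e k))"
    by (simp add: mult_ac)
  moreover have "x l ^ (e l - 1) * (\<Prod>k\<in>{1..N}-{l}. x k ^ e k) \<in> D"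
    by (intro subring_mult subring_power subring_prod D(1) D(3) var) auto
  ultimately show "\<exists>s\<in>D. (\<Prod>k=1..N. x k ^ e k) = x l * s" by blast
qed

lemma power_int_prod:
  fixes f :: "'b \<Rightarrow> 'a::field" shows "(\<Prod>k\<in>A. f k) powi c = (\<Prod>k\<in>A. f k powi c)"
  by (induction A rule: infinite_finite_induct) (auto simp: power_int_mult_distrib)

text \<open>Matrix mutation adds to column \<open>l\<close>, divided by d l, the multiple by
  \<open>c\<close> of the exponent vector of one of the two extreme terms of the exchange polynomial
  in direction \<open>i\<close>. The sign of \<open>c\<close> selects the term; for a
  skew-symmetrizable matrix it is one in which \<open>x l\<close> does not occur.\<close>

lemma beta_mutate:
  assumes "i \<noteq> l" "k \<noteq> i" "d i > 0" "d l > 0" "int (d i) dvd B k i" "int (d l) dvd B k l" "int (d l) dvd B i l"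
  defines "c \<equiv> beta d B i l"
  shows "beta d (mutate_matrix i B) k l =
    beta d B k l + c * int (eexp d B i (if c > 0 then d i else 0) k)"
proof -
  have kl: "B k l = int (d l) * beta d B k l" and il: "B i l = int (d l) * c"
    and ki: "B k i = int (d i) * beta d B k i"
    using assms by (auto simp: beta_def c_def)
  have pil: "pos_part (B i l) = int (d l) * pos_part c"
    unfolding il by (rule pos_part_mult) simp
  have pki: "pos_part (- B k i) = int (d i) * pos_part (- beta d B k i)"
    unfolding ki using pos_part_mult[of "int (d i)" "- beta d B k i"] by simp
  have "mutate_matrix i B k l =
    int (d l) * (beta d B k l + pos_part c * B k i + c * pos_part (- B k i))"
    using assms(1,2) pil by (simp add: mutate_matrix_def kl il algebra_simps)
  then have "beta d (mutate_matrix i B) k l = beta d B k l + pos_part c * B k i + c * pos_part (- B k i)"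
    using assms(4) by (simp add: beta_def)
  also have "\<dots> = beta d B k l + c * int (eexp d B i (if c > 0 then d i else 0) k)"
  proof (cases "c > 0")
    case True
    then show ?thesis
      using pos_part_diff[of "B k i"]
      by (simp add: int_eexp pki[unfolded ki] pos_part_def[of c] ki algebra_simps)
  next
    case False
    then show ?thesis by (simp add: int_eexp pki pos_part_def[of c])
  qed
  finally show ?thesis .
qed

lemma beta_mutate_row: "i \<noteq> l \<Longrightarrow> int (d l) dvd B i l \<Longrightarrow> beta d (mutate_matrix i B) i l = - beta d B i l"
  by (auto simp: beta_def mutate_matrix_def dvd_neg_div)

text \<open>The mutation rule for the hat variables. For the exchange polynomial \<open>f\<close> of
  direction \<open>i\<close>, \<open>f / M\<close> is normalized by the extreme term from
  \<open>beta_mutate\<close>; it will be 1 modulo \<open>x l\<close> when \<open>c\<close> is not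
  0.\<close>

lemma yhat_mutate:
  assumes i: "i \<in> {1..N}" "i \<noteq> l" and d: "d i > 0" "d l > 0"
    and dvd: "\<And>k. k \<in> {1..N} \<Longrightarrow> int (d i) dvd B k i" "\<And>k. k \<in> {1..N} \<Longrightarrow> int (d l) dvd B k l"
    and nz: "\<And>k. k \<in> {1..N} \<Longrightarrow> x k \<noteq> 0" and f: "f \<noteq> 0" and ii: "beta d B i i = 0"
  defines "c \<equiv> beta d B i l"
  defines "M \<equiv> eterm N x d B i (if c > 0 then d i else 0)"
  shows "yhat N (x(i := f / x i)) d (mutate_matrix i B) l = yhat N x d B l * (f / M) powi (- c)"
proof -
  let ?j = "if c > 0 then d i else 0"
  let ?e = "\<lambda>k. int (eexp d B i ?j k)"
  have e_i: "eexp d B i ?j i = 0" by (simp add: eexp_def ii pos_part_def)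
  have "M \<noteq> 0" using nz by (simp add: M_def eterm_def)
  have M: "M = (\<Prod>k\<in>{1..N}-{i}. x k powi ?e k)"
    unfolding M_def eterm_def using prod.remove[of "{1..N}" i "\<lambda>k. x k ^ eexp d B i ?j k"] i(1) e_i by simp
  have "yhat N (x(i := f / x i)) d (mutate_matrix i B) l =
    (f / x i) powi (- c) * (\<Prod>k\<in>{1..N}-{i}. x k powi (beta d B k l + c * ?e k))"
    unfolding yhat_def
  proof (subst prod.remove[of _ i], goal_cases)
    case 3
    have "(\<Prod>k\<in>{1..N}-{i}. (x(i := f / x i)) k powi beta d (mutate_matrix i B) k l) =
      (\<Prod>k\<in>{1..N}-{i}. x k powi (beta d B k l + c * ?e k))"
    proof (intro prod.cong refl)
      fix k assume k: "k \<in> {1..N} - {i}"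
      then have "beta d (mutate_matrix i B) k l = beta d B k l + c * ?e k"
        unfolding c_def by (intro beta_mutate) (use i d dvd in auto)
      then show "(x(i := f / x i)) k powi beta d (mutate_matrix i B) k l = x k powi (beta d B k l + c * ?e k)"
        using k by simp
    qed
    then show ?case using i dvd by (simp add: beta_mutate_row c_def)
  qed (use i in auto)
  also have "(\<Prod>k\<in>{1..N}-{i}. x k powi (beta d B k l + c * ?e k)) =
    (\<Prod>k\<in>{1..N}-{i}. x k powi beta d B k l) * M powi c"
    unfolding M power_int_prod prod.distrib[symmetric]
  proof (intro prod.cong refl)
    fix k assume "k \<in> {1..N} - {i}"
    then have "x k \<noteq> 0" using nz by simp
    then show "x k powi (beta d B k l + c * ?e k) = x k powi beta d B k l * (x k powi ?e k) powi c"
      by (simp add: power_int_add mult.commute[of c] power_int_mult)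
  qed
  also have "(f / x i) powi (- c) = f powi (- c) * x i powi c"
    using nz[OF i(1)] f by (simp add: power_int_divide_distrib power_int_minus field_simps)
  also have "f powi (- c) * x i powi c * ((\<Prod>k\<in>{1..N}-{i}. x k powi beta d B k l) * M powi c) =
    (x i powi c * (\<Prod>k\<in>{1..N}-{i}. x k powi beta d B k l)) * (f / M) powi (- c)"
    using \<open>M \<noteq> 0\<close> f by (simp add: power_int_divide_distrib power_int_minus field_simps)
  also have "x i powi c * (\<Prod>k\<in>{1..N}-{i}. x k powi beta d B k l) = yhat N x d B l"
    unfolding yhat_def c_def by (rule prod.remove[symmetric]) (use i in auto)
  finally show ?thesis .
qed

text \<open>Since \<open>g\<close> is 1 modulo \<open>t\<close>, replacing \<open>y\<close> by \<open>y g\<^sup>c\<close> changes the sum only modulo \<open>t\<close>, once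
  denominators \<open>g\<close> are allowed.\<close>

lemma sum_substitute_in_loc:
  assumes D: "is_subring D" and t: "t \<noteq> 0" "t' \<in> D" "t \<in> D" and s: "s \<in> D" and g: "g = 1 + t * s" "g \<noteq> 0"
    and \<rho>: "\<And>j. j \<le> d \<Longrightarrow> \<rho> j \<in> D" and y: "y \<in> D" and q: "q \<in> D"
    and rel: "(\<Sum>j=0..d. \<rho> j * y ^ j) = t * t' * q"
  shows "(\<Sum>j=0..d. \<rho> j * (y * g powi c) ^ j) / t \<in> loc D g"
proof -
  have gD: "g \<in> D" unfolding g(1) by (intro subring_add subring_1 subring_mult D s t)
  have pow: "\<exists>r\<in>D. g ^ e = 1 + t * r" for e
  proof (induction e)
    case 0
    then show ?case using subring_0[OF D] by auto
  next
    case (Suc e)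
    then obtain r where r: "r \<in> D" "g ^ e = 1 + t * r" by blast
    have "g ^ Suc e = 1 + t * (s + g * r)" by (simp add: r(2)) (simp add: g(1) algebra_simps)
    then show ?case using r(1) gD D s by (blast intro: subring_add subring_mult)
  qed
  have main: "(\<Sum>j=0..d. \<rho> j * y ^ j * g ^ e j) / t \<in> D" for e :: "nat \<Rightarrow> nat"
  proof -
    have "\<exists>r. \<forall>j. r j \<in> D \<and> g ^ e j = 1 + t * r j" using pow by (intro choice) blast
    then obtain r where r: "\<And>j. r j \<in> D" "\<And>j. g ^ e j = 1 + t * r j" by blast
    have "(\<Sum>j=0..d. \<rho> j * y ^ j * g ^ e j) = (\<Sum>j=0..d. \<rho> j * y ^ j) + t * (\<Sum>j=0..d. \<rho> j * y ^ j * r j)"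
      by (simp add: r(2) distrib_left sum.distrib sum_distrib_left mult_ac)
    also have "\<dots> / t = t' * q + (\<Sum>j=0..d. \<rho> j * y ^ j * r j)"
      using t(1) by (simp add: rel field_simps)
    also have "\<dots> \<in> D"
      by (intro subring_add subring_mult subring_sum subring_power D t q \<rho> y r(1)) auto
    finally show ?thesis .
  qed
  show ?thesis
  proof (cases "c \<ge> 0")
    case True
    then have "(\<Sum>j=0..d. \<rho> j * (y * g powi c) ^ j) = (\<Sum>j=0..d. \<rho> j * y ^ j * g ^ (nat c * j))"
      by (intro sum.cong) (auto simp: power_int_def power_mult_distrib power_mult)
    then show ?thesis using main[of "\<lambda>j. nat c * j"] by (simp add: loc_base)
  next
    case False
    \<comment> \<open>For negative \<open>c\<close>, multiplication by \<open>g ^ (b * d)\<close>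
      makes all exponents of \<open>g\<close> non-negative.\<close>
    define b where "b = nat (- c)"
    have "(\<Sum>j=0..d. \<rho> j * (y * g powi c) ^ j) * g ^ (b * d) =
      (\<Sum>j=0..d. \<rho> j * y ^ j * g ^ (b * (d - j)))"
      unfolding sum_distrib_right
    proof (intro sum.cong refl)
      fix j assume "j \<in> {0..d}"
      then have "b * d = b * j + b * (d - j)" by (simp flip: add_mult_distrib2)
      then have "g ^ (b * d) = (g ^ b) ^ j * g ^ (b * (d - j))" by (simp add: power_add power_mult)
      moreover have "g powi c * g ^ b = 1"
        using False g(2) by (simp add: power_int_def b_def power_inverse)
      then have "(g powi c) ^ j * (g ^ b) ^ j = 1" by (simp flip: power_mult_distrib)
      then have "\<rho> j * (y * g powi c) ^ j * ((g ^ b) ^ j * z) = \<rho> j * y ^ j * z" for z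
        by (simp add: power_mult_distrib mult.assoc)
      ultimately show "\<rho> j * (y * g powi c) ^ j * g ^ (b * d) = \<rho> j * y ^ j * g ^ (b * (d - j))"
        by (simp only:)
    qed
    then have "(\<Sum>j=0..d. \<rho> j * (y * g powi c) ^ j) / t * g ^ (b * d) \<in> D"
      using main[of "\<lambda>j. b * (d - j)"] by (simp add: mult.commute)
    then show ?thesis by (auto simp: loc_def)
  qed
qed

section \<open>Upper bounds and mutation\<close>

lemma skew_symmetrizable_diag: "skew_symmetrizable n B \<Longrightarrow> i \<in> {1..n} \<Longrightarrow> B i i = 0"
  unfolding skew_symmetrizable_def by force

lemma skew_symmetrizable_sgn:
  assumes "skew_symmetrizable n B" "i \<in> {1..n}" "j \<in> {1..n}"
  shows "B i j > 0 \<longleftrightarrow> B j i < 0"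
proof -
  obtain \<delta> :: "nat \<Rightarrow> int" where \<delta>: "\<delta> i > 0" "\<delta> j > 0" "\<delta> i * B i j = - (\<delta> j * B j i)"
    using assms unfolding skew_symmetrizable_def by blast
  have "B i j > 0 \<longleftrightarrow> \<delta> i * B i j > 0" using \<delta>(1) by (simp add: zero_less_mult_iff)
  also have "\<dots> \<longleftrightarrow> \<delta> j * B j i < 0" using \<delta>(3) by simp
  also have "\<dots> \<longleftrightarrow> B j i < 0" using \<delta>(2) by (simp add: mult_less_0_iff)
  finally show ?thesis .
qed

lemma skew_symmetrizable_0:
  assumes "skew_symmetrizable n B" "i \<in> {1..n}" "j \<in> {1..n}"
  shows "B i j = 0 \<longleftrightarrow> B j i = 0"
  using skew_symmetrizable_sgn[OF assms] skew_symmetrizable_sgn[OF assms(1,3,2)] by linarith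

lemma beta_pos_iff: "d i > 0 \<Longrightarrow> int (d i) dvd B k i \<Longrightarrow> beta d B k i > 0 \<longleftrightarrow> B k i > 0"
  by (auto simp: beta_def elim!: dvdE simp: zero_less_mult_iff)

lemma beta_0_iff: "d i > 0 \<Longrightarrow> int (d i) dvd B k i \<Longrightarrow> beta d B k i = 0 \<longleftrightarrow> B k i = 0"
  by (auto simp: beta_def elim!: dvdE)

lemma beta_neg_iff: "d i > 0 \<Longrightarrow> int (d i) dvd B k i \<Longrightarrow> beta d B k i < 0 \<longleftrightarrow> B k i < 0"
  using beta_pos_iff[of d i B k] beta_0_iff[of d i B k] by linarith

text \<open>Equivalently, the columns of \<open>B\<close> without the rows in \<open>F\<close> are linearly independent. A vector \<open>w\<close> is
  a grading of the variables in which the elements \<open>yhat\<close> have prescribed degrees, up to a scalar.\<close>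

definition full_rank :: "nat \<Rightarrow> nat \<Rightarrow> nat set \<Rightarrow> (nat \<Rightarrow> nat \<Rightarrow> int) \<Rightarrow> bool" where
  "full_rank n N F B \<longleftrightarrow> (\<exists>D>0. \<forall>\<tau>. \<exists>w :: nat \<Rightarrow> int. (\<forall>k\<in>F. w k = 0) \<and>
    (\<forall>l\<in>{1..n}. (\<Sum>k=1..N. w k * B k l) = D * \<tau> l))"

definition good_seed ::
    "'a::field set \<Rightarrow> nat \<Rightarrow> nat \<Rightarrow> nat set \<Rightarrow> (nat \<Rightarrow> nat) \<Rightarrow> (nat \<Rightarrow> 'a) \<Rightarrow> (nat \<Rightarrow> nat \<Rightarrow> 'a) \<Rightarrow>
      (nat \<Rightarrow> nat \<Rightarrow> int) \<Rightarrow> bool" where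
  "good_seed R n m F d x \<rho> B \<longleftrightarrow> is_subring R \<and> ind R {1..n+m} x \<and> F \<subseteq> {n+1..n+m} \<and>
    skew_symmetrizable n B \<and> full_rank n (n + m) F B \<and>
    (\<forall>i\<in>{1..n}. d i > 0 \<and> (\<forall>k\<in>{1..n+m}. int (d i) dvd B k i)) \<and>
    (\<forall>i\<in>{1..n}. \<rho> i 0 = 1 \<and> \<rho> i (d i) = 1 \<and> (\<forall>j\<le>d i. \<rho> i j \<in> lring R F x))"

text \<open>One ring for each direction \<open>i\<close>; their intersection over all
  \<open>i\<close> is the upper bound of Berenstein, Fomin and Zelevinsky.\<close>

definition ub :: "'a::field set \<Rightarrow> nat \<Rightarrow> nat \<Rightarrow> (nat \<Rightarrow> nat) \<Rightarrow> 'a seed \<Rightarrow> nat \<Rightarrow> 'a set" where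
  "ub R n m d S i = rgen (lring R ({1..n+m} - {i}) (fst S) \<union>
    {fst S i, exchange_polynomial n m d S i / fst S i})"

section \<open>Degrees of exchange polynomials and regular pairs\<close>

lemma T_powi_sum: "T powi (\<Sum>k\<in>A. a k) = (\<Prod>k\<in>A. T powi a k)"
  by (induction A rule: infinite_finite_induct) (auto simp: power_int_add)

lemma cst_prod: "cst (\<Prod>k\<in>A. f k) = (\<Prod>k\<in>A. cst (f k))"
  by (induction A rule: infinite_finite_induct) (simp_all add: cst_1 cst_mult)

lemma lift_monomial:
  assumes R: "is_subring R"
    and "\<And>k. k \<in> A \<Longrightarrow> e k \<noteq> 0 \<Longrightarrow> lift R I x w (x k) (cst (x k) * T powi w k)"
  shows "lift R I x w (\<Prod>k\<in>A. x k ^ e k) (cst (\<Prod>k\<in>A. x k ^ e k) * T powi (\<Sum>k\<in>A. w k * int (e k)))"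
proof -
  have "lift R I x w (x k ^ e k) ((cst (x k) * T powi w k) ^ e k)" if "k \<in> A" for k
    by (cases "e k = 0") (use that assms in \<open>auto intro: lift_1 lift_power\<close>)
  then have "lift R I x w (\<Prod>k\<in>A. x k ^ e k) (\<Prod>k\<in>A. (cst (x k) * T powi w k) ^ e k)"
    by (rule lift_prod[OF R])
  also have "(\<Prod>k\<in>A. (cst (x k) * T powi w k) ^ e k) =
    cst (\<Prod>k\<in>A. x k ^ e k) * T powi (\<Sum>k\<in>A. w k * int (e k))"
    unfolding cst_prod T_powi_sum cst_power prod.distrib[symmetric]
    by (intro prod.cong refl) (simp add: power_mult_distrib power_int_mult)
  finally show ?thesis .
qed

text \<open>\<open>wt\<close> is the degree of \<open>yhat\<close> in direction \<open>j\<close>, so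
  the s-th term has degree a + s * wt, where \<open>a\<close> is the degree of the term s = 0 and
  may be negative. The condition on \<open>beta d B l j\<close> says that \<open>x l\<close> does
  not occur, so it can be left out of the variables.\<close>

lemma lift_exchange:
  assumes good: "good_seed R n m F d x \<rho> B" and w: "\<And>k. k \<in> F \<Longrightarrow> w k = 0"
    and j: "j \<in> {1..n}" and l: "l \<in> {1..n}" "beta d B l j = 0"
    and wt: "wt = (\<Sum>k=1..n+m. w k * beta d B k j)" "wt \<ge> 0"
  shows "\<exists>a. lift (lring R F x) ({1..n+m} - F - {l}) x w (exchange_polynomial n m d (x, \<rho>, B) j)
    (T powi a * to_fract (\<Sum>s=0..d j. monom (\<rho> j s * eterm (n + m) x d B j s) (s * nat wt)))"
proof
  let ?N = "n + m"
  let ?R = "lring R F x" and ?I = "{1..?N} - F - {l}"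
  have R: "is_subring ?R" by simp
  define a where "a = (\<Sum>k=1..?N. w k * (int (d j) * pos_part (- beta d B k j)))"
  have weight: "(\<Sum>k=1..?N. w k * int (eexp d B j s k)) = a + int s * wt" if "s \<le> d j" for s
    unfolding a_def wt(1) sum_distrib_left sum.distrib[symmetric]
    by (intro sum.cong refl) (simp add: int_eexp[of s d j B] that algebra_simps)
  have lift_x: "lift ?R ?I x w (x k) (cst (x k) * T powi w k)" if "k \<in> {1..?N}" "k \<noteq> l" for k
  proof (cases "k \<in> F")
    case True
    then show ?thesis using lift_base[of "x k" ?R ?I x w] w by (simp add: lring_var)
  next
    case False
    then show ?thesis using that by (intro lift_var) auto
  qed
  have exp_l: "eexp d B j s l = 0" for s
    using l by (auto simp: eexp_def pos_part_def)
  have "lift ?R ?I x w (\<Sum>s=0..d j. \<rho> j s * eterm ?N x d B j s)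
    (\<Sum>s=0..d j. cst (\<rho> j s) * (cst (eterm ?N x d B j s) * T powi (a + int s * wt)))"
  proof (rule lift_sum[OF R], rule lift_mult)
    fix s assume s: "s \<in> {0..d j}"
    show "lift ?R ?I x w (\<rho> j s) (cst (\<rho> j s))"
      by (rule lift_base) (use good s j in \<open>auto simp: good_seed_def\<close>)
    have "lift ?R ?I x w (eterm ?N x d B j s)
      (cst (eterm ?N x d B j s) * T powi (\<Sum>k=1..?N. w k * int (eexp d B j s k)))"
      unfolding eterm_def
      by (rule lift_monomial[OF R], rule lift_x) (use exp_l in \<open>auto intro: ccontr\<close>)
    then show "lift ?R ?I x w (eterm ?N x d B j s) (cst (eterm ?N x d B j s) * T powi (a + int s * wt))"
      using weight[of s] s by simp
  qed
  also have "(\<Sum>s=0..d j. cst (\<rho> j s) * (cst (eterm ?N x d B j s) * T powi (a + int s * wt))) =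
    T powi a * to_fract (\<Sum>s=0..d j. monom (\<rho> j s * eterm ?N x d B j s) (s * nat wt))"
    unfolding to_fract_sum sum_distrib_left
  proof (intro sum.cong refl)
    fix s
    have "int s * wt = int (s * nat wt)" using wt(2) by simp
    then have T: "T powi (a + int s * wt) = T powi a * T ^ (s * nat wt)"
      by (simp only: power_int_add[OF disjI1[OF T_nonzero]] power_int_of_nat)
    show "cst (\<rho> j s) * (cst (eterm ?N x d B j s) * T powi (a + int s * wt)) =
        T powi a * to_fract (monom (\<rho> j s * eterm ?N x d B j s) (s * nat wt))"
      unfolding to_fract_monom cst_mult T by (simp only: mult_ac)
  qed
  finally show "lift ?R ?I x w (exchange_polynomial n m d (x, \<rho>, B) j)
    (T powi a * to_fract (\<Sum>s=0..d j. monom (\<rho> j s * eterm ?N x d B j s) (s * nat wt)))"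
    unfolding exchange_polynomial_eterm .
qed

text \<open>Prescribe the degree D at column \<open>l\<close> and 0 at all other columns; passing
  from \<open>B\<close> to \<open>beta\<close> divides these degrees by positive integers
  only.\<close>

lemma separating_weights:
  assumes good: "good_seed R n m F d x \<rho> B" and l: "l \<in> {1..n}"
  obtains w where "\<And>k. k \<in> F \<Longrightarrow> w k = 0" "(\<Sum>k=1..n+m. w k * beta d B k l) > 0"
    "\<And>j. j \<in> {1..n} \<Longrightarrow> j \<noteq> l \<Longrightarrow> (\<Sum>k=1..n+m. w k * beta d B k j) = 0"
proof -
  let ?N = "n + m"
  have d: "d j > 0" "\<And>k. k \<in> {1..?N} \<Longrightarrow> int (d j) dvd B k j" if "j \<in> {1..n}" for j
    using good that by (auto simp: good_seed_def)
  have beta: "B k j = int (d j) * beta d B k j" if "j \<in> {1..n}" "k \<in> {1..?N}" for j k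
    using d[OF that(1)] that(2) by (simp add: beta_def)
  obtain D where D: "D > 0" "\<forall>\<tau>. \<exists>w :: nat \<Rightarrow> int. (\<forall>k\<in>F. w k = 0) \<and>
      (\<forall>l\<in>{1..n}. (\<Sum>k=1..?N. w k * B k l) = D * \<tau> l)"
    using good by (auto simp: good_seed_def full_rank_def)
  obtain w where w: "\<forall>k\<in>F. w k = 0"
    "\<forall>j\<in>{1..n}. (\<Sum>k=1..?N. w k * B k j) = D * (if j = l then 1 else 0)"
    using D(2)[rule_format, of "\<lambda>j. if j = l then 1 else 0"] by blast
  have wt: "int (d j) * (\<Sum>k=1..?N. w k * beta d B k j) = (\<Sum>k=1..?N. w k * B k j)" if "j \<in> {1..n}" for j
    unfolding sum_distrib_left by (intro sum.cong) (simp_all add: beta[OF that])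
  show ?thesis
  proof (rule that)
    have "int (d l) * (\<Sum>k=1..?N. w k * beta d B k l) > 0" using wt[OF l] w(2) l D(1) by simp
    then show "(\<Sum>k=1..?N. w k * beta d B k l) > 0" by (simp add: zero_less_mult_iff)
    fix j assume j: "j \<in> {1..n}" "j \<noteq> l"
    then have "int (d j) * (\<Sum>k=1..?N. w k * beta d B k j) = 0" using wt[of j] w(2) by simp
    then show "(\<Sum>k=1..?N. w k * beta d B k j) = 0" using d(1)[OF j(1)] by simp
  qed (use w in auto)
qed

text \<open>In a separating grading for \<open>l\<close> the top component of the l-th exchange
  polynomial is its term s = d l, a monomial and hence a unit. So its lift is not 0, and neither is
  the polynomial. The i-th one is homogeneous, and \<open>regular_if_homogeneous\<close>
  applies.\<close>

lemma regular_exchange: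
  assumes good: "good_seed R n m F d x \<rho> B" and l: "l \<in> {1..n}"
  shows exchange_nonzero: "exchange_polynomial n m d (x, \<rho>, B) l \<noteq> 0"
    and "i \<in> {1..n} \<Longrightarrow> i \<noteq> l \<Longrightarrow> B i l = 0 \<Longrightarrow> exchange_polynomial n m d (x, \<rho>, B) i \<noteq> 0 \<Longrightarrow>
      regular (lring R ({1..n+m} - {l}) x)
        (exchange_polynomial n m d (x, \<rho>, B) i) (exchange_polynomial n m d (x, \<rho>, B) l)"
proof -
  let ?N = "n + m"
  let ?R = "lring R F x" and ?I = "{1..?N} - F - {l}"
  have R: "is_subring ?R" by simp
  have F: "F \<subseteq> {n+1..?N}" using good by (simp add: good_seed_def)
  have ring: "lring ?R ?I x = lring R ({1..?N} - {l}) x"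
    unfolding lring_lring using F l by (intro arg_cong[of _ _ "\<lambda>A. lring R A x"]) auto
  have "ind R (F \<union> ?I) x"
    by (rule ind_subset[of R "{1..?N}"]) (use good F in \<open>auto simp: good_seed_def\<close>)
  then have ind: "ind ?R ?I x" by (rule ind_lring) auto
  have nz: "x k \<noteq> 0" if "k \<in> {1..?N}" for k
    using good that ind_nonzero unfolding good_seed_def by blast
  have skew: "skew_symmetrizable n B" using good by (simp add: good_seed_def)
  have ll: "beta d B l l = 0"
    using skew_symmetrizable_diag[OF skew l] by (simp add: beta_def)
  obtain w where w: "\<And>k. k \<in> F \<Longrightarrow> w k = 0" and wl: "(\<Sum>k=1..?N. w k * beta d B k l) > 0"
    and wi: "\<And>j. j \<in> {1..n} \<Longrightarrow> j \<noteq> l \<Longrightarrow> (\<Sum>k=1..?N. w k * beta d B k j) = 0"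
    using separating_weights[OF good l] by blast
  define wt where "wt = (\<Sum>k=1..?N. w k * beta d B k l)"
  let ?f = "exchange_polynomial n m d (x, \<rho>, B) l"
  let ?c = "\<lambda>s. \<rho> l s * eterm ?N x d B l s"
  define q where "q = (\<Sum>s=0..d l. monom (?c s) (s * nat wt))"
  obtain a where a: "lift ?R ?I x w ?f (T powi a * to_fract q)"
    using lift_exchange[OF good w l l ll wt_def] wl unfolding wt_def q_def by auto
  have c_d: "?c (d l) = eterm ?N x d B l (d l)" using good l by (simp add: good_seed_def)
  have "coeff q (d l * nat wt) = (\<Sum>s=0..d l. if s = d l then ?c s else 0)"
    unfolding q_def coeff_sum by (intro sum.cong) (use wl in \<open>auto simp: wt_def\<close>)
  then have lead: "coeff q (d l * nat wt) = eterm ?N x d B l (d l)" using c_d by simp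
  have lead0: "eterm ?N x d B l (d l) \<noteq> 0" using nz by (simp add: eterm_def)
  have q0: "q \<noteq> 0" using lead lead0 by auto
  have "degree q \<le> d l * nat wt"
    unfolding q_def by (rule degree_sum_le) (auto intro!: order_trans[OF degree_monom_le] mult_right_mono)
  then have deg: "degree q = d l * nat wt" using lead lead0 by (metis le_antisym le_degree)
  show "?f \<noteq> 0"
  proof
    assume "?f = 0"
    then have "lift ?R ?I x w 0 (T powi a * to_fract q)" using a by argo
    then have "T powi a * to_fract q = 0" by (rule lift_functional[OF R _ ind, rotated]) simp
    then show False using q0 by simp
  qed
  let ?p = "exchange_polynomial n m d (x, \<rho>, B) i"
  assume i: "i \<in> {1..n}" "i \<noteq> l" "B i l = 0" "?p \<noteq> 0"
  have li: "beta d B l i = 0"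
    using skew_symmetrizable_0[OF skew i(1) l] i(3) by (simp add: beta_def)
  obtain b where b: "lift ?R ?I x w ?p
      (T powi b * to_fract (\<Sum>s=0..d i. monom (\<rho> i s * eterm ?N x d B i s) (s * nat 0)))"
    using lift_exchange[OF good w i(1) l li wi[OF i(1,2), symmetric]] by auto
  \<comment> \<open>As \<open>yhat\<close> has degree 0 in direction \<open>i\<close>, the
    polynomial in \<open>T\<close> is constant.\<close>
  have "(\<Sum>s=0..d i. monom (\<rho> i s * eterm ?N x d B i s) (s * nat 0)) = [:?p:]"
    unfolding exchange_polynomial_eterm by (simp add: poly_eq_iff coeff_sum coeff_pCons split: nat.splits)
  then have p: "lift ?R ?I x w ?p (cst ?p * T powi b)" using b by (simp add: mult.commute)
  show "regular (lring R ({1..?N} - {l}) x) ?p ?f"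
    unfolding ring[symmetric]
  proof (rule regular_if_homogeneous[OF R _ ind p i(4) a])
    show "poly q 1 = ?f"
      by (simp add: q_def poly_sum poly_monom exchange_polynomial_eterm)
    have exp_l: "eexp d B l s l = 0" for s by (simp add: eexp_def ll pos_part_def)
    show "coeffs_in (lring ?R ?I x) q"
      unfolding q_def
    proof (intro coeffs_in_sum coeffs_in_monom is_subring_lring)
      fix s assume "s \<in> {0..d l}"
      then have "\<rho> l s \<in> lring ?R ?I x" using good l by (auto simp: good_seed_def intro: lring_base)
      then show "?c s \<in> lring ?R ?I x"
        unfolding ring eterm_def by (intro subring_mult is_subring_lring monomial_in_lring exp_l)
    qed
    show "inverse (lead_coeff q) \<in> lring ?R ?I x"
      unfolding deg lead ring eterm_def by (rule monomial_in_lring) (simp add: exp_l)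
  qed (use q0 in auto)
qed

text \<open>Column \<open>i\<close> changes sign and \<open>\<rho> i\<close> is reversed, so the new
  term \<open>j\<close> is the old term d i - j; the exchanged variable itself does not
  occur.\<close>

lemma exchange_polynomial_mutate:
  assumes dvd: "\<And>k. k \<in> {1..n+m} \<Longrightarrow> int (d i) dvd B k i" and ii: "beta d B i i = 0"
  shows "exchange_polynomial n m d (mutate n m d i (x, \<rho>, B)) i = exchange_polynomial n m d (x, \<rho>, B) i"
proof -
  let ?N = "n + m"
  define f where "f = exchange_polynomial n m d (x, \<rho>, B) i"
  define x' where "x' = x(i := f / x i)"
  define \<rho>' where "\<rho>' = \<rho>(i := (\<lambda>j. \<rho> i (d i - j)))"
  define B' where "B' = mutate_matrix i B"
  have S': "mutate n m d i (x, \<rho>, B) = (x', \<rho>', B')"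
    by (simp add: mutate.simps x'_def \<rho>'_def B'_def f_def)
  have beta': "beta d B' k i = - beta d B k i" if "k \<in> {1..?N}" for k
    using dvd[OF that] by (simp add: B'_def mutate_matrix_def beta_def dvd_neg_div)
  have "exchange_polynomial n m d (x', \<rho>', B') i =
    (\<Sum>j=0..d i. \<rho> i (d i - j) * eterm ?N x d B i (d i - j))"
    unfolding exchange_polynomial_eterm
  proof (intro sum.cong refl)
    fix j assume j: "j \<in> {0..d i}"
    have "eterm ?N x' d B' i j = eterm ?N x d B i (d i - j)"
      unfolding eterm_def
    proof (intro prod.cong refl)
      fix k assume k: "k \<in> {1..?N}"
      have e: "eexp d B' i j k = eexp d B i (d i - j) k"
        using j by (simp add: eexp_def beta'[OF k] add.commute)
      show "x' k ^ eexp d B' i j k = x k ^ eexp d B i (d i - j) k"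
      proof (cases "k = i")
        case True
        then show ?thesis unfolding e using ii by (simp add: eexp_def pos_part_def)
      qed (simp add: e x'_def)
    qed
    then show "\<rho>' i j * eterm ?N x' d B' i j = \<rho> i (d i - j) * eterm ?N x d B i (d i - j)"
      by (simp add: \<rho>'_def)
  qed
  also have "\<dots> = f"
    unfolding f_def exchange_polynomial_eterm atLeast0AtMost
    by (rule sum.reindex_bij_witness[of _ "\<lambda>j. d i - j" "\<lambda>j. d i - j"]) auto
  finally show ?thesis by (simp add: S' f_def)
qed

text \<open>For adjacent directions \<open>i\<close>
  and \<open>l\<close> the elements \<open>x l\<close> and \<open>f\<^sub>i\<close> are comaximal, otherwise the two exchange polynomials form a
  regular pair.\<close>

lemma ub_mutate:
  fixes x :: "nat \<Rightarrow> 'a::field"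
  assumes good: "good_seed R n m F d x \<rho> B" and i: "i \<in> {1..n}" and l: "l \<in> {1..n}"
    and y: "\<And>l. l \<in> {1..n} \<Longrightarrow> y \<in> ub R n m d (mutate n m d i (x, \<rho>, B)) l"
  shows "y \<in> ub R n m d (x, \<rho>, B) l"
proof -
  let ?N = "n + m"
  define f where "f = exchange_polynomial n m d (x, \<rho>, B) i"
  define x' where "x' = x(i := f / x i)"
  define \<rho>' where "\<rho>' = \<rho>(i := (\<lambda>j. \<rho> i (d i - j)))"
  define B' where "B' = mutate_matrix i B"
  have S': "mutate n m d i (x, \<rho>, B) = (x', \<rho>', B')"
    by (simp add: mutate.simps x'_def \<rho>'_def B'_def f_def)
  have R: "is_subring R" using good by (simp add: good_seed_def)
  have nz: "x k \<noteq> 0" if "k \<in> {1..?N}" for k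
    using good that ind_nonzero unfolding good_seed_def by blast
  have f0: "f \<noteq> 0" unfolding f_def by (rule exchange_nonzero[OF good i])
  have d: "d j > 0" "\<And>k. k \<in> {1..?N} \<Longrightarrow> int (d j) dvd B k j" if "j \<in> {1..n}" for j
    using good that by (auto simp: good_seed_def)
  have iN: "i \<in> {1..?N}" and lN: "l \<in> {1..?N}" using i l by auto
  have skew: "skew_symmetrizable n B" using good by (simp add: good_seed_def)
  have \<rho>_in: "\<rho> j s \<in> lring R F x" if "j \<in> {1..n}" "s \<le> d j" for j s
    using good that by (auto simp: good_seed_def)
  have F: "F \<subseteq> {n+1..?N}" using good by (simp add: good_seed_def)
  have ii: "beta d B i i = 0" and ll: "beta d B l l = 0"
    using skew_symmetrizable_diag[OF skew] i l by (simp_all add: beta_def)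
  \<comment> \<open>In direction \<open>i\<close> both seeds have the same ring: mutation
    interchanges the generators \<open>x i\<close> and \<open>f / x i\<close>.\<close>
  have y_i: "y \<in> rgen (lring R ({1..?N} - {i}) x \<union> {x i, f / x i})"
  proof -
    have "y \<in> ub R n m d (x', \<rho>', B') i" using y[OF i] by (simp add: S')
    moreover have "lring R ({1..?N} - {i}) x' = lring R ({1..?N} - {i}) x"
      by (rule lring_cong) (simp add: x'_def)
    moreover have "exchange_polynomial n m d (x', \<rho>', B') i = f"
      using exchange_polynomial_mutate[of n m d i B x \<rho>] d(2)[OF i] ii by (simp only: S' f_def)
    moreover have "f / (f / x i) = x i" using f0 nz[OF iN] by simp
    ultimately show ?thesis unfolding ub_def
      by (simp add: x'_def insert_commute)
  qed
  show ?thesis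
  proof (cases "l = i")
    case True
    show ?thesis using y_i by (simp add: True ub_def flip: f_def)
  next
    case False
    then have il: "i \<noteq> l" by simp
    define h where "h = exchange_polynomial n m d (x, \<rho>, B) l"
    let ?G = "lring R ({1..?N} - {l}) x"
    define D where "D = rgen (?G \<union> {x l, h / x l})"
    have D: "is_subring D" by (simp add: D_def)
    have GD: "?G \<subseteq> D" unfolding D_def by (auto intro: rgen_incl)
    have xl: "x l \<in> D" "h / x l \<in> D" unfolding D_def by (auto intro: rgen_incl)
    have xl0: "x l \<noteq> 0" using nz[OF lN] .
    have xi: "x i \<in> ?G" "inverse (x i) \<in> ?G" using il iN by (auto intro: lring_var lring_inv)
    have x_in: "x k \<in> ?G" "inverse (x k) \<in> ?G" if "k \<in> {1..?N} - {l}" for k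
      using that by (auto intro: lring_var lring_inv)
    have \<rho>D: "\<rho> j s \<in> D" if "j \<in> {1..n}" "s \<le> d j" for j s
      using \<rho>_in[OF that] lring_mono[of F "{1..?N} - {l}" R x] F l GD by fastforce
    have fD: "f \<in> D"
      unfolding f_def exchange_polynomial_eterm eterm_def
      by (intro subring_sum subring_mult D monomial_in_rgen(1)[OF lN D GD xl(1)] \<rho>D i) auto
    define c where "c = beta d B i l"
    define jM where "jM = (if c > 0 then d i else 0)"
    define M where "M = eterm ?N x d B i jM"
    have M0: "M \<noteq> 0" using nz by (simp add: M_def eterm_def)
    have c_pos: "c > 0 \<longleftrightarrow> beta d B l i < 0" and c_neg: "c < 0 \<longleftrightarrow> beta d B l i > 0"
      using beta_pos_iff[of d l B i] beta_neg_iff[of d l B i] beta_pos_iff[of d i B l] beta_neg_iff[of d i B l]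
        d[OF i] d[OF l] iN lN skew_symmetrizable_sgn[OF skew i l] skew_symmetrizable_sgn[OF skew l i]
      by (auto simp: c_def)
    have e_l: "eexp d B i jM l = 0"
      using c_pos c_neg by (auto simp: eexp_def jM_def pos_part_def)
    have M: "M \<in> ?G" "inverse M \<in> ?G"
      unfolding M_def eterm_def by (intro monomial_in_lring e_l)+
    have "beta d B' l l = beta d B l l + c * int (eexp d B i jM l)"
      unfolding B'_def c_def jM_def by (rule beta_mutate) (use il i l lN iN d in auto)
    then have "beta d B' l l = 0" by (simp add: e_l ll)
    then have e_l': "eexp d B' l 0 l = 0" by (simp add: eexp_def pos_part_def)
    have yh': "yhat ?N x' d B' l = yhat ?N x d B l * (f / M) powi (- c)"
      unfolding x'_def B'_def M_def jM_def c_def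
      by (rule yhat_mutate) (use il i l iN lN d nz f0 ii in auto)
    have x'0: "x' k \<noteq> 0" if "k \<in> {1..?N}" for k using nz[OF that] nz[OF iN] f0 by (simp add: x'_def)
    define h' where "h' = exchange_polynomial n m d (x', \<rho>', B') l"
    have h'_eq: "h' = eterm ?N x' d B' l 0 * (\<Sum>j=0..d l. \<rho> l j * (yhat ?N x d B l * (f / M) powi (- c)) ^ j)"
      unfolding h'_def using exchange_polynomial_yhat[of n m x' d \<rho>' B' l] x'0 il
      by (simp add: yh' \<rho>'_def)
    have h_eq: "h = eterm ?N x d B l 0 * (\<Sum>j=0..d l. \<rho> l j * yhat ?N x d B l ^ j)"
      unfolding h_def using exchange_polynomial_yhat[of n m x d \<rho> B l] nz by blast
    have m_l: "eterm ?N x d B l 0 \<in> ?G" "inverse (eterm ?N x d B l 0) \<in> ?G"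
      unfolding eterm_def by (intro monomial_in_lring; simp add: eexp_def ll pos_part_def)+
    have m_l0: "eterm ?N x d B l 0 \<noteq> 0" using nz by (simp add: eterm_def)
    have y_l: "y \<in> rgen (lring R ({1..?N} - {l}) x' \<union> {x l, h' / x l})"
      using y[OF l] il by (simp add: S' ub_def h'_def x'_def)
    \<comment> \<open>Among the variables only \<open>x l\<close> may fail to be invertible in
      \<open>D\<close>, and D[1/x l] contains the ring of direction \<open>i\<close>.\<close>
    have loc1: "y \<in> loc D (x l)"
    proof -
      have L: "is_subring (loc D (x l))" by (rule is_subring_loc[OF D xl(1)])
      have x_loc: "x k \<in> loc D (x l) \<and> inverse (x k) \<in> loc D (x l)" if "k \<in> {1..?N}" for k
      proof (cases "k = l")
        case True
        then show ?thesis using xl loc_divide[OF subring_1[OF D] subring_0[OF D], of "x l" 1]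
          by (auto intro: loc_base simp: inverse_eq_divide)
      next
        case False
        then show ?thesis using x_in[of k] that GD by (auto intro!: loc_base)
      qed
      have "R \<subseteq> loc D (x l)" using GD by (auto intro!: loc_base lring_base)
      then have "lring R ({1..?N} - {i}) x \<subseteq> loc D (x l)"
        using x_loc by (intro lring_least[OF L]) auto
      moreover have "f / x i \<in> loc D (x l)"
        unfolding divide_inverse using fD x_loc[OF iN] by (intro subring_mult[OF L]) (auto intro: loc_base)
      ultimately have "rgen (lring R ({1..?N} - {i}) x \<union> {x i, f / x i}) \<subseteq> loc D (x l)"
        using x_loc[OF iN] by (intro rgen_least[OF L]) auto
      then show ?thesis using y_i by blast
    qed
    \<comment> \<open>The ring of the mutated seed in direction \<open>l\<close> lies in D[1/g] as
      soon as the new variable \<open>f / x i\<close> is a unit there and the new quotient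
      \<open>h' / x l\<close> belongs to it.\<close>
    have loc2: "y \<in> loc D g" if g: "g \<in> D" "f / x i \<in> loc D g" "inverse (f / x i) \<in> loc D g"
      "h' / x l \<in> loc D g" for g
    proof -
      have L: "is_subring (loc D g)" by (rule is_subring_loc[OF D g(1)])
      have "R \<subseteq> loc D g" using GD by (auto intro!: loc_base lring_base)
      moreover have "x' k \<in> loc D g" "inverse (x' k) \<in> loc D g" if "k \<in> {1..?N} - {l}" for k
        using g x_in[OF that] GD by (auto simp: x'_def simp del: inverse_divide intro!: loc_base)
      ultimately have "lring R ({1..?N} - {l}) x' \<subseteq> loc D g"
        by (intro lring_least[OF L]) auto
      then have "rgen (lring R ({1..?N} - {l}) x' \<union> {x l, h' / x l}) \<subseteq> loc D g"
        using g(4) xl by (intro rgen_least[OF L]) (auto intro: loc_base)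
      then show ?thesis using y_l by blast
    qed
    have "y \<in> D"
    proof (cases "c = 0")
      case False
      \<comment> \<open>Adjacent directions. All terms of \<open>f\<close> other than
        \<open>M\<close> contain \<open>x l\<close>, so \<open>g\<close> is 1 modulo
        \<open>x l\<close>; this provides a second denominator comaximal to
        \<open>x l\<close>.\<close>
      define g where "g = f / M"
      have g0: "g \<noteq> 0" using f0 M0 by (simp add: g_def)
      have "\<exists>s\<in>D. f = M + x l * s"
      proof -
        have jM: "jM \<in> {0..d i}" by (simp add: jM_def)
        have "\<rho> i jM = 1" using good i by (simp add: jM_def good_seed_def)
        have "\<exists>s\<in>D. \<rho> i j * eterm ?N x d B i j = x l * s" if "j \<in> {0..d i} - {jM}" for j
        proof -
          have "eexp d B i j l > 0"
          proof (cases "c > 0")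
            case True
            then show ?thesis using that c_pos by (auto simp: eexp_def jM_def pos_part_def intro!: mult_pos_neg)
          next
            case False
            then show ?thesis using that c_neg \<open>c \<noteq> 0\<close> by (auto simp: eexp_def jM_def pos_part_def)
          qed
          then obtain s where "s \<in> D" "eterm ?N x d B i j = x l * s"
            unfolding eterm_def using monomial_in_rgen(2)[OF lN D GD xl(1)] by blast
          then show ?thesis using subring_mult[OF D \<rho>D[OF i, of j]] that
            by (intro bexI[of _ "\<rho> i j * s"]) auto
        qed
        then obtain s where s: "\<And>j. j \<in> {0..d i} - {jM} \<Longrightarrow> s j \<in> D"
          "\<And>j. j \<in> {0..d i} - {jM} \<Longrightarrow> \<rho> i j * eterm ?N x d B i j = x l * s j" by metis
        have "f = \<rho> i jM * eterm ?N x d B i jM + (\<Sum>j\<in>{0..d i}-{jM}. \<rho> i j * eterm ?N x d B i j)"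
          unfolding f_def exchange_polynomial_eterm by (rule sum.remove) (use jM in auto)
        also have "\<dots> = M + x l * (\<Sum>j\<in>{0..d i}-{jM}. s j)"
          using s(2) \<open>\<rho> i jM = 1\<close> by (simp add: M_def sum_distrib_left)
        finally show ?thesis using s(1) D by (intro bexI[of _ "\<Sum>j\<in>{0..d i}-{jM}. s j"] subring_sum) auto
      qed
      then obtain s' where s': "s' \<in> D" "f = M + x l * s'" by blast
      define s where "s = inverse M * s'"
      have sD: "s \<in> D" unfolding s_def using M GD s'(1) by (intro subring_mult[OF D]) auto
      have g_eq: "g = 1 + x l * s" using M0 by (simp add: g_def s_def s'(2) field_simps)
      have gD: "g \<in> D" unfolding g_eq by (intro subring_add subring_1 subring_mult D xl sD)
      have L: "is_subring (loc D g)" by (rule is_subring_loc[OF D gD])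
      have ginv: "inverse g \<in> loc D g"
        using loc_divide[OF subring_1[OF D] subring_0[OF D], of g 1] by (simp add: inverse_eq_divide)
      have G_loc: "?G \<subseteq> loc D g" using GD by (auto intro: loc_base)
      have fx: "f / x i \<in> loc D g"
        unfolding divide_inverse using fD xi(2) GD by (auto intro!: loc_base subring_mult[OF D])
      have "inverse (f / x i) = x i * inverse M * inverse g" using M0 f0 by (simp add: g_def field_simps)
      also have "\<dots> \<in> loc D g" using xi M G_loc ginv by (intro subring_mult[OF L]) auto
      finally have fx': "inverse (f / x i) \<in> loc D g" .
      \<comment> \<open>By \<open>yhat_mutate\<close> the sum belonging to \<open>h'\<close> arises
        from that of \<open>h\<close> by multiplying \<open>yhat\<close> with a power of
        \<open>g\<close>, and the sum of \<open>h\<close> is divisible by \<open>x l\<close> in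
        \<open>D\<close>.\<close>
      have "(\<Sum>j=0..d l. \<rho> l j * (yhat ?N x d B l * g powi (- c)) ^ j) / x l \<in> loc D g"
      proof (rule sum_substitute_in_loc[OF D xl0 xl(2,1) sD g_eq g0, where q = "inverse (eterm ?N x d B l 0)"])
        show "(\<Sum>j=0..d l. \<rho> l j * yhat ?N x d B l ^ j) = x l * (h / x l) * inverse (eterm ?N x d B l 0)"
          using m_l0 xl0 by (simp add: h_eq)
        show "yhat ?N x d B l \<in> D" using yhat_in_lring[of d B l] ll GD by blast
      qed (use \<rho>D l m_l GD in auto)
      moreover have "eterm ?N x' d B' l 0 \<in> loc D g"
      proof -
        have "x' k \<in> loc D g" "inverse (x' k) \<in> loc D g" if "k \<in> {1..?N} - {l}" for k
          using fx fx' x_in[OF that] GD by (auto simp: x'_def simp del: inverse_divide intro!: loc_base)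
        then have "lring R ({1..?N} - {l}) x' \<subseteq> loc D g"
          using GD by (intro lring_least[OF L]) (auto intro!: loc_base lring_base)
        moreover have "eterm ?N x' d B' l 0 \<in> lring R ({1..?N} - {l}) x'"
          unfolding eterm_def by (rule monomial_in_lring) (rule e_l')
        ultimately show ?thesis by blast
      qed
      ultimately have "h' / x l \<in> loc D g"
        unfolding h'_eq times_divide_eq_right[symmetric] g_def[symmetric] by (intro subring_mult[OF L])
      then have "y \<in> loc D g" using loc2[OF gD fx fx'] by blast
      moreover have "- s * x l + 1 * g = 1" by (simp add: g_eq)
      ultimately show ?thesis
        using loc_comaximal[OF D xl(1) gD subring_minus[OF D sD] subring_1[OF D]] loc1 by blast
    next
      case True
      have Bil: "B i l = 0" using True beta_0_iff[of d l B i] d[OF l] iN by (simp add: c_def)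
      have li: "beta d B l i = 0" using True c_pos c_neg by linarith
      \<comment> \<open>Non-adjacent directions: mutation at \<open>i\<close> leaves column
        \<open>l\<close> unchanged, and \<open>x i\<close> does not occur in the l-th exchange
        polynomial.\<close>
      have "h' = h"
      proof -
        have b: "beta d B' k l = beta d B k l" if "k \<in> {1..?N}" for k
        proof (cases "k = i")
          case True
          then show ?thesis using beta_mutate_row[of i l d B] il Bil \<open>c = 0\<close> by (simp add: B'_def c_def)
        next
          case False
          then show ?thesis using beta_mutate[of i l k d B] il i l that d iN \<open>c = 0\<close>
            by (simp add: B'_def c_def)
        qed
        have "eterm ?N x' d B' l j = eterm ?N x d B l j" for j
          unfolding eterm_def
        proof (intro prod.cong refl)
          fix k assume k: "k \<in> {1..?N}"
          have e: "eexp d B' l j k = eexp d B l j k" by (simp add: eexp_def b[OF k])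
          show "x' k ^ eexp d B' l j k = x k ^ eexp d B l j k"
          proof (cases "k = i")
            case True
            then show ?thesis unfolding e using \<open>c = 0\<close> by (simp add: eexp_def pos_part_def c_def)
          qed (simp add: e x'_def)
        qed
        then show ?thesis unfolding h'_def h_def exchange_polynomial_eterm using il by (simp add: \<rho>'_def)
      qed
      have fG: "f \<in> ?G"
        unfolding f_def exchange_polynomial_eterm eterm_def
      proof (intro subring_sum subring_mult is_subring_lring monomial_in_lring(1))
        fix j assume "j \<in> {0..d i}"
        then show "\<rho> i j \<in> ?G" using \<rho>_in[OF i] lring_mono[of F "{1..?N} - {l}" R x] F l by fastforce
        show "eexp d B i j l = 0" by (simp add: eexp_def li pos_part_def)
      qed
      have hG: "h \<in> ?G"
        unfolding h_def exchange_polynomial_eterm eterm_def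
      proof (intro subring_sum subring_mult is_subring_lring monomial_in_lring(1))
        fix j assume "j \<in> {0..d l}"
        then show "\<rho> l j \<in> ?G" using \<rho>_in[OF l] lring_mono[of F "{1..?N} - {l}" R x] F l by fastforce
        show "eexp d B l j l = 0" by (simp add: eexp_def ll pos_part_def)
      qed
      \<comment> \<open>Here \<open>f\<close> is the second denominator; it need not be comaximal to
        \<open>x l\<close>, but it forms a regular pair with \<open>h\<close>.\<close>
      have "y \<in> loc D f"
      proof (rule loc2[OF fD])
        show "f / x i \<in> loc D f"
          unfolding divide_inverse using fD xi(2) GD by (auto intro!: loc_base subring_mult[OF D])
        have "x i / f ^ 1 \<in> loc D f" using xi(1) GD by (intro loc_divide subring_0[OF D]) auto
        then show "inverse (f / x i) \<in> loc D f" by simp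
        show "h' / x l \<in> loc D f" using xl(2) \<open>h' = h\<close> by (auto intro: loc_base)
      qed
      moreover have "transc ?G (x l)" using good lN by (auto simp: good_seed_def ind_def)
      moreover have "h \<noteq> 0" unfolding h_def by (rule exchange_nonzero[OF good l])
      moreover have "regular ?G f h"
        using regular_exchange(2)[OF good l i il Bil] f0 unfolding f_def h_def by blast
      ultimately show ?thesis
        using loc_regular[of ?G "x l" h f y] hG fG loc1 unfolding D_def by simp
    qed
    then show ?thesis by (simp add: ub_def D_def h_def)
  qed
qed

section \<open>Mutation of seeds\<close>

text \<open>The same symmetrizer works. Scaling by it turns the negative part of B a i into the
  positive part of B i a (\<open>pos_scale\<close>), so transposition interchanges the two
  correction terms of the mutation rule up to sign.\<close>

lemma skew_symmetrizable_mutate: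
  assumes "skew_symmetrizable n B" "i \<in> {1..n}"
  shows "skew_symmetrizable n (mutate_matrix i B)"
proof -
  obtain \<delta> :: "nat \<Rightarrow> int" where pos: "\<forall>i\<in>{1..n}. \<delta> i > 0"
    and \<delta>: "\<And>k l. k \<in> {1..n} \<Longrightarrow> l \<in> {1..n} \<Longrightarrow> \<delta> k * B k l = - (\<delta> l * B l k)"
    using assms(1) unfolding skew_symmetrizable_def by blast
  have "\<delta> k * mutate_matrix i B k l = - (\<delta> l * mutate_matrix i B l k)"
    if k: "k \<in> {1..n}" and l: "l \<in> {1..n}" for k l
  proof (cases "k = i \<or> l = i")
    case True
    then show ?thesis using \<delta>[OF k l] by (auto simp: mutate_matrix_def)
  next
    case False
    have pos_scale: "\<delta> a * pos_part (- B a i) = \<delta> i * pos_part (B i a)" if "a \<in> {1..n}" for a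
    proof -
      have "\<delta> a * pos_part (- B a i) = pos_part (\<delta> a * (- B a i))"
        by (rule pos_part_mult[symmetric]) (use pos that less_imp_le in blast)
      also have "\<delta> a * (- B a i) = \<delta> i * B i a" using \<delta>[OF that assms(2)] by simp
      also have "pos_part \<dots> = \<delta> i * pos_part (B i a)"
        by (rule pos_part_mult) (use pos assms(2) less_imp_le in blast)
      finally show ?thesis .
    qed
    have "\<delta> k * mutate_matrix i B k l =
      \<delta> k * B k l + pos_part (B i l) * (\<delta> k * B k i) + B i l * (\<delta> k * pos_part (- B k i))"
      using False by (simp add: mutate_matrix_def algebra_simps)
    also have "\<dots> = - (\<delta> l * B l k) - pos_part (B i l) * (\<delta> i * B i k) + B i l * (\<delta> i * pos_part (B i k))"
      unfolding pos_scale[OF k] \<delta>[OF k l] \<delta>[OF k assms(2)] by simp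
    also have "\<dots> = - (\<delta> l * B l k + pos_part (B i k) * (- (\<delta> i * B i l)) + B i k * (\<delta> i * pos_part (B i l)))"
      by (simp add: algebra_simps)
    also have "\<dots> = - (\<delta> l * B l k + pos_part (B i k) * (\<delta> l * B l i) + B i k * (\<delta> l * pos_part (- B l i)))"
      unfolding pos_scale[OF l] \<delta>[OF l assms(2)] ..
    also have "\<dots> = - (\<delta> l * mutate_matrix i B l k)"
      using False by (simp add: mutate_matrix_def algebra_simps)
    finally show ?thesis .
  qed
  then show ?thesis using pos unfolding skew_symmetrizable_def by blast
qed

lemma dvd_mutate_matrix:
  assumes "e dvd B k l" "e dvd B i l" shows "e dvd mutate_matrix i B k l"
proof -
  have "e dvd pos_part (B i l)" using assms(2) by (simp add: pos_part_def max_def)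
  then show ?thesis using assms by (auto simp: mutate_matrix_def)
qed

text \<open>Gradings are transported along the mutation: the new variable receives the degree of the
  term j = 0 of the exchange polynomial divided by \<open>x i\<close>, which is s - w i, and the
  targets \<open>\<tau>\<close> are pulled back to targets \<open>\<sigma>\<close> for the old
  matrix. Only the degree at \<open>i\<close> changes, so degrees on \<open>F\<close> stay
  0.\<close>

lemma full_rank_mutate:
  assumes fr: "full_rank n N F B" and i: "i \<in> {1..n}" "n \<le> N" "i \<notin> F" and ii: "B i i = 0"
  shows "full_rank n N F (mutate_matrix i B)"
proof -
  obtain D where D: "D > 0" "\<And>\<tau>. \<exists>w :: nat \<Rightarrow> int. (\<forall>k\<in>F. w k = 0) \<and>
      (\<forall>l\<in>{1..n}. (\<Sum>k=1..N. w k * B k l) = D * \<tau> l)"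
    using fr unfolding full_rank_def by blast
  have "\<exists>w :: nat \<Rightarrow> int. (\<forall>k\<in>F. w k = 0) \<and>
      (\<forall>l\<in>{1..n}. (\<Sum>k=1..N. w k * mutate_matrix i B k l) = D * \<tau> l)" for \<tau>
  proof -
    define \<sigma> where "\<sigma> l = (if l = i then - \<tau> i else \<tau> l + pos_part (B i l) * \<tau> i)" for l
    obtain w where w: "\<And>k. k \<in> F \<Longrightarrow> w k = 0"
      "\<And>l. l \<in> {1..n} \<Longrightarrow> (\<Sum>k=1..N. w k * B k l) = D * \<sigma> l"
      using D(2)[of \<sigma>] by blast
    let ?A = "{1..N} - {i}"
    have split: "(\<Sum>k=1..N. g k) = g i + (\<Sum>k\<in>?A. g k)" for g :: "nat \<Rightarrow> int"
      by (rule sum.remove) (use i in auto)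
    define s where "s = (\<Sum>k\<in>?A. w k * pos_part (- B k i))"
    define w' where "w' = w(i := s - w i)"
    have w_i: "(\<Sum>k\<in>?A. w k * B k i) = - D * \<tau> i"
      using w(2)[OF i(1)] split[of "\<lambda>k. w k * B k i"] ii by (simp add: \<sigma>_def)
    have w_l: "(\<Sum>k\<in>?A. w k * B k l) = D * \<sigma> l - w i * B i l" if "l \<in> {1..n}" for l
      using w(2)[OF that] split[of "\<lambda>k. w k * B k l"] by simp
    have eq: "(\<Sum>k\<in>?A. w' k * g k) = (\<Sum>k\<in>?A. w k * g k)" for g
      by (intro sum.cong) (auto simp: w'_def)
    have "(\<Sum>k=1..N. w' k * mutate_matrix i B k l) = D * \<tau> l" if l: "l \<in> {1..n}" for l
    proof (cases "l = i")
      case True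
      have "(\<Sum>k\<in>?A. w k * mutate_matrix i B k i) = - (\<Sum>k\<in>?A. w k * B k i)"
        unfolding sum_negf[symmetric] by (intro sum.cong) (auto simp: mutate_matrix_def)
      then show ?thesis unfolding split eq using True w_i ii by (simp add: mutate_matrix_def)
    next
      case False
      have "(\<Sum>k\<in>?A. w k * mutate_matrix i B k l) =
        (\<Sum>k\<in>?A. w k * B k l + pos_part (B i l) * (w k * B k i) + B i l * (w k * pos_part (- B k i)))"
        by (intro sum.cong) (use False in \<open>auto simp: mutate_matrix_def algebra_simps\<close>)
      also have "\<dots> = D * \<sigma> l - w i * B i l - pos_part (B i l) * (D * \<tau> i) + B i l * s"
        unfolding sum.distrib sum_distrib_left[symmetric] w_l[OF l] w_i s_def[symmetric] by simp
      finally have e: "(\<Sum>k\<in>?A. w k * mutate_matrix i B k l) =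
        D * \<sigma> l - w i * B i l - pos_part (B i l) * (D * \<tau> i) + B i l * s" .
      show ?thesis unfolding split eq e using False
        by (simp add: mutate_matrix_def w'_def \<sigma>_def algebra_simps)
    qed
    moreover have "\<forall>k\<in>F. w' k = 0" using w(1) i(3) by (auto simp: w'_def)
    ultimately show ?thesis by blast
  qed
  then show ?thesis using D(1) unfolding full_rank_def by blast
qed

lemma exchange_polynomial_in_lring:
  assumes "is_subring R" "beta d B i i = 0" "\<And>j. j \<le> d i \<Longrightarrow> \<rho> i j \<in> lring R ({1..n+m} - {i}) x"
  shows "exchange_polynomial n m d (x, \<rho>, B) i \<in> lring R ({1..n+m} - {i}) x"
  unfolding exchange_polynomial_eterm eterm_def
  by (intro subring_sum subring_mult is_subring_lring monomial_in_lring(1))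
     (use assms in \<open>auto simp: eexp_def pos_part_def\<close>)

lemma ind_mutate:
  assumes "ind R {1..n+m} x" "i \<in> {1..n}" "f \<in> lring R ({1..n+m} - {i}) x" "f \<noteq> 0"
  shows "ind R {1..n+m} (x(i := f / x i))"
  by (rule ind_update[OF assms(1)])
     (use assms in \<open>auto intro!: transc_divide simp: ind_def\<close>)

text \<open>By \<open>exchange_nonzero\<close> a good seed can be mutated in every direction;
  \<open>F\<close> consists of frozen variables, so the ring containing the coefficients does not
  change.\<close>

lemma good_seed_mutate:
  assumes good: "good_seed R n m F d x \<rho> B" and i: "i \<in> {1..n}"
    and S': "mutate n m d i (x, \<rho>, B) = (x', \<rho>', B')"
  shows "good_seed R n m F d x' \<rho>' B'"
proof -
  define f where "f = exchange_polynomial n m d (x, \<rho>, B) i"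
  have x': "x' = x(i := f / x i)" and \<rho>': "\<rho>' = \<rho>(i := (\<lambda>j. \<rho> i (d i - j)))"
    and B': "B' = mutate_matrix i B"
    using S' by (simp_all add: mutate.simps f_def)
  have R: "is_subring R" and ind: "ind R {1..n+m} x" and F: "F \<subseteq> {n+1..n+m}"
    and skew: "skew_symmetrizable n B" and fr: "full_rank n (n + m) F B"
    and d: "\<And>i k. i \<in> {1..n} \<Longrightarrow> k \<in> {1..n+m} \<Longrightarrow> int (d i) dvd B k i"
      "\<And>i. i \<in> {1..n} \<Longrightarrow> d i > 0"
    and \<rho>: "\<And>i. i \<in> {1..n} \<Longrightarrow> \<rho> i 0 = 1 \<and> \<rho> i (d i) = 1"
      "\<And>i j. i \<in> {1..n} \<Longrightarrow> j \<le> d i \<Longrightarrow> \<rho> i j \<in> lring R F x"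
    using good unfolding good_seed_def by blast+
  have ii: "B i i = 0" using skew_symmetrizable_diag[OF skew i] .
  have iF: "i \<notin> F" using F i by auto
  have "lring R F x \<subseteq> lring R ({1..n+m} - {i}) x" by (rule lring_mono) (use F i in auto)
  then have "f \<in> lring R ({1..n+m} - {i}) x"
    unfolding f_def using \<rho>(2)[OF i] ii
    by (intro exchange_polynomial_in_lring R) (auto simp: beta_def)
  then have "ind R {1..n+m} x'"
    unfolding x' using exchange_nonzero[OF good i] by (intro ind_mutate ind i) (auto simp: f_def)
  moreover have "lring R F x' = lring R F x"
    by (rule lring_cong) (use iF in \<open>auto simp: x'\<close>)
  moreover have "int (d l) dvd B' k l" if "l \<in> {1..n}" "k \<in> {1..n+m}" for k l
    unfolding B' using that i by (intro dvd_mutate_matrix d) auto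
  moreover have "full_rank n (n + m) F B'"
    unfolding B' by (rule full_rank_mutate) (use fr i iF ii in auto)
  moreover have "skew_symmetrizable n B'"
    unfolding B' by (rule skew_symmetrizable_mutate[OF skew i])
  ultimately show ?thesis
    unfolding good_seed_def using R F d(2) \<rho> by (auto simp: \<rho>')
qed

section \<open>Generic frozen variables\<close>

text \<open>Specialization at the point \<open>\<xi>\<close> is a partial map, defined on the local ring of \<open>\<xi>\<close>.\<close>

type_synonym 'a mpoly = "(nat \<Rightarrow>\<^sub>0 nat) \<Rightarrow>\<^sub>0 'a"

definition spec :: "(nat \<Rightarrow> 'a::field) \<Rightarrow> 'a mpoly fract \<Rightarrow> 'a \<Rightarrow> bool" where
  "spec \<xi> y w \<longleftrightarrow> (\<exists>p q. y = Fract p q \<and> poly_eval q \<xi> \<noteq> 0 \<and> w = poly_eval p \<xi> / poly_eval q \<xi>)"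

lemma spec_unique:
  assumes "spec \<xi> y w" "spec \<xi> y w'" shows "w = w'"
proof -
  obtain p q p' q' where
    p: "y = Fract p q" "poly_eval q \<xi> \<noteq> 0" "w = poly_eval p \<xi> / poly_eval q \<xi>" and
    p': "y = Fract p' q'" "poly_eval q' \<xi> \<noteq> 0" "w' = poly_eval p' \<xi> / poly_eval q' \<xi>"
    using assms unfolding spec_def by blast
  have "q \<noteq> 0" "q' \<noteq> 0" using p(2) p'(2) by auto
  then have "p * q' = p' * q" using p(1) p'(1) by (simp add: eq_fract)
  then have "poly_eval p \<xi> * poly_eval q' \<xi> = poly_eval p' \<xi> * poly_eval q \<xi>"
    by (simp flip: poly_eval_mult)
  then show ?thesis unfolding p(3) p'(3) using p(2) p'(2) by (simp add: frac_eq_eq)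
qed

lemma spec_to_fract: "spec \<xi> (to_fract p) (poly_eval p \<xi>)"
  unfolding spec_def to_fract_def by (rule exI[of _ p], rule exI[of _ 1]) simp

lemma spec_1: "spec \<xi> 1 1"
  using spec_to_fract[of \<xi> 1] by simp

lemma spec_0: "spec \<xi> 0 0"
  using spec_to_fract[of \<xi> 0] by simp

lemma spec_add:
  assumes "spec \<xi> y w" "spec \<xi> y' w'" shows "spec \<xi> (y + y') (w + w')"
proof -
  obtain p q p' q' where
    p: "y = Fract p q" "poly_eval q \<xi> \<noteq> 0" "w = poly_eval p \<xi> / poly_eval q \<xi>" and
    p': "y' = Fract p' q'" "poly_eval q' \<xi> \<noteq> 0" "w' = poly_eval p' \<xi> / poly_eval q' \<xi>"
    using assms unfolding spec_def by blast
  have "q \<noteq> 0" "q' \<noteq> 0" using p(2) p'(2) by auto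
  then show ?thesis unfolding spec_def using p p'
    by (intro exI[of _ "p * q' + p' * q"] exI[of _ "q * q'"])
       (simp add: poly_eval_add poly_eval_mult field_simps)
qed

lemma spec_mult:
  assumes "spec \<xi> y w" "spec \<xi> y' w'" shows "spec \<xi> (y * y') (w * w')"
proof -
  obtain p q p' q' where
    p: "y = Fract p q" "poly_eval q \<xi> \<noteq> 0" "w = poly_eval p \<xi> / poly_eval q \<xi>" and
    p': "y' = Fract p' q'" "poly_eval q' \<xi> \<noteq> 0" "w' = poly_eval p' \<xi> / poly_eval q' \<xi>"
    using assms unfolding spec_def by blast
  then show ?thesis unfolding spec_def
    by (intro exI[of _ "p * p'"] exI[of _ "q * q'"]) (simp add: poly_eval_mult)
qed

lemma spec_uminus: "spec \<xi> y w \<Longrightarrow> spec \<xi> (- y) (- w)"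
  using spec_mult[OF spec_to_fract[of \<xi> "- 1"], of y w] by (simp add: poly_eval_uminus)

lemma spec_inverse:
  assumes "spec \<xi> y w" "w \<noteq> 0" shows "spec \<xi> (inverse y) (inverse w)"
proof -
  obtain p q where
    p: "y = Fract p q" "poly_eval q \<xi> \<noteq> 0" "w = poly_eval p \<xi> / poly_eval q \<xi>"
    using assms unfolding spec_def by blast
  then show ?thesis unfolding spec_def using assms(2)
    by (intro exI[of _ q] exI[of _ p]) auto
qed

lemma spec_divide: "spec \<xi> y w \<Longrightarrow> spec \<xi> y' w' \<Longrightarrow> w' \<noteq> 0 \<Longrightarrow> spec \<xi> (y / y') (w / w')"
  unfolding divide_inverse by (intro spec_mult spec_inverse)

lemma spec_sum: "(\<And>i. i \<in> A \<Longrightarrow> spec \<xi> (f i) (g i)) \<Longrightarrow> spec \<xi> (sum f A) (sum g A)"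
  by (induction A rule: infinite_finite_induct) (auto intro: spec_0 spec_add)

lemma spec_prod: "(\<And>i. i \<in> A \<Longrightarrow> spec \<xi> (f i) (g i)) \<Longrightarrow> spec \<xi> (prod f A) (prod g A)"
  by (induction A rule: infinite_finite_induct) (auto intro: spec_1 spec_mult)

lemma spec_power: "spec \<xi> y w \<Longrightarrow> spec \<xi> (y ^ e) (w ^ e)"
  by (induction e) (auto intro: spec_1 spec_mult)

text \<open>Carries membership in a generated ring from the generic seed to the given one: only the
  generators have to be specialized.\<close>

lemma spec_rgen:
  assumes D: "is_subring D" and H: "\<And>h. h \<in> H \<Longrightarrow> \<exists>w\<in>D. spec \<xi> h w" and y: "y \<in> rgen H"
  shows "\<exists>w\<in>D. spec \<xi> y w"
proof -
  have "is_subring {y. \<exists>w\<in>D. spec \<xi> y w}" (is "is_subring ?S")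
    unfolding is_subring_def
  proof (intro conjI ballI)
    show "1 \<in> ?S" using spec_1 subring_1[OF D] by blast
    fix a assume "a \<in> ?S"
    then obtain v where v: "v \<in> D" "spec \<xi> a v" by blast
    show "- a \<in> ?S" using spec_uminus[OF v(2)] subring_minus[OF D v(1)] by blast
    fix b assume "b \<in> ?S"
    then obtain w where w: "w \<in> D" "spec \<xi> b w" by blast
    show "a + b \<in> ?S" using spec_add[OF v(2) w(2)] subring_add[OF D v(1) w(1)] by blast
    show "a * b \<in> ?S" using spec_mult[OF v(2) w(2)] subring_mult[OF D v(1) w(1)] by blast
  qed
  then have "rgen H \<subseteq> ?S" by (rule rgen_least) (use H in blast)
  then show ?thesis using y by blast
qed

section \<open>Formal variables and constants\<close>

abbreviation fvar :: "nat \<Rightarrow> 'a::field mpoly fract" where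
  "fvar k \<equiv> to_fract (Poly_Mapping.single (Poly_Mapping.single k 1) 1)"

abbreviation fcon :: "'a::field \<Rightarrow> 'a mpoly fract" where
  "fcon c \<equiv> to_fract (Poly_Mapping.single 0 c)"

lemma spec_fvar: "spec \<xi> (fvar k) (\<xi> k)"
  using spec_to_fract[of \<xi> "Poly_Mapping.single (Poly_Mapping.single k 1) 1"] by simp

lemma spec_fcon: "spec \<xi> (fcon c) c"
  using spec_to_fract[of \<xi> "Poly_Mapping.single 0 c"] by simp

lemma is_subring_fcon: "is_subring R \<Longrightarrow> is_subring (fcon ` R)"
  unfolding is_subring_def
proof (intro conjI ballI)
  assume R: "1 \<in> R \<and> (\<forall>a\<in>R. - a \<in> R) \<and> (\<forall>a\<in>R. \<forall>b\<in>R. a + b \<in> R \<and> a * b \<in> R)"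
  have "fcon 1 = 1" by simp
  then show "1 \<in> fcon ` R" using R by (metis image_eqI)
  fix a assume "a \<in> fcon ` R"
  then obtain a' where a: "a = fcon a'" "a' \<in> R" by blast
  have "- a = fcon (- a')" by (simp add: a single_uminus)
  then show "- a \<in> fcon ` R" using R a by blast
  fix b assume "b \<in> fcon ` R"
  then obtain b' where b: "b = fcon b'" "b' \<in> R" by blast
  have "a + b = fcon (a' + b')" "a * b = fcon (a' * b')"
    by (simp_all add: a b single_add mult_single flip: to_fract_mult)
  then show "a + b \<in> fcon ` R" "a * b \<in> fcon ` R" using R a b by blast+
qed

lemma single_power:
  "Poly_Mapping.single (Poly_Mapping.single k (1::nat)) (1::'a::field) ^ e =
    Poly_Mapping.single (Poly_Mapping.single (k::nat) e) 1"
  by (induction e) (simp_all add: mult_single flip: single_add)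

lemma prod_single:
  "(\<Prod>i\<in>A. Poly_Mapping.single (\<alpha> i) (1::'a::field)) = Poly_Mapping.single ((\<Sum>i\<in>A. \<alpha> i) :: nat \<Rightarrow>\<^sub>0 nat) 1"
  by (induction A rule: infinite_finite_induct) (simp_all add: mult_single)

lemma to_fract_prod: "to_fract (\<Prod>i\<in>A. f i) = (\<Prod>i\<in>A. to_fract (f i))"
  by (induction A rule: infinite_finite_induct) simp_all

lemma monom_eval_fvar: "monom_eval \<alpha> fvar = to_fract (Poly_Mapping.single \<alpha> (1::'a::field))"
proof -
  have "monom_eval \<alpha> fvar = (\<Prod>k\<in>Poly_Mapping.keys \<alpha>.
      to_fract (Poly_Mapping.single (Poly_Mapping.single k (Poly_Mapping.lookup \<alpha> k)) (1::'a)))"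
    unfolding monom_eval_def
    by (intro prod.cong refl) (simp only: single_power flip: to_fract_power)
  also have "\<dots> = to_fract (Poly_Mapping.single \<alpha> 1)"
    by (simp only: prod_single flip: to_fract_prod poly_mapping_expand)
  finally show ?thesis .
qed

text \<open>Evaluation at the formal variables returns the polynomial itself, once its coefficients
  are read back as elements of the field.\<close>

lemma ind_fvar:
  assumes R: "is_subring R" shows "ind (fcon ` R) {1..N} (fvar :: nat \<Rightarrow> 'a::field mpoly fract)"
proof (rule algebraically_independent_imp_ind[OF is_subring_fcon[OF R]],
    unfold algebraically_independent_iff, intro allI impI)
  fix p :: "(nat \<Rightarrow>\<^sub>0 nat) \<Rightarrow>\<^sub>0 'a mpoly fract"
  assume "poly_over (fcon ` R) {1..N} p" and ev: "poly_eval p fvar = 0"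
  then have "\<forall>\<alpha>. \<exists>c. Poly_Mapping.lookup p \<alpha> = fcon c" by (auto simp: poly_over_def)
  then obtain g where g: "\<And>\<alpha>. Poly_Mapping.lookup p \<alpha> = fcon (g \<alpha>)" by metis
  define q where "q = (\<Sum>\<alpha>\<in>Poly_Mapping.keys p. Poly_Mapping.single \<alpha> (g \<alpha>))"
  have "poly_eval p fvar = (\<Sum>\<alpha>\<in>Poly_Mapping.keys p. to_fract (Poly_Mapping.single 0 (g \<alpha>)) *
      to_fract (Poly_Mapping.single \<alpha> 1))"
    unfolding poly_eval_superset[OF finite_keys order_refl] g monom_eval_fvar ..
  also have "\<dots> = to_fract q" by (simp add: q_def mult_single flip: to_fract_mult)
  finally have "q = 0" using ev by simp
  have "\<alpha> \<notin> Poly_Mapping.keys p" for \<alpha>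
  proof
    assume \<alpha>: "\<alpha> \<in> Poly_Mapping.keys p"
    have "Poly_Mapping.lookup q \<alpha> = (\<Sum>\<beta>\<in>Poly_Mapping.keys p. if \<beta> = \<alpha> then g \<alpha> else 0)"
      unfolding q_def lookup_sum by (intro sum.cong) (auto simp: lookup_single when_def)
    then have "g \<alpha> = 0" using \<alpha> \<open>q = 0\<close> by simp
    then have "Poly_Mapping.lookup p \<alpha> = 0" by (simp add: g)
    then show False using \<alpha> by (simp add: in_keys_iff)
  qed
  then show "p = 0" by (metis equals0I keys_eq_empty)
qed

section \<open>Generalized seeds as specializations of good seeds\<close>

lemma generalized_seedD:
  assumes "generalized_seed R n m d (x, \<rho>, B)" "is_subring R"
  shows "ind R {1..n+m} x" "skew_symmetrizable n B"
    "\<And>i. i \<in> {1..n} \<Longrightarrow> d i > 0" "\<And>i k. i \<in> {1..n} \<Longrightarrow> k \<in> {1..n+m} \<Longrightarrow> int (d i) dvd B k i"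
    "\<And>i. i \<in> {1..n} \<Longrightarrow> \<rho> i 0 = 1" "\<And>i. i \<in> {1..n} \<Longrightarrow> \<rho> i (d i) = 1"
    "\<And>i j. i \<in> {1..n} \<Longrightarrow> j \<in> {1..d i - 1} \<Longrightarrow> frozen_monomial R n m x (\<rho> i j)"
  using assms by (auto simp: algebraically_independent_iff_ind)

lemma frozen_monomial_in_lring:
  assumes "is_subring R" "frozen_monomial R n m x r"
  shows "r \<in> lring R {n+1..n+m} x"
proof -
  obtain c e where c: "c \<in> R" and r: "r = c * (\<Prod>k\<in>{n+1..n+m}. x k ^ e k)"
    using assms(2) by (auto simp: frozen_monomial_def)
  show ?thesis
    unfolding r by (intro subring_mult subring_prod subring_power is_subring_lring lring_var lring_base c)
qed

lemma rho_in_lring: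
  assumes S: "generalized_seed R n m d (x, \<rho>, B)" and R: "is_subring R" and i: "i \<in> {1..n}" "j \<le> d i"
  shows "\<rho> i j \<in> lring R {n+1..n+m} x"
proof (cases "j = 0 \<or> j = d i")
  case True
  then show ?thesis using generalized_seedD(5,6)[OF S R i(1)] by (auto simp: subringD)
next
  case False
  then show ?thesis
    using generalized_seedD(7)[OF S R i(1), of j] i(2) by (intro frozen_monomial_in_lring[OF R]) auto
qed

text \<open>The given seed is the specialization of a seed with formal variables and \<open>n\<close> additional frozen
  variables, whose columns are independent; the additional variables are sent to 1.\<close>

lemma generic_seed_exists:
  fixes x :: "nat \<Rightarrow> 'a::field"
  assumes S: "generalized_seed R n m d (x, \<rho>, B)" and R: "is_subring R"
  defines "\<xi> \<equiv> \<lambda>k. if k \<le> n + m then x k else 1"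
  obtains \<rho>' B' where "good_seed (fcon ` R) n (m + n) {n+1..n+m} d fvar \<rho>' B'"
    "\<And>i j. i \<in> {1..n} \<Longrightarrow> j \<le> d i \<Longrightarrow> spec \<xi> (\<rho>' i j) (\<rho> i j)"
    "\<And>k l. k \<in> {1..n+m} \<Longrightarrow> B' k l = B k l"
proof -
  note SD = generalized_seedD[OF S R]
  \<comment> \<open>The row of the l-th new variable has its only entry in column \<open>l\<close>.
    This entry is d l and not 1, since all entries of the column must be divisible by d l.\<close>
  define B' where "B' k l = (if k \<le> n + m then B k l else if k = n + m + l then int (d l) else 0)" for k l
  define P where "P i j r \<longleftrightarrow> r \<in> lring (fcon ` R) {n+1..n+m} fvar \<and> spec \<xi> r (\<rho> i j) \<and>
    (j = 0 \<or> j = d i \<longrightarrow> r = 1)" for i j r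
  have ex: "\<exists>r. i \<in> {1..n} \<longrightarrow> j \<le> d i \<longrightarrow> P i j r" for i j
  proof (cases "i \<in> {1..n} \<and> j \<le> d i")
    case True
    show ?thesis
    proof (cases "j = 0 \<or> j = d i")
      case True
      then have "i \<in> {1..n} \<Longrightarrow> \<rho> i j = 1" using SD(5,6) by auto
      then show ?thesis by (intro exI[of _ 1]) (auto simp: subringD spec_1 P_def)
    next
      case False
      with True have "j \<in> {1..d i - 1}" by auto
      then obtain c e where ce: "c \<in> R" "\<rho> i j = c * (\<Prod>k\<in>{n+1..n+m}. x k ^ e k)"
        using SD(7)[of i j] True by (auto simp: frozen_monomial_def)
      define r where "r = fcon c * (\<Prod>k\<in>{n+1..n+m}. fvar k ^ e k)"
      have "r \<in> lring (fcon ` R) {n+1..n+m} fvar"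
        unfolding r_def using ce(1)
        by (intro subring_mult subring_prod subring_power is_subring_lring lring_var) (auto intro: lring_base)
      moreover have "spec \<xi> r (c * (\<Prod>k\<in>{n+1..n+m}. \<xi> k ^ e k))"
        unfolding r_def by (intro spec_mult spec_prod spec_power spec_fcon spec_fvar)
      moreover have "c * (\<Prod>k\<in>{n+1..n+m}. \<xi> k ^ e k) = \<rho> i j"
        unfolding ce(2) by (intro arg_cong2[where f = "(*)"] prod.cong) (auto simp: \<xi>_def)
      ultimately show ?thesis using False by (auto simp: P_def)
    qed
  qed auto
  define \<rho>' where "\<rho>' i j = (SOME r. i \<in> {1..n} \<longrightarrow> j \<le> d i \<longrightarrow> P i j r)" for i j
  have P: "P i j (\<rho>' i j)" if "i \<in> {1..n}" "j \<le> d i" for i j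
    using someI_ex[OF ex[of i j]] that unfolding \<rho>'_def by blast
  have \<rho>': "\<And>i j. i \<in> {1..n} \<Longrightarrow> j \<le> d i \<Longrightarrow> \<rho>' i j \<in> lring (fcon ` R) {n+1..n+m} fvar"
    "\<And>i j. i \<in> {1..n} \<Longrightarrow> j \<le> d i \<Longrightarrow> spec \<xi> (\<rho>' i j) (\<rho> i j)"
    "\<And>i. i \<in> {1..n} \<Longrightarrow> \<rho>' i 0 = 1" "\<And>i. i \<in> {1..n} \<Longrightarrow> \<rho>' i (d i) = 1"
    using P unfolding P_def by blast+
  have "full_rank n (n + (m + n)) {n+1..n+m} B'"
    unfolding full_rank_def
  proof (intro exI conjI allI)
    \<comment> \<open>With the new variables alone, the degrees attainable in column
      \<open>l\<close> are the multiples of d l; the product of all d i is a common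
      multiple.\<close>
    define D where "D = (\<Prod>i=1..n. int (d i))"
    show "(0::int) < (\<Prod>i=1..n. int (d i))" by (rule prod_pos) (use SD(3) in auto)
    fix \<tau> :: "nat \<Rightarrow> int"
    define w where "w k = (if k \<le> n + m then 0 else \<tau> (k - (n + m)) * (D div int (d (k - (n + m)))))" for k
    show "\<forall>k\<in>{n+1..n+m}. w k = 0" by (simp add: w_def)
    show "\<forall>l\<in>{1..n}. (\<Sum>k=1..n+(m+n). w k * B' k l) = (\<Prod>i=1..n. int (d i)) * \<tau> l"
    proof
      fix l assume l: "l \<in> {1..n}"
      have "(\<Sum>k=1..n+(m+n). w k * B' k l) =
        (\<Sum>k=1..n+(m+n). if k = n + m + l then \<tau> l * (D div int (d l)) * int (d l) else 0)"
        by (intro sum.cong) (use l in \<open>auto simp: w_def B'_def\<close>)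
      also have "\<dots> = \<tau> l * ((D div int (d l)) * int (d l))" using l by (simp add: mult.assoc)
      also have "(D div int (d l)) * int (d l) = D"
        unfolding D_def by (rule dvd_div_mult_self) (use l in \<open>auto intro!: dvd_prodI\<close>)
      finally show "(\<Sum>k=1..n+(m+n). w k * B' k l) = (\<Prod>i=1..n. int (d i)) * \<tau> l"
        by (simp add: D_def mult_ac)
    qed
  qed
  moreover have "skew_symmetrizable n B'"
    using SD(2) unfolding skew_symmetrizable_def B'_def by auto
  moreover have "int (d i) dvd B' k i" if "i \<in> {1..n}" "k \<in> {1..n+(m+n)}" for i k
    using SD(4)[OF that(1), of k] that(2) by (auto simp: B'_def)
  ultimately have "good_seed (fcon ` R) n (m + n) {n+1..n+m} d fvar \<rho>' B'"
    unfolding good_seed_def using is_subring_fcon[OF R] ind_fvar[OF R] SD(3) \<rho>' by auto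
  then show ?thesis using \<rho>'(2) by (rule that) (auto simp: B'_def)
qed

text \<open>The rows of the added variables are not compared: these variables take the value 1 and
  leave no trace in the exchange polynomials.\<close>

definition specializes :: "nat \<Rightarrow> nat \<Rightarrow> (nat \<Rightarrow> nat) \<Rightarrow> (nat \<Rightarrow> 'a::field) \<Rightarrow> 'a mpoly fract seed \<Rightarrow> 'a seed \<Rightarrow> bool" where
  "specializes n m d \<xi> S' S \<longleftrightarrow> (case (S', S) of ((x', \<rho>', B'), (x, \<rho>, B)) \<Rightarrow>
    (\<forall>k\<in>{1..n+(m+n)}. spec \<xi> (x' k) (if k \<le> n + m then x k else 1)) \<and>
    (\<forall>i\<in>{1..n}. \<forall>j\<le>d i. spec \<xi> (\<rho>' i j) (\<rho> i j)) \<and>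
    (\<forall>k\<in>{1..n+m}. \<forall>l\<in>{1..n}. B' k l = B k l))"

lemma specializes_exchange:
  assumes "specializes n m d \<xi> (x', \<rho>', B') (x, \<rho>, B)" and i: "i \<in> {1..n}"
  shows "spec \<xi> (exchange_polynomial n (m + n) d (x', \<rho>', B') i) (exchange_polynomial n m d (x, \<rho>, B) i)"
proof -
  let ?z = "\<lambda>k. if k \<le> n + m then x k else 1"
  have x: "spec \<xi> (x' k) (?z k)" if "k \<in> {1..n+(m+n)}" for k
    using assms(1) that unfolding specializes_def by blast
  have \<rho>: "spec \<xi> (\<rho>' i j) (\<rho> i j)" if "j \<le> d i" for j
    using assms(1) i that unfolding specializes_def by blast
  have B: "B' k i = B k i" if "k \<in> {1..n+m}" for k
    using assms(1) i that unfolding specializes_def by blast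
  have "eterm (n + m) x d B i j = (\<Prod>k=1..n+(m+n). ?z k ^ eexp d B' i j k)" for j
  proof -
    have "eterm (n + m) x d B i j = (\<Prod>k=1..n+m. ?z k ^ eexp d B' i j k)"
      unfolding eterm_def by (intro prod.cong) (simp_all add: eexp_def beta_def B)
    also have "\<dots> = (\<Prod>k=1..n+(m+n). ?z k ^ eexp d B' i j k)"
      by (rule prod.mono_neutral_left) auto
    finally show ?thesis .
  qed
  then show ?thesis
    unfolding exchange_polynomial_eterm
    by (auto simp: eterm_def[of "n + (m + n)"] intro!: spec_sum spec_mult spec_prod spec_power \<rho> x)
qed

text \<open>The only new denominator is \<open>x' i\<close>, which specializes to
  \<open>x i\<close>; as this is not 0, the mutated variable stays in the local ring of
  \<open>\<xi>\<close>.\<close>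

lemma specializes_mutate:
  assumes "specializes n m d \<xi> (x', \<rho>', B') (x, \<rho>, B)" and i: "i \<in> {1..n}" and "x i \<noteq> 0"
  shows "specializes n m d \<xi> (mutate n (m + n) d i (x', \<rho>', B')) (mutate n m d i (x, \<rho>, B))"
proof -
  have x: "spec \<xi> (x' k) (if k \<le> n + m then x k else 1)" if "k \<in> {1..n+(m+n)}" for k
    using assms(1) that unfolding specializes_def by blast
  have \<rho>: "spec \<xi> (\<rho>' a j) (\<rho> a j)" if "a \<in> {1..n}" "j \<le> d a" for a j
    using assms(1) that unfolding specializes_def by blast
  have B: "B' k l = B k l" if "k \<in> {1..n+m}" "l \<in> {1..n}" for k l
    using assms(1) that unfolding specializes_def by blast
  have "spec \<xi> (x' i) (x i)" using x[of i] i by simp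
  then have f: "spec \<xi> (exchange_polynomial n (m + n) d (x', \<rho>', B') i / x' i)
      (exchange_polynomial n m d (x, \<rho>, B) i / x i)"
    by (intro spec_divide specializes_exchange[OF assms(1) i] assms(3))
  have "mutate_matrix i B' k l = mutate_matrix i B k l" if "k \<in> {1..n+m}" "l \<in> {1..n}" for k l
    using i that by (simp add: mutate_matrix_def B)
  moreover have "spec \<xi> ((x'(i := exchange_polynomial n (m + n) d (x', \<rho>', B') i / x' i)) k)
      (if k \<le> n + m then (x(i := exchange_polynomial n m d (x, \<rho>, B) i / x i)) k else 1)"
    if "k \<in> {1..n+(m+n)}" for k
    using x[OF that] f i by (cases "k = i") auto
  moreover have "spec \<xi> ((\<rho>'(i := \<lambda>j. \<rho>' i (d i - j))) a j) ((\<rho>(i := \<lambda>j. \<rho> i (d i - j))) a j)"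
    if "a \<in> {1..n}" "j \<le> d a" for a j
    using that \<rho> i by (cases "a = i") auto
  ultimately show ?thesis
    unfolding specializes_def mutate.simps by (auto simp del: fun_upd_apply)
qed

text \<open>The Laurent phenomenon, in the stronger form of membership in the upper bounds. No step of
  \<^const>\<open>mutation_equivalent\<close> need exist in the direction \<open>l\<close>: the exchange polynomial may vanish.\<close>

theorem cluster_variable_in_ub:
  fixes S :: "'a::field seed"
  assumes seed: "generalized_seed R n m d S" and R: "is_subring R"
    and equiv: "mutation_equivalent R n m d S S'" and i: "i \<in> {1..n}" and l: "l \<in> {1..n}"
  shows "fst S' i \<in> ub R n m d S l"
proof -
  obtain x \<rho> B where S: "S = (x, \<rho>, B)" by (cases S)
  define \<xi> where "\<xi> = (\<lambda>k. if k \<le> n + m then x k else 1)"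
  obtain \<rho>g Bg where good: "good_seed (fcon ` R) n (m + n) {n+1..n+m} d fvar \<rho>g Bg"
    and \<rho>g: "\<And>i j. i \<in> {1..n} \<Longrightarrow> j \<le> d i \<Longrightarrow> spec \<xi> (\<rho>g i j) (\<rho> i j)"
    and Bg: "\<And>k l. k \<in> {1..n+m} \<Longrightarrow> Bg k l = B k l"
    using generic_seed_exists[OF seed[unfolded S] R] unfolding \<xi>_def by blast
  have init: "specializes n m d \<xi> (fvar, \<rho>g, Bg) S"
    unfolding specializes_def S using \<rho>g Bg spec_fvar[of \<xi>] by (auto simp: \<xi>_def split: if_splits)
  have nz: "x k \<noteq> 0" if "k \<in> {1..n+m}" for k
    using generalized_seedD(1)[OF seed[unfolded S] R] ind_nonzero that by blast
  let ?ub = "ub (fcon ` R) n (m + n) d"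
  have "(mutation_step R n m d)\<^sup>*\<^sup>* S S'" using equiv by (simp add: mutation_equivalent_def)
  \<comment> \<open>The generic seed follows the same path. Each step passes membership in all upper
    bounds back towards the initial seed; this happens before specialization because the comparison
    of upper bounds requires a good seed.\<close>
  then have "\<exists>x' \<rho>' B'. good_seed (fcon ` R) n (m + n) {n+1..n+m} d x' \<rho>' B' \<and>
      specializes n m d \<xi> (x', \<rho>', B') S' \<and>
      (\<forall>y. (\<forall>l\<in>{1..n}. y \<in> ?ub (x', \<rho>', B') l) \<longrightarrow> (\<forall>l\<in>{1..n}. y \<in> ?ub (fvar, \<rho>g, Bg) l))"
  proof induction
    case base
    show ?case using good init by blast
  next
    case (step S1 S2)
    then obtain x' \<rho>' B' where good': "good_seed (fcon ` R) n (m + n) {n+1..n+m} d x' \<rho>' B'"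
      and sp: "specializes n m d \<xi> (x', \<rho>', B') S1"
      and ub: "\<And>y. \<forall>l\<in>{1..n}. y \<in> ?ub (x', \<rho>', B') l \<Longrightarrow> \<forall>l\<in>{1..n}. y \<in> ?ub (fvar, \<rho>g, Bg) l"
      by blast
    obtain j where S1: "generalized_seed R n m d S1" and j: "j \<in> {1..n}" and S2: "S2 = mutate n m d j S1"
      using step.hyps(2) by (auto simp: mutation_step_def)
    obtain x1 \<rho>1 B1 where S1_eq: "S1 = (x1, \<rho>1, B1)" by (cases S1)
    \<comment> \<open>Steps lead only between generalized seeds, so no cluster variable on the path
      specializes to 0.\<close>
    have "x1 j \<noteq> 0"
      using generalized_seedD(1)[OF S1[unfolded S1_eq] R] j by (intro ind_nonzero) auto
    then have "specializes n m d \<xi> (mutate n (m + n) d j (x', \<rho>', B')) S2"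
      using specializes_mutate[OF sp[unfolded S1_eq] j] by (simp add: S2 S1_eq)
    moreover obtain x2 \<rho>2 B2 where mut: "mutate n (m + n) d j (x', \<rho>', B') = (x2, \<rho>2, B2)"
      by (cases "mutate n (m + n) d j (x', \<rho>', B')")
    ultimately show ?case
      using good_seed_mutate[OF good' j mut] ub_mutate[OF good' j] ub by (metis mut)
  qed
  then obtain x' \<rho>' B' where good': "good_seed (fcon ` R) n (m + n) {n+1..n+m} d x' \<rho>' B'"
    and sp: "specializes n m d \<xi> (x', \<rho>', B') S'"
    and ub: "\<And>y. \<forall>l\<in>{1..n}. y \<in> ?ub (x', \<rho>', B') l \<Longrightarrow> \<forall>l\<in>{1..n}. y \<in> ?ub (fvar, \<rho>g, Bg) l"
    by blast
  \<comment> \<open>A cluster variable lies in all upper bounds of its own seed.\<close>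
  have "x' i \<in> ?ub (x', \<rho>', B') l" if "l \<in> {1..n}" for l
    unfolding ub_def
    by (cases "i = l") (use i in \<open>auto intro!: rgen_incl lring_var\<close>)
  then have mem: "x' i \<in> ?ub (fvar, \<rho>g, Bg) l" using ub l by blast
  \<comment> \<open>The generators of the generic upper bound specialize to elements of the given
    one; the values of all variables other than the l-th are invertible there.\<close>
  have "\<exists>w\<in>ub R n m d S l. spec \<xi> (x' i) w"
  proof (rule spec_rgen[OF _ _ mem[unfolded ub_def]])
    let ?D = "ub R n m d S l"
    show D: "is_subring ?D" by (simp add: ub_def)
    have R_D: "lring R ({1..n+m} - {l}) x \<subseteq> ?D" unfolding ub_def S by (auto intro: rgen_incl)
    have x_D: "x l \<in> ?D" "exchange_polynomial n m d S l / x l \<in> ?D"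
      unfolding ub_def S by (auto intro: rgen_incl)
    have \<xi>_D: "\<xi> k \<in> ?D \<and> inverse (\<xi> k) \<in> ?D" if "k \<in> {1..n+(m+n)} - {l}" for k
      using that R_D subring_1[OF D] by (auto simp: \<xi>_def intro!: subsetD[OF R_D] lring_var lring_inv)
    have \<xi>0: "\<xi> k \<noteq> 0" if "k \<in> {1..n+(m+n)}" for k using nz that by (auto simp: \<xi>_def)
    have main: "\<exists>w\<in>?D. spec \<xi> y w" if "y \<in> lring (fcon ` R) ({1..n+(m+n)} - {l}) fvar" for y
    proof (rule spec_rgen[OF D _ that[unfolded lring_def]])
      fix h assume "h \<in> fcon ` R \<union> fvar ` ({1..n+(m+n)} - {l}) \<union> (\<lambda>k. inverse (fvar k)) ` ({1..n+(m+n)} - {l})"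
      then consider r where "r \<in> R" "h = fcon r" | k where "k \<in> {1..n+(m+n)} - {l}" "h = fvar k"
        | k where "k \<in> {1..n+(m+n)} - {l}" "h = inverse (fvar k)" by blast
      then show "\<exists>w\<in>?D. spec \<xi> h w"
      proof cases
        case 1
        then show ?thesis using R_D spec_fcon by (blast intro: lring_base)
      next
        case 2
        then show ?thesis using \<xi>_D spec_fvar by blast
      next
        case (3 k)
        then have "spec \<xi> h (inverse (\<xi> k))" using spec_inverse[OF spec_fvar[of \<xi> k] \<xi>0] by blast
        then show ?thesis using \<xi>_D 3 by blast
      qed
    qed
    have "spec \<xi> (fvar l) (x l)" using spec_fvar[of \<xi> l] l by (simp add: \<xi>_def)
    moreover have "spec \<xi> (exchange_polynomial n (m + n) d (fvar, \<rho>g, Bg) l / fvar l)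
        (exchange_polynomial n m d S l / x l)"
      using specializes_exchange[OF init[unfolded S] l] calculation nz l
      by (auto simp: S intro!: spec_divide)
    ultimately show "\<exists>w\<in>?D. spec \<xi> h w" if "h \<in> lring (fcon ` R) ({1..n+(m+n)} - {l}) (fst (fvar, \<rho>g, Bg)) \<union>
      {fst (fvar, \<rho>g, Bg) l, exchange_polynomial n (m + n) d (fvar, \<rho>g, Bg) l / fst (fvar, \<rho>g, Bg) l}" for h
      using that main x_D by auto
  qed
  moreover have "spec \<xi> (x' i) (fst S' i)"
  proof -
    have "i \<in> {1..n+(m+n)}" "i \<le> n + m" using i by auto
    then show ?thesis using sp by (cases S') (force simp: specializes_def)
  qed
  ultimately show ?thesis using spec_unique by metis
qed

section \<open>Finiteness of the sets of divisors\<close>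

definition units_of_subring :: "'a::field set \<Rightarrow> 'a set" where
  "units_of_subring A = {u \<in> A. u \<noteq> 0 \<and> inverse u \<in> A}"

lemma units_of_subringD:
  assumes "u \<in> units_of_subring A" shows "u \<in> A" "u \<noteq> 0" "inverse u \<in> A"
  using assms by (auto simp: units_of_subring_def)

lemma units_of_subring_1: "is_subring A \<Longrightarrow> 1 \<in> units_of_subring A"
  by (simp add: units_of_subring_def subringD)

lemma units_of_subring_mult:
  "is_subring A \<Longrightarrow> u \<in> units_of_subring A \<Longrightarrow> v \<in> units_of_subring A \<Longrightarrow> u * v \<in> units_of_subring A"
  by (auto simp: units_of_subring_def subringD)

lemma units_of_subring_inverse: "u \<in> units_of_subring A \<Longrightarrow> inverse u \<in> units_of_subring A"
  by (auto simp: units_of_subring_def)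

lemma units_of_subring_powi:
  assumes "is_subring A" "u \<in> units_of_subring A" shows "u powi e \<in> units_of_subring A"
proof -
  have "u powi e \<in> A" "inverse u powi e \<in> A"
    using assms by (auto intro!: subring_powi simp: units_of_subring_def)
  then show ?thesis using assms(2) by (simp add: units_of_subring_def power_int_inverse)
qed

lemma units_of_subring_prod:
  "is_subring A \<Longrightarrow> (\<And>i. i \<in> I \<Longrightarrow> f i \<in> units_of_subring A) \<Longrightarrow> prod f I \<in> units_of_subring A"
  by (induction I rule: infinite_finite_induct)
     (auto intro: units_of_subring_1 units_of_subring_mult)

lemma units_of_subring_var:
  "x k \<noteq> 0 \<Longrightarrow> k \<in> I \<Longrightarrow> x k \<in> units_of_subring (lring R I x)"
  by (simp add: units_of_subring_def lring_var lring_inv)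

text \<open>For \<open>E\<close> the units of \<open>A\<close>, every non-zero element has only
  finitely many divisors up to units. \<open>E\<close> is a parameter because for Laurent rings an
  explicit set of units with visible exponents is used. The representatives \<open>Q\<close> may lie
  outside \<open>A\<close>.\<close>

definition fin_div :: "'a::field set \<Rightarrow> 'a set \<Rightarrow> bool" where
  "fin_div A E \<longleftrightarrow> (\<forall>a\<in>A. a \<noteq> 0 \<longrightarrow>
    (\<exists>Q. finite Q \<and> (\<forall>b\<in>A. \<forall>c\<in>A. b * c = a \<longrightarrow> (\<exists>e\<in>E. \<exists>q\<in>Q. b = e * q))))"

lemma fin_divD:
  assumes "fin_div A E" "a \<in> A" "a \<noteq> 0"
  obtains Q where "finite Q" "\<And>b c. b \<in> A \<Longrightarrow> c \<in> A \<Longrightarrow> b * c = a \<Longrightarrow> \<exists>e\<in>E. \<exists>q\<in>Q. b = e * q"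
  using assms unfolding fin_div_def by metis

lemma fin_div_mono: "E \<subseteq> E' \<Longrightarrow> fin_div A E \<Longrightarrow> fin_div A E'"
  unfolding fin_div_def by (meson subsetD)

section \<open>Divisors in the ground ring, in polynomial rings and in Laurent rings\<close>

lemma is_subring_subfield:
  assumes "subfield R (ambient :: 'a::field ring)"
  shows "is_subring R" "r \<in> R \<Longrightarrow> inverse r \<in> R"
proof -
  interpret field "ambient :: 'a ring" by (rule field_from_type_algebra)
  have R: "subring R (ambient :: 'a ring)" using assms by (rule subfieldE(1))
  show "is_subring R"
    unfolding is_subring_def using subringE(3,5-7)[OF R] by simp
  show "inverse r \<in> R" if r: "r \<in> R"
  proof (cases "r = 0")
    case False
    have "inv\<^bsub>ambient\<^esub> r \<in> R" "r \<otimes>\<^bsub>ambient\<^esub> inv\<^bsub>ambient\<^esub> r = \<one>\<^bsub>ambient\<^esub>"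
      using subfield_m_inv(1,2)[OF assms] r False by auto
    then show ?thesis by (metis ambient_simps(2,4) inverse_unique)
  qed (use r in simp)
qed

lemma is_subring_Ints: "is_subring \<int>"
  by (simp add: is_subring_def)

lemma fin_div_subfield:
  assumes "subfield R (ambient :: 'a::field ring)" shows "fin_div R (units_of_subring R)"
  unfolding fin_div_def
proof (intro ballI impI exI conjI)
  fix a b c assume "b \<in> R" "b * c = a" "a \<noteq> 0"
  then show "\<exists>e\<in>units_of_subring R. \<exists>q\<in>{1}. b = e * q"
    using is_subring_subfield(2)[OF assms] by (auto simp: units_of_subring_def)
qed simp

lemma fin_div_Ints: "fin_div (\<int> :: 'a::field_char_0 set) (units_of_subring \<int>)"
  unfolding fin_div_def
proof (intro ballI impI)
  fix a :: 'a assume "a \<in> \<int>" "a \<noteq> 0"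
  then obtain k where k: "a = of_int k" "k \<noteq> 0" by (auto elim: Ints_cases)
  show "\<exists>Q. finite Q \<and> (\<forall>b\<in>\<int>. \<forall>c\<in>\<int>. b * c = a \<longrightarrow> (\<exists>e\<in>units_of_subring \<int>. \<exists>q\<in>Q. b = e * q))"
  proof (intro exI conjI ballI impI)
    show "finite ((of_int :: int \<Rightarrow> 'a) ` {d. d dvd k})" using k(2) by (intro finite_imageI finite_divisors_int)
    fix b c :: 'a assume "b \<in> \<int>" "c \<in> \<int>" "b * c = a"
    then obtain i j where ij: "b = of_int i" "c = of_int j" "of_int (i * j) = (of_int k :: 'a)"
      by (auto elim!: Ints_cases simp: k(1))
    then have "i dvd k" by (metis dvd_triv_left of_int_eq_iff)
    then show "\<exists>e\<in>units_of_subring \<int>. \<exists>q\<in>of_int ` {d. d dvd k}. b = e * q"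
      using ij(1) units_of_subring_1[OF is_subring_Ints] by (intro bexI[of _ 1] bexI[of _ b]) auto
  qed
qed

text \<open>Over the algebraic closure a monic divisor is a product of at most degree P factors X -
  z with z a root of \<open>P\<close>; these products are finite in number. The embedding into
  polynomials over the closure is injective.\<close>

lemma finite_monic_divisors:
  fixes P :: "'a::field poly" assumes "P \<noteq> 0"
  shows "finite {m. lead_coeff m = 1 \<and> m dvd P}"
proof -
  let ?h = "map_poly (to_ac :: 'a \<Rightarrow> _)"
  have hmult: "?h (p * q) = ?h p * ?h q" for p q
    by (intro poly_eqI) (simp add: coeff_map_poly coeff_mult to_ac_sum)
  have h0: "?h p = 0 \<longleftrightarrow> p = 0" for p
    by (auto simp: poly_eq_iff coeff_map_poly)
  have inj: "inj ?h" by (auto simp: inj_on_def poly_eq_iff coeff_map_poly)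
  define Z where "Z = {x. poly (?h P) x = 0}"
  have "finite Z" unfolding Z_def using assms h0 by (intro poly_roots_finite) auto
  define L where "L = {xs. set xs \<subseteq> Z \<and> length xs \<le> degree P}"
  have "finite L" unfolding L_def using \<open>finite Z\<close> by (rule finite_lists_length_le)
  have "?h ` {m. lead_coeff m = 1 \<and> m dvd P} \<subseteq> (\<lambda>xs. \<Prod>x\<in>#mset xs. [:- x, 1:]) ` L"
  proof (rule image_subsetI, clarify)
    fix m assume m: "lead_coeff m = 1" "m dvd P"
    have m0: "m \<noteq> 0" using m(1) by auto
    obtain A where A: "size A = degree (?h m)" "?h m = smult (lead_coeff (?h m)) (\<Prod>x\<in>#A. [:- x, 1:])"
      using alg_closed_imp_factorization[of "?h m"] m0 h0 by blast
    have deg: "degree (?h m) = degree m" by (rule degree_map_poly) simp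
    then have "lead_coeff (?h m) = 1" by (simp add: coeff_map_poly m(1))
    then have hm: "?h m = (\<Prod>x\<in>#A. [:- x, 1:])" using A(2) by simp
    obtain xs where xs: "mset xs = A" by (metis ex_mset)
    have "x \<in> Z" if "x \<in># A" for x
    proof -
      have "[:- x, 1:] dvd ?h m" unfolding hm using that by (metis dvd_prod_mset image_eqI set_image_mset)
      moreover have "?h m dvd ?h P" using m(2) by (auto simp: hmult elim!: dvdE)
      ultimately have "[:- x, 1:] dvd ?h P" by (rule dvd_trans)
      then show ?thesis by (simp add: Z_def poly_eq_0_iff_dvd)
    qed
    moreover have "size A \<le> degree P" unfolding A(1) deg using m(2) assms by (rule dvd_imp_degree_le)
    ultimately have "xs \<in> L" using xs by (auto simp: L_def)
    then show "?h m \<in> (\<lambda>xs. \<Prod>x\<in>#mset xs. [:- x, 1:]) ` L" using hm xs by blast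
  qed
  then have "finite (?h ` {m. lead_coeff m = 1 \<and> m dvd P})"
    using \<open>finite L\<close> by (meson finite_imageI finite_subset)
  then show ?thesis using inj by (meson finite_imageD inj_on_subset subset_UNIV)
qed

text \<open>A divisor is determined by its leading coefficient and its monic multiple over the
  field. The members of \<open>Q\<close> combine such data and need not have coefficients in
  \<open>C\<close>.\<close>

lemma fin_div_poly:
  assumes C: "is_subring C" and fd: "fin_div C E" and P: "P \<noteq> 0" "coeffs_in C P"
  obtains Q where "finite Q"
    "\<And>p q. coeffs_in C p \<Longrightarrow> coeffs_in C q \<Longrightarrow> p * q = P \<Longrightarrow> \<exists>e\<in>E. \<exists>r\<in>Q. p = smult e r"
proof -
  have "lead_coeff P \<in> C" using P(2) by (simp add: coeffs_in_def)
  then obtain Q where Q: "finite Q"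
    "\<And>b c. b \<in> C \<Longrightarrow> c \<in> C \<Longrightarrow> b * c = lead_coeff P \<Longrightarrow> \<exists>e\<in>E. \<exists>q\<in>Q. b = e * q"
    using fin_divD[OF fd, of "lead_coeff P"] P(1) by auto
  let ?M = "{m. lead_coeff m = 1 \<and> m dvd P}"
  show ?thesis
  proof (rule that)
    show "finite ((\<lambda>(q, m). smult q m) ` (Q \<times> ?M))"
      using Q(1) finite_monic_divisors[OF P(1)] by blast
    fix p q assume pq: "coeffs_in C p" "coeffs_in C q" "p * q = P"
    then have "lead_coeff p * lead_coeff q = lead_coeff P" by (simp add: lead_coeff_mult flip: pq(3))
    then obtain e r where er: "e \<in> E" "r \<in> Q" "lead_coeff p = e * r"
      using Q(2) pq(1,2) unfolding coeffs_in_def by blast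
    have p0: "p \<noteq> 0" using pq(3) P(1) by auto
    define m where "m = smult (inverse (lead_coeff p)) p"
    have "lead_coeff m = 1" using p0 by (simp add: m_def)
    moreover have "m dvd P" using p0 pq(3) by (auto simp: m_def smult_dvd_iff)
    ultimately have "smult r m \<in> (\<lambda>(q, m). smult q m) ` (Q \<times> ?M)" using er(2) by force
    moreover have "e * (r * inverse (lead_coeff p)) = 1"
      using p0 er(3) by (metis leading_coeff_0_iff mult.assoc right_inverse)
    then have "p = smult e (smult r m)" by (simp add: m_def)
    ultimately show "\<exists>e\<in>E. \<exists>r\<in>(\<lambda>(q, m). smult q m) ` (Q \<times> ?M). p = smult e r" using er(1) by blast
  qed
qed

lemma poly_strip:
  fixes p :: "'a::field poly" assumes "p \<noteq> 0"
  obtains i p' where "p = monom 1 i * p'" "coeff p' 0 \<noteq> 0" "\<And>C. coeffs_in C p \<Longrightarrow> is_subring C \<Longrightarrow> coeffs_in C p'"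
proof -
  define i where "i = (LEAST i. coeff p i \<noteq> 0)"
  have ex: "\<exists>i. coeff p i \<noteq> 0" using assms by (metis leading_coeff_0_iff)
  have i: "coeff p i \<noteq> 0" unfolding i_def by (rule LeastI_ex[OF ex])
  have less: "coeff p j = 0" if "j < i" for j using that not_less_Least unfolding i_def by blast
  define p' where "p' = poly_shift i p"
  have c: "coeff p' j = coeff p (i + j)" for j by (simp add: p'_def coeff_poly_shift add.commute)
  have "p = monom 1 i * p'"
    by (intro poly_eqI) (auto simp: coeff_monom_mult c less)
  moreover have "coeff p' 0 \<noteq> 0" using i c[of 0] by simp
  moreover have "coeffs_in C p'" if "coeffs_in C p" for C using that by (simp add: c coeffs_in_def)
  ultimately show ?thesis using that by blast
qed

lemma monom_mult_unique:
  fixes u v :: "'a::field poly"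
  assumes "monom 1 a * u = monom 1 b * v" "coeff u 0 \<noteq> 0" "coeff v 0 \<noteq> 0"
  shows "a = b" "u = v"
proof -
  have "coeff (monom 1 a * u) a = coeff (monom 1 b * v) a" "coeff (monom 1 a * u) b = coeff (monom 1 b * v) b"
    using assms(1) by simp_all
  then show ab: "a = b" using assms(2,3) by (auto simp: coeff_monom_mult split: if_splits)
  then show "u = v" using assms(1) by simp
qed

text \<open>Powers of \<open>t\<close> are units. Once they are stripped off, all polynomials
  involved have a non-zero constant term, which turns b * c = a into the equation p * q = P in
  C[X].\<close>

lemma fin_div_laurent:
  assumes C: "is_subring C" and t: "transc C t" and fd: "fin_div C E"
  shows "fin_div (rgen (C \<union> {t, 1 / t})) {e * t powi k | e k. e \<in> E}"
  unfolding fin_div_def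
proof (intro ballI impI)
  let ?L = "rgen (C \<union> {t, 1 / t})"
  have t0: "t \<noteq> 0" using transc_nonzero[OF C t] .
  have rep: "\<exists>K p. y * t ^ K = poly p t \<and> coeffs_in C p" if "y \<in> ?L" for y
    using rgen_pair_iff[OF C subring_1[OF C] t0] that by (simp add: weighted_1)
  have strip: "\<exists>K i p. y * t ^ K = poly (monom 1 i * p) t \<and> coeffs_in C p \<and> coeff p 0 \<noteq> 0"
    if y: "y \<in> ?L" "y \<noteq> 0" for y
  proof -
    obtain K p where p: "y * t ^ K = poly p t" "coeffs_in C p" using rep[OF y(1)] by blast
    then have "p \<noteq> 0" using y(2) t0 by auto
    then show ?thesis using poly_strip[of p] p C by metis
  qed
  fix a assume a: "a \<in> ?L" "a \<noteq> 0"
  obtain K s P where P: "a * t ^ K = poly (monom 1 s * P) t" "coeffs_in C P" "coeff P 0 \<noteq> 0"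
    using strip[OF a] by blast
  have "P \<noteq> 0" using P(3) by auto
  then obtain Q where Q: "finite Q"
    "\<And>p q. coeffs_in C p \<Longrightarrow> coeffs_in C q \<Longrightarrow> p * q = P \<Longrightarrow> \<exists>e\<in>E. \<exists>r\<in>Q. p = smult e r"
    using fin_div_poly[OF C fd _ P(2)] by blast
  show "\<exists>Q. finite Q \<and> (\<forall>b\<in>?L. \<forall>c\<in>?L. b * c = a \<longrightarrow>
      (\<exists>e\<in>{e * t powi k | e k. e \<in> E}. \<exists>q\<in>Q. b = e * q))"
  proof (intro exI conjI ballI impI)
    show "finite ((\<lambda>r. poly r t) ` Q)" using Q(1) by simp
    fix b c assume bc: "b \<in> ?L" "c \<in> ?L" "b * c = a"
    then have "b \<noteq> 0" "c \<noteq> 0" using a(2) by auto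
    obtain M i p where p: "b * t ^ M = poly (monom 1 i * p) t" "coeffs_in C p" "coeff p 0 \<noteq> 0"
      using strip[OF bc(1) \<open>b \<noteq> 0\<close>] by blast
    obtain N j q where q: "c * t ^ N = poly (monom 1 j * q) t" "coeffs_in C q" "coeff q 0 \<noteq> 0"
      using strip[OF bc(2) \<open>c \<noteq> 0\<close>] by blast
    have pm: "poly (monom 1 e * u) t = t ^ e * poly u t" for e u by (simp add: poly_monom)
    have "poly (monom 1 (i + j + K) * (p * q)) t = poly (monom 1 (s + M + N) * P) t"
    proof -
      have "poly (monom 1 (i + j + K) * (p * q)) t = (b * t ^ M) * (c * t ^ N) * t ^ K"
        unfolding p(1) q(1) pm by (simp add: power_add)
      also have "\<dots> = (a * t ^ K) * t ^ (M + N)" by (simp add: power_add flip: bc(3))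
      also have "\<dots> = poly (monom 1 (s + M + N) * P) t" unfolding P(1) pm by (simp add: power_add)
      finally show ?thesis .
    qed
    then have "monom 1 (i + j + K) * (p * q) = monom 1 (s + M + N) * P"
      by (intro transc_eqD[OF C t])
         (intro coeffs_in_mult coeffs_in_monom C subring_1 p q P | assumption)+
    moreover have "coeff (p * q) 0 \<noteq> 0" using p(3) q(3) by (simp add: coeff_mult)
    ultimately have "p * q = P" using P(3) by (rule monom_mult_unique(2))
    then obtain e r where er: "e \<in> E" "r \<in> Q" "p = smult e r" using Q(2) p(2) q(2) by blast
    have "b = t powi (int i - int M) * poly p t"
      using p(1) t0 unfolding pm by (simp add: power_int_diff field_simps)
    then have "b = (e * t powi (int i - int M)) * poly r t" by (simp add: er(3))
    then show "\<exists>e\<in>{e * t powi k | e k. e \<in> E}. \<exists>q\<in>(\<lambda>r. poly r t) ` Q. b = e * q" using er by blast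
  qed
qed

text \<open>Units with explicit exponents, because it is the exponents that get bounded in
  \<open>fin_div_intermediate\<close>.\<close>

definition monomial_units :: "'a::field set \<Rightarrow> nat set \<Rightarrow> (nat \<Rightarrow> 'a) \<Rightarrow> 'a set" where
  "monomial_units R I x = {r * (\<Prod>k\<in>I. x k powi \<alpha> k) | r \<alpha>. r \<in> units_of_subring R}"

lemma monomial_units_subset:
  assumes "is_subring R" "\<And>k. k \<in> I \<Longrightarrow> x k \<noteq> 0"
  shows "monomial_units R I x \<subseteq> units_of_subring (lring R I x)"
  unfolding monomial_units_def
  using assms
  by (auto intro!: units_of_subring_mult units_of_subring_prod units_of_subring_powi units_of_subring_var)
     (auto simp: units_of_subring_def intro: lring_base)

lemma fin_div_lring:
  assumes R: "is_subring R" and fd: "fin_div R (units_of_subring R)" and "finite I"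
  shows "ind R I x \<Longrightarrow> fin_div (lring R I x) (monomial_units R I x)"
  using assms(3)
proof (induction I rule: finite_induct)
  case empty
  have "monomial_units R {} x = units_of_subring R" by (auto simp: monomial_units_def)
  then show ?case using fd R by (simp add: lring_empty)
next
  case (insert k I)
  have "fin_div (lring R I x) (monomial_units R I x)"
    using insert.IH ind_subset[OF insert.prems] by blast
  moreover have "transc (lring R I x) (x k)" using insert by (auto intro: ind_transc)
  ultimately have "fin_div (lring R (insert k I) x) {e * x k powi a | e a. e \<in> monomial_units R I x}"
    unfolding lring_insert_rgen by (intro fin_div_laurent) simp_all
  moreover have "{e * x k powi a | e a. e \<in> monomial_units R I x} \<subseteq> monomial_units R (insert k I) x"
  proof clarify
    fix e a assume "e \<in> monomial_units R I x"
    then obtain r \<alpha> where r: "r \<in> units_of_subring R" "e = r * (\<Prod>k\<in>I. x k powi \<alpha> k)"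
      by (auto simp: monomial_units_def)
    have "(\<Prod>j\<in>insert k I. x j powi (\<alpha>(k := a)) j) = x k powi a * (\<Prod>j\<in>I. x j powi (\<alpha>(k := a)) j)"
      using insert.hyps by simp
    also have "(\<Prod>j\<in>I. x j powi (\<alpha>(k := a)) j) = (\<Prod>j\<in>I. x j powi \<alpha> j)"
      using insert.hyps by (intro prod.cong) auto
    finally have "e * x k powi a = r * (\<Prod>j\<in>insert k I. x j powi (\<alpha>(k := a)) j)"
      by (simp add: r(2) mult_ac)
    then show "e * x k powi a \<in> monomial_units R (insert k I) x"
      unfolding monomial_units_def using r(1) by blast
  qed
  ultimately show ?case using fin_div_mono by blast
qed

text \<open>If arbitrarily high powers of \<open>f\<close> divide \<open>a\<close>, two of them, f^m
  and f^n with m < n, agree up to units; then f^(n - m) is a unit, and so is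
  \<open>f\<close>.\<close>

lemma bounded_power_divisor:
  assumes A: "is_subring A" and fd: "fin_div A E" and E: "E \<subseteq> units_of_subring A"
    and a: "a \<in> A" "a \<noteq> 0" and f: "f \<in> A" "f \<notin> units_of_subring A"
  shows "\<exists>N. \<forall>e c. c \<in> A \<longrightarrow> a = c * f ^ e \<longrightarrow> e \<le> N"
proof (rule ccontr)
  define S where "S = {e. \<exists>c\<in>A. a = c * f ^ e}"
  assume "\<not> ?thesis"
  then have inf: "\<And>N. \<exists>e\<in>S. e > N" unfolding S_def by (simp add: not_le) blast
  then have "infinite S" unfolding finite_nat_set_iff_bounded_le by (metis not_le)
  obtain e1 where "e1 \<in> S" "e1 > 0" using inf by blast
  then have f0: "f \<noteq> 0" using a(2) by (auto simp: S_def)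
  obtain Q where Q: "finite Q" "\<And>b c. b \<in> A \<Longrightarrow> c \<in> A \<Longrightarrow> b * c = a \<Longrightarrow> \<exists>e\<in>E. \<exists>q\<in>Q. b = e * q"
    using fin_divD[OF fd a] by blast
  have "\<exists>q\<in>Q. \<exists>u\<in>E. f ^ e = u * q" if e: "e \<in> S" for e
  proof -
    obtain c where c: "c \<in> A" "f ^ e * c = a" using e by (auto simp: S_def mult.commute)
    show ?thesis using Q(2)[OF subring_power[OF A f(1)] c] by blast
  qed
  then obtain g where g: "\<And>e. e \<in> S \<Longrightarrow> g e \<in> Q" "\<And>e. e \<in> S \<Longrightarrow> \<exists>u\<in>E. f ^ e = u * g e" by metis
  have "\<not> inj_on g S" using \<open>infinite S\<close> Q(1) g(1) by (meson finite_subset image_subsetI finite_imageD)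
  then obtain m n where mn: "m \<in> S" "n \<in> S" "m < n" "g m = g n"
    unfolding inj_on_def by (metis nat_neq_iff)
  obtain u v where uv: "u \<in> E" "v \<in> E" "f ^ m = u * g m" "f ^ n = v * g n" using g(2) mn by metis
  have u: "u \<in> A" "u \<noteq> 0" "inverse u \<in> A" "v \<in> A" "v \<noteq> 0" "inverse v \<in> A"
    using uv(1,2) E by (auto simp: units_of_subring_def)
  have "u * f ^ n = v * f ^ m" using uv mn(4) by simp
  moreover have "f ^ n = f ^ m * f ^ (n - m)" using mn(3) by (simp flip: power_add)
  ultimately have "u * f ^ (n - m) = v" using f0 by simp
  moreover have "n - m = Suc (n - m - 1)" using mn(3) by simp
  then have "f ^ (n - m) = f * f ^ (n - m - 1)" by (metis power_Suc)
  ultimately have "f * (f ^ (n - m - 1) * u * inverse v) = 1" using u by (simp add: field_simps)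
  then have "inverse f = f ^ (n - m - 1) * u * inverse v" by (rule inverse_unique)
  also have "\<dots> \<in> A" by (intro subring_mult subring_power A f(1) u)
  finally show False using f f0 by (simp add: units_of_subring_def)
qed

text \<open>The case \<open>f = 0\<close>, where the ring is \<open>C[t]\<close>, is included.\<close>

lemma bounded_order:
  assumes C: "is_subring C" and t: "transc C t" and fd: "fin_div C E" and E: "E \<subseteq> units_of_subring C"
    and f: "f \<in> C" "f \<notin> units_of_subring C"
    and y: "y \<in> rgen (C \<union> {t, 1 / t})" "y \<noteq> 0"
  shows "\<exists>N. \<forall>k. y * t powi k \<in> rgen (C \<union> {t, f / t}) \<longrightarrow> k \<ge> - int N"
proof -
  have t0: "t \<noteq> 0" using transc_nonzero[OF C t] .
  obtain L P where P: "y * t ^ L = poly P t" "coeffs_in C P"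
    using rgen_pair_iff[OF C subring_1[OF C] t0] y(1) by (auto simp: weighted_1)
  then have "P \<noteq> 0" using y(2) t0 by auto
  \<comment> \<open>One non-zero coefficient is enough: if \<open>y\<close> divided by t^N lies in
    the ring, then f^(N + L - j) divides this coefficient, whereas the powers of \<open>f\<close>
    dividing it have exponent at most \<open>e0\<close>.\<close>
  then obtain j where j: "coeff P j \<noteq> 0" by (metis leading_coeff_0_iff)
  have "coeff P j \<in> C" using P(2) by (simp add: coeffs_in_def)
  then obtain e0 where e0: "\<And>e c. c \<in> C \<Longrightarrow> coeff P j = c * f ^ e \<Longrightarrow> e \<le> e0"
    using bounded_power_divisor[OF C fd E _ j f] by blast
  have "k \<ge> - int (e0 + j)" if mem: "y * t powi k \<in> rgen (C \<union> {t, f / t})" for k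
  proof (rule ccontr)
    assume k: "\<not> - int (e0 + j) \<le> k"
    define N where "N = nat (- k)"
    have N: "N > e0 + j" "y * t powi k * t ^ N = y" using k t0 by (auto simp: N_def power_int_def power_inverse)
    obtain K Q where Q: "y * t powi k * t ^ K = poly Q t" "weighted C f K Q"
      using mem unfolding rgen_pair_iff[OF C f(1) t0] by blast
    have "poly (monom 1 K * P) t = t ^ K * (y * t ^ L)" by (simp add: poly_monom P(1))
    also have "\<dots> = t ^ K * ((y * t powi k * t ^ N) * t ^ L)" by (simp only: N(2))
    also have "\<dots> = (y * t powi k * t ^ K) * t ^ (N + L)" by (simp add: power_add)
    also have "\<dots> = poly (monom 1 (N + L) * Q) t" by (simp add: poly_monom Q(1))
    finally have "monom 1 K * P = monom 1 (N + L) * Q"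
      by (intro transc_eqD[OF C t])
         (intro coeffs_in_mult coeffs_in_monom C subring_1 P weighted_coeffs_in[OF C f(1) Q(2)] | assumption)+
    then have "coeff (monom 1 K * P) (j + K) = coeff (monom 1 (N + L) * Q) (j + K)" by simp
    then have eq: "coeff P j = (if N + L \<le> j + K then coeff Q (j + K - (N + L)) else 0)"
      by (simp add: coeff_monom_mult)
    then have le: "N + L \<le> j + K" using j by (auto split: if_splits)
    obtain c where c: "c \<in> C" "coeff Q (j + K - (N + L)) = c * f ^ (K - (j + K - (N + L)))"
      using Q(2) weightedD by blast
    have "K - (j + K - (N + L)) = N + L - j" using le N(1) by linarith
    then have "coeff P j = c * f ^ (N + L - j)" using eq le c(2) by simp
    then have "N + L - j \<le> e0" using e0 c(1) by blast
    then show False using N(1) by linarith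
  qed
  then show ?thesis by blast
qed

text \<open>A divisor \<open>b\<close> of \<open>a\<close> is a Laurent monomial times one of
  finitely many \<open>q\<close>. Variables outside \<open>J\<close> are units of \<open>A\<close>.
  For k in \<open>J\<close>, membership of \<open>b\<close> in \<open>A\<close> bounds the exponent
  from below by \<open>bounded_order\<close>; the cofactor is the inverse monomial times a / q, and
  the same estimate applied to it bounds the exponent from above.\<close>

lemma fin_div_intermediate:
  assumes R: "is_subring R" and fd: "fin_div R (units_of_subring R)" and fin: "finite I" and ind: "ind R I x"
    and A: "is_subring A" and RA: "R \<subseteq> A" and AL: "A \<subseteq> lring R I x"
    and J: "J \<subseteq> I" "\<And>k. k \<in> I - J \<Longrightarrow> x k \<in> units_of_subring A"
    and f: "\<And>k. k \<in> J \<Longrightarrow> f k \<in> lring R (I - {k}) x"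
      "\<And>k. k \<in> J \<Longrightarrow> f k \<notin> units_of_subring (lring R (I - {k}) x)"
      "\<And>k. k \<in> J \<Longrightarrow> A \<subseteq> rgen (lring R (I - {k}) x \<union> {x k, f k / x k})"
  shows "fin_div A (units_of_subring A)"
  unfolding fin_div_def
proof (intro ballI impI)
  let ?L = "lring R I x"
  have nz: "x k \<noteq> 0" if "k \<in> I" for k using ind_nonzero[OF ind that] .
  have UL: "monomial_units R I x \<subseteq> units_of_subring ?L" using R nz by (rule monomial_units_subset)
  have bound: "\<exists>N. \<forall>r \<alpha>. r \<in> units_of_subring R \<longrightarrow> r * (\<Prod>j\<in>I. x j powi \<alpha> j) * y \<in> A \<longrightarrow> \<alpha> k \<ge> - int N"
    if k: "k \<in> J" and y: "y \<in> ?L" "y \<noteq> 0" for k y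
  proof -
    let ?C = "lring R (I - {k}) x"
    have kI: "k \<in> I" and ins: "insert k (I - {k}) = I" using k J by auto
    have "fin_div ?C (monomial_units R (I - {k}) x)"
      using fin ind_subset[OF ind] by (intro fin_div_lring R fd) auto
    moreover have "monomial_units R (I - {k}) x \<subseteq> units_of_subring ?C"
      using nz by (intro monomial_units_subset R) auto
    moreover have "transc ?C (x k)" using ind kI by (auto simp: ind_def)
    moreover have "y \<in> rgen (?C \<union> {x k, 1 / x k})" using y(1) lring_insert_rgen[of R k "I - {k}" x] ins by simp
    ultimately have "\<exists>N. \<forall>e. y * x k powi e \<in> rgen (?C \<union> {x k, f k / x k}) \<longrightarrow> e \<ge> - int N"
      by (intro bounded_order[where E = "monomial_units R (I - {k}) x"] is_subring_lring f(1,2)[OF k] y(2))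
    then obtain N where N: "\<And>e. y * x k powi e \<in> rgen (?C \<union> {x k, f k / x k}) \<Longrightarrow> e \<ge> - int N" by blast
    have "\<alpha> k \<ge> - int N" if r: "r \<in> units_of_subring R" and mem: "r * (\<Prod>j\<in>I. x j powi \<alpha> j) * y \<in> A" for r \<alpha>
    proof (rule N)
      let ?D = "rgen (?C \<union> {x k, f k / x k})"
      define u where "u = r * (\<Prod>j\<in>I-{k}. x j powi \<alpha> j)"
      have "u \<in> monomial_units R (I - {k}) x" unfolding u_def monomial_units_def using r by blast
      then have "u \<in> units_of_subring ?C" using monomial_units_subset[OF R, of "I - {k}" x] nz by blast
      then have u: "inverse u \<in> ?D" "u \<noteq> 0" by (auto simp: units_of_subring_def intro: rgen_incl)
      have "(\<Prod>j\<in>I. x j powi \<alpha> j) = x k powi \<alpha> k * (\<Prod>j\<in>I-{k}. x j powi \<alpha> j)"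
        using fin kI by (rule prod.remove)
      then have "r * (\<Prod>j\<in>I. x j powi \<alpha> j) = x k powi \<alpha> k * u" by (simp add: u_def mult_ac)
      then have "y * x k powi \<alpha> k = inverse u * (r * (\<Prod>j\<in>I. x j powi \<alpha> j) * y)"
        using u(2) by simp
      also have "\<dots> \<in> ?D" by (rule subring_mult[OF is_subring_rgen u(1) subsetD[OF f(3)[OF k] mem]])
      finally show "y * x k powi \<alpha> k \<in> ?D" .
    qed
    then show ?thesis by blast
  qed
  fix a assume a: "a \<in> A" "a \<noteq> 0"
  then have aL: "a \<in> ?L" using AL by blast
  obtain Q where Q: "finite Q"
    "\<And>b c. b \<in> ?L \<Longrightarrow> c \<in> ?L \<Longrightarrow> b * c = a \<Longrightarrow> \<exists>e\<in>monomial_units R I x. \<exists>q\<in>Q. b = e * q"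
    using fin_divD[OF fin_div_lring[OF R fd fin ind] aL a(2)] by blast
  define Q' where "Q' = {q \<in> Q. q \<in> ?L \<and> q \<noteq> 0 \<and> a / q \<in> ?L}"
  have bound': "\<exists>N. \<forall>k\<in>J. \<forall>r \<alpha>. r \<in> units_of_subring R \<longrightarrow> r * (\<Prod>j\<in>I. x j powi \<alpha> j) * y \<in> A \<longrightarrow> \<alpha> k \<ge> - int N"
    if y: "y \<in> ?L" "y \<noteq> 0" for y
  proof -
    have "\<forall>k\<in>J. \<exists>N. \<forall>r \<alpha>. r \<in> units_of_subring R \<longrightarrow> r * (\<Prod>j\<in>I. x j powi \<alpha> j) * y \<in> A \<longrightarrow>
        \<alpha> k \<ge> - int N" using bound[OF _ y] by blast
    from bchoice[OF this] obtain N where N: "\<And>k r \<alpha>. k \<in> J \<Longrightarrow> r \<in> units_of_subring R \<Longrightarrow>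
        r * (\<Prod>j\<in>I. x j powi \<alpha> j) * y \<in> A \<Longrightarrow> \<alpha> k \<ge> - int (N k)" by blast
    have "finite J" using J(1) fin by (rule finite_subset)
    then have le: "N k \<le> (\<Sum>k\<in>J. N k)" if "k \<in> J" for k using that by (intro member_le_sum) auto
    show ?thesis
    proof (intro exI ballI allI impI)
      fix k r \<alpha> assume *: "k \<in> J" "r \<in> units_of_subring R" "r * (\<Prod>j\<in>I. x j powi \<alpha> j) * y \<in> A"
      show "- int (\<Sum>k\<in>J. N k) \<le> \<alpha> k" using N[OF *] le[OF *(1)] by linarith
    qed
  qed
  have "\<forall>y\<in>?L - {0}. \<exists>N. \<forall>k\<in>J. \<forall>r \<alpha>. r \<in> units_of_subring R \<longrightarrow>
      r * (\<Prod>j\<in>I. x j powi \<alpha> j) * y \<in> A \<longrightarrow> \<alpha> k \<ge> - int N" using bound' by blast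
  from bchoice[OF this] obtain N where N: "\<And>y k r \<alpha>. y \<in> ?L \<Longrightarrow> y \<noteq> 0 \<Longrightarrow> k \<in> J \<Longrightarrow>
      r \<in> units_of_subring R \<Longrightarrow> r * (\<Prod>j\<in>I. x j powi \<alpha> j) * y \<in> A \<Longrightarrow> \<alpha> k \<ge> - int (N y)" by blast
  \<comment> \<open>Exponent vectors on \<open>J\<close>: the lower bounds belong to
    \<open>q\<close>, the upper bounds to a / q.\<close>
  define box where "box q = (\<Pi>\<^sub>E k\<in>J. {- int (N q)..int (N (a / q))})" for q
  define Q'' where "Q'' = (\<Union>q\<in>Q'. (\<lambda>\<alpha>. (\<Prod>j\<in>J. x j powi \<alpha> j) * q) ` box q)"
  have "finite Q''"
    unfolding Q''_def box_def using Q(1) J(1) fin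
    by (intro finite_UN_I finite_imageI finite_PiE) (auto simp: Q'_def intro: finite_subset)
  moreover have "\<exists>e\<in>units_of_subring A. \<exists>q\<in>Q''. b = e * q" if bc: "b \<in> A" "c \<in> A" "b * c = a" for b c
  proof -
    obtain e q where eq: "e \<in> monomial_units R I x" "q \<in> Q" "b = e * q"
      using Q(2)[of b c] bc AL by blast
    obtain r \<alpha> where r: "r \<in> units_of_subring R" "e = r * (\<Prod>j\<in>I. x j powi \<alpha> j)"
      using eq(1) by (auto simp: monomial_units_def)
    have e: "e \<noteq> 0" "e \<in> ?L" "inverse e \<in> ?L" using eq(1) UL by (auto simp: units_of_subring_def)
    have "b \<noteq> 0" "c \<noteq> 0" using bc(3) a(2) by auto
    have q0: "q \<noteq> 0" using eq(3) \<open>b \<noteq> 0\<close> by auto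
    have "q = inverse e * b" using e(1) eq(3) by simp
    also have "\<dots> \<in> ?L" using e(3) bc(1) AL by (intro subring_mult is_subring_lring) auto
    finally have qL: "q \<in> ?L" .
    have aq: "a / q = e * c" using q0 by (simp add: eq(3) flip: bc(3))
    have aqL: "a / q \<in> ?L" unfolding aq using e(2) bc(2) AL by (intro subring_mult is_subring_lring) auto
    have q': "q \<in> Q'" using eq(2) qL q0 aqL by (simp add: Q'_def)
    have "inverse r * (\<Prod>j\<in>I. x j powi (- \<alpha> j)) * (a / q) = c"
    proof -
      have "inverse r * (\<Prod>j\<in>I. x j powi (- \<alpha> j)) = inverse e"
        using prod_inversef[of "\<lambda>j. x j powi \<alpha> j" I] by (simp add: r(2) power_int_minus comp_def)
      then show ?thesis unfolding aq using e(1) by simp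
    qed
    then have up: "- \<alpha> k \<ge> - int (N (a / q))" if "k \<in> J" for k
      using N[OF aqL _ that units_of_subring_inverse[OF r(1)], of "\<lambda>j. - \<alpha> j"] bc(2) a(2) q0 by auto
    have low: "\<alpha> k \<ge> - int (N q)" if "k \<in> J" for k
      using N[OF qL q0 that r(1), of \<alpha>] bc(1) eq(3) r(2) by simp
    \<comment> \<open>Restriction makes the exponent vector extensional, as membership in the finite
      product \<open>box q\<close> requires.\<close>
    define \<beta> where "\<beta> = restrict \<alpha> J"
    have "\<beta> \<in> box q" using up low by (force simp: box_def \<beta>_def)
    then have mem: "(\<Prod>j\<in>J. x j powi \<beta> j) * q \<in> Q''" unfolding Q''_def using q' by blast
    have "(\<Prod>j\<in>I. x j powi \<alpha> j) = (\<Prod>j\<in>I-J. x j powi \<alpha> j) * (\<Prod>j\<in>J. x j powi \<alpha> j)"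
      using J(1) fin by (rule prod.subset_diff)
    also have "(\<Prod>j\<in>J. x j powi \<alpha> j) = (\<Prod>j\<in>J. x j powi \<beta> j)" by (intro prod.cong) (auto simp: \<beta>_def)
    finally have b: "b = (r * (\<Prod>j\<in>I-J. x j powi \<alpha> j)) * ((\<Prod>j\<in>J. x j powi \<beta> j) * q)"
      by (simp add: eq(3) r(2))
    have "r \<in> units_of_subring A" using r(1) RA by (auto simp: units_of_subring_def)
    then have "r * (\<Prod>j\<in>I-J. x j powi \<alpha> j) \<in> units_of_subring A"
      by (intro units_of_subring_mult units_of_subring_prod units_of_subring_powi A J(2)) auto
    then show ?thesis using b mem by blast
  qed
  ultimately show "\<exists>Q. finite Q \<and> (\<forall>b\<in>A. \<forall>c\<in>A. b * c = a \<longrightarrow> (\<exists>e\<in>units_of_subring A. \<exists>q\<in>Q. b = e * q))"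
    by blast
qed

section \<open>Finite factorization domains\<close>

text \<open>A class is the whole set of associates of a divisor, so that classes can be counted by
  \<open>card\<close>.\<close>

definition divisor_classes :: "'a::field set \<Rightarrow> 'a \<Rightarrow> 'a set set" where
  "divisor_classes A a = (\<lambda>b. (\<lambda>u. u * b) ` units_of_subring A) ` {b \<in> A. \<exists>c\<in>A. b * c = a}"

lemma finite_divisor_classes:
  assumes A: "is_subring A" and fd: "fin_div A (units_of_subring A)" and a: "a \<in> A" "a \<noteq> 0"
  shows "finite (divisor_classes A a)"
proof -
  obtain Q where Q: "finite Q"
    "\<And>b c. b \<in> A \<Longrightarrow> c \<in> A \<Longrightarrow> b * c = a \<Longrightarrow> \<exists>e\<in>units_of_subring A. \<exists>q\<in>Q. b = e * q"
    using fin_divD[OF fd a] by blast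
  have "divisor_classes A a \<subseteq> (\<lambda>q. (\<lambda>u. u * q) ` units_of_subring A) ` Q"
    unfolding divisor_classes_def
  proof (rule image_subsetI, clarify)
    fix b c assume "b \<in> A" "c \<in> A" "a = b * c"
    then obtain e q where eq: "e \<in> units_of_subring A" "q \<in> Q" "b = e * q" using Q(2) by blast
    have "(\<lambda>u. u * b) ` units_of_subring A = (\<lambda>u. u * q) ` units_of_subring A"
    proof (intro equalityI image_subsetI)
      fix u assume u: "u \<in> units_of_subring A"
      show "u * b \<in> (\<lambda>u. u * q) ` units_of_subring A"
        using units_of_subring_mult[OF A u eq(1)] by (auto simp: eq(3) mult.assoc)
      have "u * q = (u * inverse e) * b" using units_of_subringD[OF eq(1)] by (simp add: eq(3))
      then show "u * q \<in> (\<lambda>u. u * b) ` units_of_subring A"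
        using units_of_subring_mult[OF A u units_of_subring_inverse[OF eq(1)]] by blast
    qed
    then show "(\<lambda>u. u * b) ` units_of_subring A \<in> (\<lambda>q. (\<lambda>u. u * q) ` units_of_subring A) ` Q"
      using eq(2) by blast
  qed
  then show ?thesis using Q(1) by (meson finite_imageI finite_subset)
qed

text \<open>Every divisor of \<open>b\<close> divides \<open>b * c\<close>. The class of
  \<open>b * c\<close> itself is new, since otherwise \<open>b * c\<close> would divide
  \<open>b\<close> and \<open>c\<close> would be a unit.\<close>

lemma card_divisor_classes_less:
  assumes A: "is_subring A" and fd: "fin_div A (units_of_subring A)"
    and bc: "b \<in> A" "c \<in> A" "b * c \<noteq> 0" "c \<notin> units_of_subring A"
  shows "card (divisor_classes A b) < card (divisor_classes A (b * c))"
proof (rule psubset_card_mono)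
  let ?U = "units_of_subring A"
  show "finite (divisor_classes A (b * c))"
    using A fd subring_mult[OF A bc(1,2)] bc(3) by (rule finite_divisor_classes)
  have "{d \<in> A. \<exists>e\<in>A. d * e = b} \<subseteq> {d \<in> A. \<exists>e\<in>A. d * e = b * c}"
    using subring_mult[OF A _ bc(2)] by (auto simp: mult.assoc)
  then have "divisor_classes A b \<subseteq> divisor_classes A (b * c)"
    unfolding divisor_classes_def by (rule image_mono)
  moreover have "(\<lambda>u. u * (b * c)) ` ?U \<in> divisor_classes A (b * c)"
    unfolding divisor_classes_def using subring_mult[OF A bc(1,2)] subring_1[OF A] by force
  moreover have "(\<lambda>u. u * (b * c)) ` ?U \<notin> divisor_classes A b"
  proof
    assume "(\<lambda>u. u * (b * c)) ` ?U \<in> divisor_classes A b"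
    then obtain d e where de: "e \<in> A" "d * e = b" "(\<lambda>u. u * (b * c)) ` ?U = (\<lambda>u. u * d) ` ?U"
      unfolding divisor_classes_def by auto
    have "d \<in> (\<lambda>u. u * (b * c)) ` ?U" unfolding de(3) using units_of_subring_1[OF A] by force
    then obtain u where u: "u \<in> ?U" "d = u * (b * c)" by blast
    have "b * (u * c * e) = b" using u(2) de(2) by (simp add: mult_ac)
    then have "c * (u * e) = 1" using bc(3) by (simp add: mult_ac)
    then have "inverse c = u * e" by (rule inverse_unique)
    then show False using bc u(1) de(1) A by (auto simp: units_of_subring_def subring_mult)
  qed
  ultimately show "divisor_classes A b \<subset> divisor_classes A (b * c)" by blast
qed

lemma domain_ring_on:
  assumes "is_subring A" shows "domain (ring_on A)"
proof -
  interpret field "ambient :: 'a ring" by (rule field_from_type_algebra)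
  have "subring A ambient"
    by (rule subringI) (use assms in \<open>auto simp: subringD\<close>)
  then show ?thesis by (rule subring_is_domain)
qed

lemma Units_ring_on:
  "is_subring A \<Longrightarrow> u \<in> Units (ring_on A) \<longleftrightarrow> u \<in> units_of_subring A"
  "is_subring A \<Longrightarrow> u \<in> Units (mult_of (ring_on A)) \<longleftrightarrow> u \<in> units_of_subring A"
proof -
  have *: "(\<exists>v\<in>A. v * u = 1 \<and> u * v = 1) \<longleftrightarrow> u \<noteq> 0 \<and> inverse u \<in> A"
    by (metis inverse_unique left_inverse mult_zero_left right_inverse zero_neq_one)
  have **: "(\<exists>v\<in>A-{0}. v * u = 1 \<and> u * v = 1) \<longleftrightarrow> u \<noteq> 0 \<and> inverse u \<in> A"
    using * by (metis DiffI mult_zero_left singletonD zero_neq_one Diff_iff)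
  show "u \<in> Units (ring_on A) \<longleftrightarrow> u \<in> units_of_subring A"
    using * by (auto simp: Units_def units_of_subring_def)
  show "u \<in> Units (mult_of (ring_on A)) \<longleftrightarrow> u \<in> units_of_subring A"
    using ** by (auto simp: Units_def units_of_subring_def)
qed

lemma foldr_ambient [simp]: "foldr (\<otimes>\<^bsub>ambient\<^esub>) fs z = prod_list fs * z"
  by (induction fs) (auto simp: mult.assoc)

text \<open>The number of divisor classes drops when a non-unit factor is removed. This gives a
  factorization into atoms by induction and bounds the length of every factorization. Up to
  associates each atom dividing \<open>a\<close> lies in \<open>Q\<close>, so lists over
  \<open>Q\<close> of bounded length represent all factorizations.\<close>

lemma fin_div_imp_ff_domain:
  fixes A :: "'a::field set"
  assumes A: "is_subring A" and fd: "fin_div A (units_of_subring A)"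
  shows "ff_domain (ring_on A)"
proof -
  let ?M = "mult_of (ring_on A)" and ?U = "units_of_subring A"
  let ?n = "\<lambda>a. card (divisor_classes A a)"
  have irr_nonunit: "x \<notin> ?U" if "Divisibility.irreducible ?M x" for x
    using that Units_ring_on(2)[OF A] by (auto simp: Divisibility.irreducible_def)
  have exist: "\<exists>fs. set fs \<subseteq> carrier ?M \<and> factors ?M fs a" if "a \<in> A" "a \<noteq> 0" "a \<notin> ?U" for a
    using that
  proof (induction "?n a" arbitrary: a rule: less_induct)
    case less
    show ?case
    proof (cases "Divisibility.irreducible ?M a")
      case True
      then show ?thesis using less.prems by (intro exI[of _ "[a]"]) (auto simp: factors_def)
    next
      case False
      then obtain b where b: "b \<in> A" "b \<noteq> 0" "properfactor ?M b a" "b \<notin> ?U"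
        using less.prems Units_ring_on(2)[OF A] by (auto simp: Divisibility.irreducible_def)
      then obtain c where c: "c \<in> A" "c \<noteq> 0" "a = b * c"
        by (auto simp: properfactor_def factor_def)
      have "c \<notin> ?U"
      proof
        assume "c \<in> ?U"
        then have "inverse c \<in> A - {0}" "b = a * inverse c" using c by (auto simp: units_of_subring_def)
        then have "a divides\<^bsub>?M\<^esub> b" by (auto simp: factor_def)
        then show False using b(3) by (simp add: properfactor_def)
      qed
      then have "?n b < ?n a" "?n c < ?n a"
        using card_divisor_classes_less[OF A fd, of b c] card_divisor_classes_less[OF A fd, of c b] b c
        by (simp_all add: mult.commute)
      then obtain fs gs where "set fs \<subseteq> carrier ?M" "factors ?M fs b" "set gs \<subseteq> carrier ?M" "factors ?M gs c"
        using less.hyps[of b] less.hyps[of c] b c \<open>c \<notin> ?U\<close> by metis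
      then show ?thesis using c(3) by (intro exI[of _ "fs @ gs"]) (auto simp: factors_def)
    qed
  qed
  have len: "length fs \<le> ?n (prod_list fs)"
    if "set fs \<subseteq> A - {0}" "\<forall>x\<in>set fs. Divisibility.irreducible ?M x" for fs
    using that
  proof (induction fs)
    case (Cons x fs)
    have fs: "prod_list fs \<in> A" "prod_list fs \<noteq> 0"
      using Cons.prems(1) A by (induction fs) (auto simp: subringD)
    have "?n (prod_list fs) < ?n (prod_list fs * x)"
      using fs Cons.prems irr_nonunit by (intro card_divisor_classes_less A fd) auto
    then show ?case using Cons by (simp add: mult.commute)
  qed simp
  have finite: "\<exists>\<F>. finite \<F> \<and> (\<forall>fs. set fs \<subseteq> carrier ?M \<and> factors ?M fs a \<longrightarrow>
      (\<exists>gs\<in>\<F>. essentially_equal ?M fs gs))" if a: "a \<in> A" "a \<noteq> 0" for a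
  proof -
    obtain Q where Q: "finite Q"
      "\<And>b c. b \<in> A \<Longrightarrow> c \<in> A \<Longrightarrow> b * c = a \<Longrightarrow> \<exists>e\<in>?U. \<exists>q\<in>Q. b = e * q"
      using fin_divD[OF fd a] by blast
    show ?thesis
    proof (intro exI conjI allI impI)
      show "finite {gs. set gs \<subseteq> Q \<and> length gs \<le> ?n a}" using Q(1) by (rule finite_lists_length_le)
      fix fs assume "set fs \<subseteq> carrier ?M \<and> factors ?M fs a"
      then have fs: "set fs \<subseteq> A - {0}" "\<forall>x\<in>set fs. Divisibility.irreducible ?M x" "prod_list fs = a"
        by (auto simp: factors_def)
      have "\<exists>q. q \<in> Q \<and> x \<sim>\<^bsub>?M\<^esub> q" if x: "x \<in> set fs" for x
      proof -
        obtain ys zs where yz: "fs = ys @ x # zs" using x by (meson split_list)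
        have "prod_list us \<in> A" if "set us \<subseteq> A - {0}" for us
          using that A by (induction us) (auto simp: subringD)
        then have "prod_list ys * prod_list zs \<in> A" using fs(1) yz A by (auto simp: subring_mult)
        moreover have "x * (prod_list ys * prod_list zs) = a" using fs(3) yz by (simp add: mult_ac)
        ultimately obtain e q where eq: "e \<in> ?U" "q \<in> Q" "x = e * q"
          using Q(2)[of x] fs(1) x by blast
        have e: "e \<in> A - {0}" "inverse e \<in> A - {0}" using eq(1) by (auto simp: units_of_subring_def)
        have "q = x * inverse e" using e(1) by (simp add: eq(3))
        then have "x divides\<^bsub>?M\<^esub> q" unfolding factor_def using e(2) by (intro bexI[of _ "inverse e"]) simp_all
        moreover have "q divides\<^bsub>?M\<^esub> x"
          unfolding factor_def using e(1) by (intro bexI[of _ e]) (simp_all add: eq(3))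
        ultimately have "x \<sim>\<^bsub>?M\<^esub> q" by (simp add: associated_def)
        then show ?thesis using eq(2) by blast
      qed
      then obtain g where g: "\<And>x. x \<in> set fs \<Longrightarrow> g x \<in> Q" "\<And>x. x \<in> set fs \<Longrightarrow> x \<sim>\<^bsub>?M\<^esub> g x" by metis
      have "length fs \<le> ?n a" using len[OF fs(1,2)] fs(3) by simp
      then have "map g fs \<in> {gs. set gs \<subseteq> Q \<and> length gs \<le> ?n a}" using g(1) by auto
      moreover have "essentially_equal ?M fs (map g fs)"
        unfolding essentially_equal_def using g(2)
        by (intro exI[of _ fs]) (auto simp: list_all2_conv_all_nth)
      ultimately show "\<exists>gs\<in>{gs. set gs \<subseteq> Q \<and> length gs \<le> ?n a}. essentially_equal ?M fs gs" by blast
    qed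
  qed
  show ?thesis
    unfolding ff_domain_def atomic_domain_def
    using domain_ring_on[OF A] exist finite Units_ring_on(1)[OF A] by auto
qed

section \<open>Isolated variables\<close>

text \<open>Independence survives because f / x i is transcendental over the Laurent ring in the
  other variables for f \<noteq> 0. The monomials in \<open>\<rho>\<close> involve only frozen
  variables, which keep their values.\<close>

lemma generalized_seed_mutate:
  assumes S: "generalized_seed R n m d (x, \<rho>, B)" and R: "is_subring R" and i: "i \<in> {1..n}"
    and f0: "exchange_polynomial n m d (x, \<rho>, B) i \<noteq> 0"
  shows "generalized_seed R n m d (mutate n m d i (x, \<rho>, B))"
proof -
  note SD = generalized_seedD[OF S R]
  define f where "f = exchange_polynomial n m d (x, \<rho>, B) i"
  have ii: "beta d B i i = 0" using skew_symmetrizable_diag[OF SD(2) i] by (simp add: beta_def)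
  have "lring R {n+1..n+m} x \<subseteq> lring R ({1..n+m} - {i}) x" using i by (intro lring_mono) auto
  then have "f \<in> lring R ({1..n+m} - {i}) x"
    unfolding f_def using rho_in_lring[OF S R i] by (intro exchange_polynomial_in_lring R ii) blast
  then have "ind R {1..n+m} (x(i := f / x i))"
    using f0 by (intro ind_mutate SD i) (auto simp: f_def)
  moreover have "int (d l) dvd mutate_matrix i B k l" if "l \<in> {1..n}" "k \<in> {1..n+m}" for k l
    using that i by (intro dvd_mutate_matrix SD) auto
  moreover have frozen: "frozen_monomial R n m (x(i := f / x i)) r = frozen_monomial R n m x r" for r
  proof -
    have "(\<Prod>k\<in>{n+1..n+m}. (x(i := f / x i)) k ^ e k) = (\<Prod>k\<in>{n+1..n+m}. x k ^ e k)" for e :: "nat \<Rightarrow> nat"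
      by (intro prod.cong) (use i in auto)
    then show ?thesis by (simp only: frozen_monomial_def)
  qed
  moreover have "frozen_monomial R n m x (\<rho> i (d i - j))" if "j \<in> {1..d i - 1}" for j
    by (rule SD(7)[OF i]) (use that in auto)
  ultimately show ?thesis
    unfolding mutate.simps f_def[symmetric]
    using SD(3,5,6,7) skew_symmetrizable_mutate[OF SD(2) i] R
    by (auto simp: algebraically_independent_iff_ind)
qed

lemma mutation_step_mutate:
  assumes S: "generalized_seed R n m d S" and R: "is_subring R" and i: "i \<in> {1..n}"
    and f0: "exchange_polynomial n m d S i \<noteq> 0"
  shows "mutation_equivalent R n m d S (mutate n m d i S)"
  unfolding mutation_equivalent_def
proof (rule r_into_rtranclp)
  show "mutation_step R n m d S (mutate n m d i S)"
    using assms generalized_seed_mutate[of R n m d "fst S" "fst (snd S)" "snd (snd S)" i]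
    by (auto simp: mutation_step_def)
qed

text \<open>If \<open>B k i \<noteq> 0\<close>, the exchange polynomial has, as a polynomial in \<open>x k\<close>, positive degree and a
  non-zero constant term, so it neither vanishes nor is a unit.\<close>

lemma column_zero:
  assumes S: "generalized_seed R n m d (x, \<rho>, B)" and R: "is_subring R" and i: "i \<in> {1..n}" and k: "k \<in> {1..n}"
    and f: "exchange_polynomial n m d (x, \<rho>, B) i = 0 \<or>
      exchange_polynomial n m d (x, \<rho>, B) i \<in> units_of_subring (lring R ({1..n+m} - {i}) x)"
  shows "B k i = 0"
proof (rule ccontr)
  assume B: "B k i \<noteq> 0"
  note SD = generalized_seedD[OF S R]
  have ki: "k \<noteq> i" using B skew_symmetrizable_diag[OF SD(2) i] by auto
  define b where "b = beta d B k i"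
  have b: "b \<noteq> 0" unfolding b_def using beta_0_iff[of d i B k] SD(3,4)[OF i] k B by auto
  let ?C = "lring R ({1..n+m} - {i, k}) x"
  let ?I = "{1..n+m} - {i}"
  have t: "transc ?C (x k)" using SD(1) by (rule ind_transc) (use k in auto)
  have insert: "lring R ?I x = rgen (?C \<union> {x k, 1 / x k})"
  proof -
    have "?I = insert k ({1..n+m} - {i, k})" using ki k by auto
    then show ?thesis by (simp add: lring_insert_rgen)
  qed
  have C: "is_subring ?C" by simp
  have nz: "x j \<noteq> 0" if "j \<in> {1..n+m}" for j using ind_nonzero[OF SD(1) that] .
  have exp_i: "eexp d B i j i = 0" for j
    using skew_symmetrizable_diag[OF SD(2) i] by (simp add: eexp_def beta_def pos_part_def)
  define c where "c j = \<rho> i j * (\<Prod>l\<in>{1..n+m}-{k}. x l ^ eexp d B i j l)" for j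
  define p where "p = (\<Sum>j=0..d i. monom (c j) (eexp d B i j k))"
  have c: "c j \<in> ?C" if "j \<le> d i" for j
    unfolding c_def
  proof (intro subring_mult subring_prod C)
    show "\<rho> i j \<in> ?C"
      using rho_in_lring[OF S R i that] lring_mono[of "{n+1..n+m}" "{1..n+m} - {i, k}" R x] i k by fastforce
    fix l assume "l \<in> {1..n+m} - {k}"
    then show "x l ^ eexp d B i j l \<in> ?C"
      by (cases "l = i") (auto simp: exp_i subring_1 intro!: subring_power lring_var)
  qed
  have p: "coeffs_in ?C p" unfolding p_def using c by (intro coeffs_in_sum coeffs_in_monom) auto
  have pt: "poly p (x k) = exchange_polynomial n m d (x, \<rho>, B) i"
    unfolding p_def exchange_polynomial_eterm poly_sum
  proof (intro sum.cong refl)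
    fix j
    have "eterm (n + m) x d B i j = x k ^ eexp d B i j k * (\<Prod>l\<in>{1..n+m}-{k}. x l ^ eexp d B i j l)"
      unfolding eterm_def by (rule prod.remove) (use k in auto)
    then show "poly (monom (c j) (eexp d B i j k)) (x k) = \<rho> i j * eterm (n + m) x d B i j"
      by (simp add: poly_monom c_def mult_ac)
  qed
  have e: "eexp d B i j k = (if b > 0 then j * nat b else (d i - j) * nat (- b))" for j
    using nat_mult_distrib[of "int (d i - j)" "- b"]
    by (auto simp: eexp_def b_def[symmetric] pos_part_def nat_mult_distrib)
  \<comment> \<open>The exponent of \<open>x k\<close> is affine in the index with slope b \<noteq>
    0, so no two terms interfere; at both ends the coefficient is a monomial, since
    \<open>\<rho>\<close> is 1 there.\<close>
  have coeff: "coeff p (eexp d B i j k) \<noteq> 0" if j: "j = 0 \<or> j = d i" for j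
  proof -
    have "coeff p (eexp d B i j k) = (\<Sum>s=0..d i. if s = j then c j else 0)"
      unfolding p_def coeff_sum
    proof (intro sum.cong refl)
      fix s assume "s \<in> {0..d i}"
      then have "eexp d B i s k = eexp d B i j k \<longleftrightarrow> s = j" using b j by (auto simp: e)
      then show "coeff (monom (c s) (eexp d B i s k)) (eexp d B i j k) = (if s = j then c j else 0)"
        by auto
    qed
    also have "\<dots> = c j" using j by auto
    also have "c j \<noteq> 0" using SD(5,6)[OF i] j nz by (auto simp: c_def)
    finally show ?thesis .
  qed
  have "coeff p 0 \<noteq> 0"
    using coeff[of 0] coeff[of "d i"] by (cases "b > 0") (auto simp: e)
  moreover have "degree p > 0"
  proof (cases "b > 0")
    case True
    then have "coeff p (d i * nat b) \<noteq> 0" using coeff[of "d i"] by (simp add: e)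
    then have "d i * nat b \<le> degree p" by (rule le_degree)
    moreover have "d i * nat b > 0" using SD(3)[OF i] True by simp
    ultimately show ?thesis by linarith
  next
    case False
    then have "coeff p (d i * nat (- b)) \<noteq> 0" using coeff[of 0] by (simp add: e)
    then have "d i * nat (- b) \<le> degree p" by (rule le_degree)
    moreover have "d i * nat (- b) > 0" using SD(3)[OF i] False b by simp
    ultimately show ?thesis by linarith
  qed
  moreover from f show False
  proof
    assume "exchange_polynomial n m d (x, \<rho>, B) i = 0"
    then have "p = 0" using transcD[OF t p] pt by simp
    then show False using \<open>coeff p 0 \<noteq> 0\<close> by simp
  next
    assume "exchange_polynomial n m d (x, \<rho>, B) i \<in> units_of_subring (lring R ?I x)"
    then obtain h where h: "h \<in> rgen (?C \<union> {x k, 1 / x k})" "poly p (x k) * h = 1"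
      unfolding insert pt by (auto simp: units_of_subring_def)
    obtain K q where q: "h * x k ^ K = poly q (x k)" "coeffs_in ?C q"
      using rgen_pair_iff[OF C subring_1[OF C], of "x k" h] h(1) nz k by (auto simp: weighted_1)
    have "poly (p * q) (x k) = poly (monom 1 K) (x k)"
      using h(2) by (simp add: poly_monom flip: q(1))
    \<comment> \<open>\<open>p\<close> divides a power of the variable and has a non-zero constant
      term, so it must be constant.\<close>
    then have pq: "p * q = monom 1 K"
      by (intro transc_eqD[OF C t] coeffs_in_mult coeffs_in_monom C p q subring_1)
    then have "q \<noteq> 0" by auto
    then obtain j q' where q': "q = monom 1 j * q'" "coeff q' 0 \<noteq> 0" using poly_strip by blast
    have "monom 1 j * (p * q') = monom 1 K * 1" using pq by (simp add: q'(1) mult_ac)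
    then have "p * q' = 1"
      by (rule monom_mult_unique(2)) (use \<open>coeff p 0 \<noteq> 0\<close> q'(2) in \<open>simp_all add: coeff_mult\<close>)
    then have "degree p = 0" by (metis add_is_0 degree_1 degree_mult_eq mult_zero_left mult_zero_right zero_neq_one)
    then show False using \<open>degree p > 0\<close> by simp
  qed
qed

text \<open>For one further variable, write the inverse of \<open>f\<close> as q(x k) divided by the
  N-th power of \<open>x k\<close>. Then f * q is the N-th power of the variable, and comparing
  coefficients at N shows that the inverse of \<open>f\<close> is a coefficient of
  \<open>q\<close>.\<close>

lemma inverse_in_smaller_lring:
  assumes "finite K" and f: "f \<in> lring R J x" "f \<noteq> 0"
  shows "ind R (J \<union> K) x \<Longrightarrow> inverse f \<in> lring R (J \<union> K) x \<Longrightarrow> inverse f \<in> lring R J x"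
  using assms(1)
proof (induction K rule: finite_induct)
  case (insert k K)
  show ?case
  proof (cases "k \<in> J")
    case True
    then show ?thesis using insert by (simp add: insert_absorb)
  next
    case False
    let ?C = "lring R (J \<union> K) x"
    have C: "is_subring ?C" by simp
    have t: "transc ?C (x k)" using insert.prems(1) by (rule ind_transc) (use False insert.hyps in auto)
    have t0: "x k \<noteq> 0" using transc_nonzero[OF C t] .
    have fC: "f \<in> ?C" using f(1) lring_mono[of J "J \<union> K" R x] by blast
    have "inverse f \<in> rgen (?C \<union> {x k, 1 / x k})" using insert.prems(2) by (simp add: lring_insert_rgen)
    then obtain N q where q: "inverse f * x k ^ N = poly q (x k)" "coeffs_in ?C q"
      using rgen_pair_iff[OF C subring_1[OF C] t0] by (auto simp: weighted_1)
    have "poly (smult f q) (x k) = poly (monom 1 N) (x k)"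
      using f(2) by (simp add: poly_monom flip: q(1))
    then have "smult f q = monom 1 N"
      by (intro transc_eqD[OF C t] coeffs_in_smult coeffs_in_monom C q fC subring_1)
    then have "f * coeff q N = 1" by (metis coeff_monom coeff_smult)
    then have "inverse f = coeff q N" by (rule inverse_unique)
    then have "inverse f \<in> ?C" using q(2) by (simp add: coeffs_in_def)
    then show ?thesis using insert.IH ind_subset[OF insert.prems(1)] by auto
  qed
qed simp

text \<open>A Laurent polynomial in f/t over C, expanded in t, has a coefficient divisible by f^e at
  each t^(-e) with e > 0; comparison with the expansion of \<open>y\<close> in \<open>t\<close>
  yields the condition \<open>weighted\<close>.\<close>

lemma laurent_inter:
  assumes C: "is_subring C" and t: "transc C t" and f: "f \<in> C" "f \<noteq> 0"
    and y: "y \<in> rgen (C \<union> {t, 1 / t})" "y \<in> rgen (C \<union> {f / t, 1 / (f / t)})"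
  shows "y \<in> rgen (C \<union> {t, f / t})"
proof -
  have t0: "t \<noteq> 0" using transc_nonzero[OF C t] .
  obtain K p where p: "y * t ^ K = poly p t" "coeffs_in C p"
    using rgen_pair_iff[OF C subring_1[OF C] t0] y(1) by (auto simp: weighted_1)
  have ft: "f / t \<noteq> 0" using f(2) t0 by simp
  obtain M q where q: "y * (f / t) ^ M = poly q (f / t)" "coeffs_in C q"
    using rgen_pair_iff[OF C subring_1[OF C] ft] y(2) by (auto simp: weighted_1)
  define D where "D = degree q"
  \<comment> \<open>\<open>r\<close> represents y * (f/t)^M multiplied by t^(D + K + M), which
    clears the denominators of both expansions of \<open>y\<close>.\<close>
  define r where "r = (\<Sum>j\<le>D. monom (coeff q j * f ^ j) (D - j + K + M))"
  have r: "coeffs_in C r" unfolding r_def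
    by (intro coeffs_in_sum coeffs_in_monom C subring_mult subring_power f) (use q(2) in \<open>simp add: coeffs_in_def\<close>)
  have "poly r t = poly q (f / t) * t ^ (D + K + M)"
    unfolding r_def poly_sum poly_altdef[of q] sum_distrib_right D_def[symmetric]
  proof (intro sum.cong refl)
    fix j assume "j \<in> {..D}"
    then have "D + K + M = j + (D - j + K + M)" by simp
    then have "t ^ (D + K + M) = t ^ j * t ^ (D - j + K + M)" by (simp only: power_add)
    then show "poly (monom (coeff q j * f ^ j) (D - j + K + M)) t = coeff q j * (f / t) ^ j * t ^ (D + K + M)"
      using t0 by (simp add: poly_monom power_divide)
  qed
  also have "\<dots> = poly (monom (f ^ M) D * p) t"
    unfolding q(1)[symmetric] using t0 by (simp add: poly_monom power_add power_divide mult_ac flip: p(1))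
  finally have "r = monom (f ^ M) D * p"
    by (intro transc_eqD[OF C t] coeffs_in_mult coeffs_in_monom C r p subring_power f)
  then have eq: "coeff r (i + D) = f ^ M * coeff p i" for i by (simp add: coeff_monom_mult)
  have "weighted C f K p"
    unfolding weighted_def
  proof
    fix i
    show "\<exists>c\<in>C. coeff p i = c * f ^ (K - i)"
    proof (cases "i < K")
      case True
      \<comment> \<open>The only index whose term can contribute to the coefficient of
        \<open>r\<close> at i + D.\<close>
      define s where "s = K + M - i"
      have idx: "D - j + K + M = i + D \<longleftrightarrow> j = s" if "j \<le> D" for j
        using that True unfolding s_def by linarith
      have "coeff r (i + D) = (\<Sum>j\<le>D. if j = s then coeff q s * f ^ s else 0)"
        unfolding r_def coeff_sum coeff_monom
      proof (intro sum.cong refl)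
        fix j assume "j \<in> {..D}"
        then have "D - j + K + M = i + D \<longleftrightarrow> j = s" using idx by blast
        then show "(if D - j + K + M = i + D then coeff q j * f ^ j else 0) = (if j = s then coeff q s * f ^ s else 0)"
          by (cases "j = s") (simp_all only: if_True if_False simp_thms)
      qed
      also have "\<dots> = (if s \<le> D then coeff q s else 0) * f ^ s" by simp
      finally have "f ^ M * coeff p i = (if s \<le> D then coeff q s else 0) * f ^ s" using eq by simp
      moreover have "f ^ s = f ^ M * f ^ (K - i)" using True by (simp add: s_def add.commute flip: power_add)
      ultimately have "coeff p i = (if s \<le> D then coeff q s else 0) * f ^ (K - i)" using f(2) by simp
      moreover have "(if s \<le> D then coeff q s else 0) \<in> C" using q(2) C by (simp add: coeffs_in_def subringD)
      ultimately show ?thesis by blast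
    qed (use p(2) in \<open>auto simp: coeffs_in_def\<close>)
  qed
  then show ?thesis using rgen_pair_iff[OF C f(1) t0] p(1) by blast
qed


lemma exchange_polynomial_frozen:
  assumes S: "generalized_seed R n m d (x, \<rho>, B)" and R: "is_subring R" and i: "i \<in> {1..n}"
    and col: "\<And>k. k \<in> {1..n} \<Longrightarrow> B k i = 0"
  shows "exchange_polynomial n m d (x, \<rho>, B) i \<in> lring R {n+1..n+m} x"
  unfolding exchange_polynomial_eterm eterm_def
proof (intro subring_sum subring_mult subring_prod is_subring_lring)
  fix j assume "j \<in> {0..d i}"
  then show "\<rho> i j \<in> lring R {n+1..n+m} x" using rho_in_lring[OF S R i] by simp
  fix k assume k: "k \<in> {1..n+m}"
  show "x k ^ eexp d B i j k \<in> lring R {n+1..n+m} x"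
  proof (cases "k \<le> n")
    case True
    then have "eexp d B i j k = 0" using col[of k] k by (simp add: eexp_def beta_def pos_part_def)
    then show ?thesis by (simp add: subring_1)
  qed (use k in \<open>auto intro!: subring_power lring_var\<close>)
qed

lemma exchange_unit_frozen:
  assumes S: "generalized_seed R n m d (x, \<rho>, B)" and R: "is_subring R" and i: "i \<in> {1..n}"
    and f: "exchange_polynomial n m d (x, \<rho>, B) i \<in> units_of_subring (lring R ({1..n+m} - {i}) x)"
  shows "exchange_polynomial n m d (x, \<rho>, B) i \<in> units_of_subring (lring R {n+1..n+m} x)"
proof -
  let ?f = "exchange_polynomial n m d (x, \<rho>, B) i" and ?F = "{n+1..n+m}" and ?K = "{1..n} - {i}"
  have FK: "?F \<union> ?K = {1..n+m} - {i}" using i by auto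
  have mem: "?f \<in> lring R ?F x"
    using exchange_polynomial_frozen[OF S R i] column_zero[OF S R i] f by blast
  have "ind R (?F \<union> ?K) x" unfolding FK using generalized_seedD(1)[OF S R] by (rule ind_subset) auto
  then have "inverse ?f \<in> lring R ?F x"
    by (rule inverse_in_smaller_lring[rotated 3]) (use f mem FK in \<open>simp_all add: units_of_subring_def\<close>)
  then show ?thesis using mem f by (simp add: units_of_subring_def)
qed

lemma frozen_variables_fixed:
  assumes "mutation_equivalent R n m d S S'" "k \<in> {n+1..n+m}"
  shows "fst S' k = fst S k"
  using assms(1) unfolding mutation_equivalent_def
proof induction
  case (step S1 S2)
  obtain x \<rho> B where "S1 = (x, \<rho>, B)" by (cases S1)
  then show ?case using step assms(2) by (auto simp: mutation_step_def mutate.simps)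
qed simp

text \<open>A column that vanishes on the mutable rows keeps doing so under every mutation, and its
  exchange polynomial does not change; so the variable alternates between its initial value and f
  divided by it.\<close>

lemma isolated_variable:
  assumes S: "generalized_seed R n m d S" and R: "is_subring R" and i: "i \<in> {1..n}"
    and col: "\<And>k. k \<in> {1..n} \<Longrightarrow> snd (snd S) k i = 0" and equiv: "mutation_equivalent R n m d S S'"
  defines "f \<equiv> exchange_polynomial n m d S i"
  shows "fst S' i = fst S i \<or> f \<noteq> 0 \<and> fst S' i = f / fst S i"
proof -
  have "(\<forall>k\<in>{1..n}. snd (snd S') k i = 0) \<and> exchange_polynomial n m d S' i = f \<and>
      (fst S' i = fst S i \<or> f \<noteq> 0 \<and> fst S' i = f / fst S i)"
    using equiv unfolding mutation_equivalent_def
  proof induction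
    case base
    show ?case using col by (simp add: f_def)
  next
    case (step S1 S2)
    obtain x \<rho> B where S1: "S1 = (x, \<rho>, B)" by (cases S1)
    obtain j where seed1: "generalized_seed R n m d (x, \<rho>, B)" and seed2: "generalized_seed R n m d S2"
      and j: "j \<in> {1..n}" and S2: "S2 = mutate n m d j (x, \<rho>, B)"
      using step.hyps(2) by (auto simp: mutation_step_def S1)
    have IH: "\<And>k. k \<in> {1..n} \<Longrightarrow> B k i = 0" "exchange_polynomial n m d (x, \<rho>, B) i = f"
      "x i = fst S i \<or> f \<noteq> 0 \<and> x i = f / fst S i"
      using step.IH by (simp_all add: S1)
    note SD = generalized_seedD[OF seed1 R]
    have x0: "x i \<noteq> 0" using ind_nonzero[OF SD(1)] i by simp
    show ?case
    proof (cases "j = i")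
      case True
      have "exchange_polynomial n m d S2 i = f"
        unfolding S2 True using exchange_polynomial_mutate[of n m d i B x \<rho>] SD(4)[OF i] IH(1)[OF i] IH(2)
        by (simp add: beta_def)
      moreover have "fst S2 i = f / x i" by (simp add: S2 True mutate.simps IH(2))
      moreover have "fst S2 i \<noteq> 0"
        using generalized_seedD(1)[of R n m d "fst S2" "fst (snd S2)" "snd (snd S2)"] seed2 R ind_nonzero i
        by (metis (no_types, lifting) atLeastAtMost_iff prod.collapse trans_le_add1)
      moreover have "snd (snd S2) k i = 0" if "k \<in> {1..n}" for k
        using IH(1)[OF that] by (simp add: S2 True mutate.simps mutate_matrix_def)
      ultimately show ?thesis using IH(3) x0 by auto
    next
      case False
      have B: "mutate_matrix j B k i = B k i" for k
        using IH(1)[OF j] False by (simp add: mutate_matrix_def pos_part_def)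
      have "eterm (n + m) (x(j := exchange_polynomial n m d (x, \<rho>, B) j / x j)) d (mutate_matrix j B) i s
          = eterm (n + m) x d B i s" for s
        unfolding eterm_def
      proof (intro prod.cong refl)
        fix k assume "k \<in> {1..n+m}"
        have "eexp d (mutate_matrix j B) i s k = eexp d B i s k" by (simp add: eexp_def beta_def B)
        moreover have "eexp d B i s j = 0" using IH(1)[OF j] by (simp add: eexp_def beta_def pos_part_def)
        ultimately show "(x(j := exchange_polynomial n m d (x, \<rho>, B) j / x j)) k ^ eexp d (mutate_matrix j B) i s k
          = x k ^ eexp d B i s k" by (cases "k = j") simp_all
      qed
      then have "exchange_polynomial n m d S2 i = f"
        unfolding S2 mutate.simps exchange_polynomial_eterm IH(2)[symmetric] using False by simp
      moreover have "snd (snd S2) k i = 0" if "k \<in> {1..n}" for k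
        using IH(1)[OF that] by (simp add: S2 mutate.simps B)
      moreover have "fst S2 i = x i" using False by (simp add: S2 mutate.simps)
      ultimately show ?thesis using IH(3) by simp
    qed
  qed
  then show ?thesis by blast
qed

section \<open>Cluster algebras are finite factorization domains\<close>

lemma ub_subset_laurent:
  assumes S: "generalized_seed R n m d (x, \<rho>, B)" and R: "is_subring R" and l: "l \<in> {1..n}"
  shows "ub R n m d (x, \<rho>, B) l \<subseteq> lring R {1..n+m} x"
  unfolding ub_def
proof (rule rgen_least)
  let ?L = "lring R {1..n+m} x"
  have "exchange_polynomial n m d (x, \<rho>, B) l \<in> ?L"
    unfolding exchange_polynomial_eterm eterm_def
  proof (intro subring_sum subring_mult subring_prod subring_power is_subring_lring lring_var)
    fix j assume "j \<in> {0..d l}"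
    then show "\<rho> l j \<in> ?L"
      using rho_in_lring[OF S R l, of j] lring_mono[of "{n+1..n+m}" "{1..n+m}" R x] by fastforce
  qed
  then have "exchange_polynomial n m d (x, \<rho>, B) l / x l \<in> ?L"
    unfolding divide_inverse using l by (intro subring_mult is_subring_lring lring_inv) auto
  moreover have "x l \<in> ?L" using l by (intro lring_var) auto
  moreover have "lring R ({1..n+m} - {l}) x \<subseteq> ?L" by (rule lring_mono) auto
  ultimately show "lring R ({1..n+m} - {l}) (fst (x, \<rho>, B)) \<union>
    {fst (x, \<rho>, B) l, exchange_polynomial n m d (x, \<rho>, B) l / fst (x, \<rho>, B) l} \<subseteq> ?L" by auto
qed simp

lemma is_subring_cluster_algebras:
  fixes S :: "'a::field seed"
  shows "is_subring (generalized_cluster_algebra R n m d S)"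
  "is_subring (generalized_upper_cluster_algebra R n m d S)"
proof -
  show "is_subring (generalized_cluster_algebra R n m d S)"
    by (simp add: generalized_cluster_algebra_def)
  have inter: "is_subring (\<Inter>\<D>)" if "\<And>D. D \<in> \<D> \<Longrightarrow> is_subring D" for \<D> :: "'a set set"
    using that by (auto simp: is_subring_def)
  show "is_subring (generalized_upper_cluster_algebra R n m d S)"
    unfolding generalized_upper_cluster_algebra_def by (rule inter) (auto simp: laurent_ring_eq)
qed

text \<open>The inclusion of \<open>A\<close> in the rings
  \<open>G\<^sub>k[x\<^sub>k, f\<^sub>k/x\<^sub>k]\<close> rests on
  \<open>cluster_variable_in_ub\<close>.\<close>

lemma fin_div_cluster_algebra:
  assumes S: "generalized_seed R n m d (x, \<rho>, B)" and R: "is_subring R"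
    and fd: "fin_div R (units_of_subring R)"
  defines "A \<equiv> generalized_cluster_algebra R n m d (x, \<rho>, B)"
  shows "fin_div A (units_of_subring A)"
proof -
  let ?f = "exchange_polynomial n m d (x, \<rho>, B)" and ?F = "{n+1..n+m}"
  let ?G = "\<lambda>i. lring R ({1..n+m} - {i}) x"
  note SD = generalized_seedD[OF S R]
  have nz: "x k \<noteq> 0" if "k \<in> {1..n+m}" for k using ind_nonzero[OF SD(1) that] .
  have A: "is_subring A" unfolding A_def by (rule is_subring_cluster_algebras)
  have var_A: "fst S' i \<in> A" if "mutation_equivalent R n m d (x, \<rho>, B) S'" "i \<in> {1..n}" for S' i
    unfolding A_def generalized_cluster_algebra_def using that by (intro rgen_incl) blast
  have RA: "R \<subseteq> A" unfolding A_def generalized_cluster_algebra_def by (auto intro: rgen_incl)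
  have frozen: "x k \<in> A" "inverse (x k) \<in> A" if "k \<in> ?F" for k
    using that unfolding A_def generalized_cluster_algebra_def by (auto intro!: rgen_incl)
  have FA: "lring R ?F x \<subseteq> A" using RA frozen by (intro lring_least[OF A]) auto
  have ub: "A \<subseteq> ub R n m d (x, \<rho>, B) i" if i: "i \<in> {1..n}" for i
    unfolding A_def generalized_cluster_algebra_def
  proof (rule rgen_least)
    have "?G i \<subseteq> ub R n m d (x, \<rho>, B) i" by (auto simp: ub_def intro: rgen_incl)
    moreover have "R \<union> x ` ?F \<union> (\<lambda>k. inverse (x k)) ` ?F \<subseteq> ?G i"
      using i by (auto intro: lring_base lring_var lring_inv)
    ultimately show "R \<union> fst (x, \<rho>, B) ` ?F \<union> (\<lambda>k. inverse (fst (x, \<rho>, B) k)) ` ?F \<union>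
        {fst S' i |S' i. mutation_equivalent R n m d (x, \<rho>, B) S' \<and> i \<in> {1..n}} \<subseteq> ub R n m d (x, \<rho>, B) i"
      using cluster_variable_in_ub[OF S R _ _ i] by auto
  qed (simp add: ub_def)
  \<comment> \<open>For n = 0 there is no upper bound to pass through, and \<open>A\<close> is
    generated by ground ring, frozen variables and their inverses.\<close>
  have AL: "A \<subseteq> lring R {1..n+m} x"
  proof (cases "n = 0")
    case True
    have "R \<union> x ` ?F \<union> (\<lambda>k. inverse (x k)) ` ?F \<subseteq> lring R {1..n+m} x"
      by (auto intro: lring_base lring_var lring_inv)
    then show ?thesis unfolding A_def generalized_cluster_algebra_def
      using True by (intro rgen_least) auto
  next
    case False
    then show ?thesis using ub[of 1] ub_subset_laurent[OF S R, of 1] by fastforce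
  qed
  \<comment> \<open>A vanishing exchange polynomial is not a unit, so its direction belongs to
    \<open>J\<close>; the inclusion in the upper bound holds for it as well.\<close>
  define J where "J = {i\<in>{1..n}. ?f i \<notin> units_of_subring (?G i)}"
  show ?thesis
  proof (rule fin_div_intermediate[OF R fd _ SD(1) A RA AL, where J = J and f = ?f])
    fix k assume k: "k \<in> {1..n+m} - J"
    show "x k \<in> units_of_subring A"
    proof (cases "k \<in> ?F")
      case True
      then show ?thesis using frozen nz k by (auto simp: units_of_subring_def)
    next
      case False
      then have kn: "k \<in> {1..n}" using k by auto
      then have "?f k \<in> units_of_subring (?G k)" using k by (auto simp: J_def)
      then have "?f k \<in> units_of_subring (lring R ?F x)" by (rule exchange_unit_frozen[OF S R kn])
      then have f: "?f k \<noteq> 0" "inverse (?f k) \<in> A" using FA by (auto simp: units_of_subring_def)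
      \<comment> \<open>The mutated variable is a generator of \<open>A\<close>; multiplied by the
        inverse of the exchange polynomial, it gives the inverse of \<open>x k\<close>.\<close>
      have "fst (mutate n m d k (x, \<rho>, B)) k \<in> A"
        using mutation_step_mutate[OF S R kn f(1)] kn by (rule var_A)
      then have "?f k / x k * inverse (?f k) \<in> A"
        using f(2) by (intro subring_mult[OF A]) (simp_all add: mutate.simps)
      then have "inverse (x k) \<in> A" using f(1) by (simp add: field_simps inverse_eq_divide)
      moreover have "fst (x, \<rho>, B) k \<in> A" by (rule var_A[OF _ kn]) (simp add: mutation_equivalent_def)
      ultimately show ?thesis using nz k by (simp add: units_of_subring_def)
    qed
  next
    fix k assume "k \<in> J"
    then have k: "k \<in> {1..n}" "?f k \<notin> units_of_subring (?G k)" by (auto simp: J_def)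
    show "?f k \<notin> units_of_subring (?G k)" by (rule k(2))
    show "A \<subseteq> rgen (?G k \<union> {x k, ?f k / x k})" using ub[OF k(1)] by (simp add: ub_def)
    have "lring R ?F x \<subseteq> ?G k" using k by (intro lring_mono) auto
    then show "?f k \<in> ?G k"
      using rho_in_lring[OF S R k(1)] skew_symmetrizable_diag[OF SD(2) k(1)]
      by (intro exchange_polynomial_in_lring R) (auto simp: beta_def)
  qed (auto simp: J_def)
qed

text \<open>The inclusion in \<open>G\<^sub>k[x\<^sub>k, f\<^sub>k/x\<^sub>k]\<close> follows from
  two neighbouring clusters by \<open>laurent_inter\<close>. Variables outside \<open>J\<close> have
  to be shown to be units in the Laurent rings of all clusters.\<close>

lemma fin_div_upper_cluster_algebra:
  assumes S: "generalized_seed R n m d (x, \<rho>, B)" and R: "is_subring R"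
    and fd: "fin_div R (units_of_subring R)"
  defines "A \<equiv> generalized_upper_cluster_algebra R n m d (x, \<rho>, B)"
  shows "fin_div A (units_of_subring A)"
proof -
  let ?f = "exchange_polynomial n m d (x, \<rho>, B)" and ?F = "{n+1..n+m}"
  let ?G = "\<lambda>i. lring R ({1..n+m} - {i}) x"
  let ?eq = "mutation_equivalent R n m d (x, \<rho>, B)"
  note SD = generalized_seedD[OF S R]
  have nz: "x k \<noteq> 0" if "k \<in> {1..n+m}" for k using ind_nonzero[OF SD(1) that] .
  have A: "is_subring A" unfolding A_def by (rule is_subring_cluster_algebras)
  have A_iff: "y \<in> A \<longleftrightarrow> (\<forall>S'. ?eq S' \<longrightarrow> y \<in> lring R {1..n+m} (fst S'))" for y
    by (auto simp: A_def generalized_upper_cluster_algebra_def laurent_ring_eq)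
  have RA: "R \<subseteq> A" using A_iff by (auto intro: lring_base)
  have refl: "?eq (x, \<rho>, B)" by (simp add: mutation_equivalent_def)
  then have AL: "A \<subseteq> lring R {1..n+m} x" using A_iff by force
  have unit_A: "u \<in> units_of_subring A"
    if "\<And>S'. ?eq S' \<Longrightarrow> u \<in> units_of_subring (lring R {1..n+m} (fst S'))" for u
    using that refl unfolding units_of_subring_def A_iff by blast
  have var_unit: "fst S' k \<in> units_of_subring (lring R {1..n+m} (fst S'))" if "?eq S'" "k \<in> {1..n+m}" for S' k
  proof -
    have "generalized_seed R n m d S'"
      using that(1) S unfolding mutation_equivalent_def by induction (auto simp: mutation_step_def)
    then have "ind R {1..n+m} (fst S')"
      using generalized_seedD(1)[of R n m d "fst S'" "fst (snd S')" "snd (snd S')"] R by simp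
    then show ?thesis using ind_nonzero that(2) by (intro units_of_subring_var) blast+
  qed
  \<comment> \<open>Directions with vanishing exchange polynomial are excluded here: by
    \<open>isolated_variable\<close> their variable remains in every cluster and is therefore a unit
    of \<open>A\<close>.\<close>
  define J where "J = {i\<in>{1..n}. ?f i \<noteq> 0 \<and> ?f i \<notin> units_of_subring (?G i)}"
  show ?thesis
  proof (rule fin_div_intermediate[OF R fd _ SD(1) A RA AL, where J = J and f = ?f])
    fix k assume k: "k \<in> {1..n+m} - J"
    show "x k \<in> units_of_subring A"
    proof (rule unit_A)
      fix S' assume S': "?eq S'"
      let ?L = "lring R {1..n+m} (fst S')"
      show "x k \<in> units_of_subring ?L"
      proof (cases "k \<in> ?F")
        case True
        then show ?thesis using var_unit[OF S', of k] frozen_variables_fixed[OF S' True] k by simp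
      next
        case False
        then have kn: "k \<in> {1..n}" using k by auto
        then have f: "?f k = 0 \<or> ?f k \<in> units_of_subring (?G k)" using k by (auto simp: J_def)
        then have "\<And>j. j \<in> {1..n} \<Longrightarrow> B j k = 0" using column_zero[OF S R kn] by blast
        then consider "fst S' k = x k" | "?f k \<noteq> 0" "fst S' k = ?f k / x k"
          using isolated_variable[OF S R kn _ S'] by auto
        then show ?thesis
        proof cases
          case 1
          then show ?thesis using var_unit[OF S', of k] k by simp
        next
          case 2
          then have "?f k \<in> units_of_subring (lring R ?F x)" using f exchange_unit_frozen[OF S R kn] by blast
          also have "lring R ?F x = lring R ?F (fst S')"
            using frozen_variables_fixed[OF S'] by (intro lring_cong) simp
          also have "units_of_subring (lring R ?F (fst S')) \<subseteq> units_of_subring ?L"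
            using lring_mono[of ?F "{1..n+m}" R "fst S'"] by (auto simp: units_of_subring_def)
          finally have "?f k * inverse (fst S' k) \<in> units_of_subring ?L"
            using units_of_subring_inverse[OF var_unit[OF S', of k]] k
            by (intro units_of_subring_mult is_subring_lring) auto
          also have "?f k * inverse (fst S' k) = x k" using 2 nz[of k] k by simp
          finally show ?thesis .
        qed
      qed
    qed
  next
    fix k assume "k \<in> J"
    then have k: "k \<in> {1..n}" "?f k \<noteq> 0" "?f k \<notin> units_of_subring (?G k)" by (auto simp: J_def)
    show "?f k \<notin> units_of_subring (?G k)" by (rule k(3))
    have "lring R ?F x \<subseteq> ?G k" using k by (intro lring_mono) auto
    then show fG: "?f k \<in> ?G k"
      using rho_in_lring[OF S R k(1)] skew_symmetrizable_diag[OF SD(2) k(1)]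
      by (intro exchange_polynomial_in_lring R) (auto simp: beta_def)
    show "A \<subseteq> rgen (?G k \<union> {x k, ?f k / x k})"
    proof
      fix y assume y: "y \<in> A"
      have ins: "insert k ({1..n+m} - {k}) = {1..n+m}" using k by auto
      let ?x' = "x(k := ?f k / x k)"
      have "y \<in> lring R {1..n+m} x" using y AL by blast
      then have y1: "y \<in> rgen (?G k \<union> {x k, 1 / x k})" using lring_insert_rgen[of R k "{1..n+m} - {k}" x] ins by simp
      have "fst (mutate n m d k (x, \<rho>, B)) = ?x'" by (simp add: mutate.simps)
      then have "y \<in> lring R {1..n+m} ?x'"
        using y mutation_step_mutate[OF S R k(1,2)] A_iff by metis
      moreover have "lring R ({1..n+m} - {k}) ?x' = ?G k" by (rule lring_cong) simp
      ultimately have y2: "y \<in> rgen (?G k \<union> {?f k / x k, 1 / (?f k / x k)})"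
        using lring_insert_rgen[of R k "{1..n+m} - {k}" ?x'] ins by simp
      have "transc (?G k) (x k)" using SD(1) k by (auto simp: ind_def)
      then show "y \<in> rgen (?G k \<union> {x k, ?f k / x k})"
        by (rule laurent_inter[OF is_subring_lring _ fG k(2) y1 y2])
    qed
  qed (auto simp: J_def)
qed

theorem proposition2p13:
  fixes R A :: "'a::field_char_0 set"
    and n m :: nat
    and d :: "nat \<Rightarrow> nat"
    and x :: "nat \<Rightarrow> 'a"
    and \<rho> :: "nat \<Rightarrow> nat \<Rightarrow> 'a"
    and B :: "nat \<Rightarrow> nat \<Rightarrow> int"
  assumes "n + m > 0"
    and "R = \<int> \<or> subfield R ambient"
    and "ambient_rational_function_field (quotient_field R) (n + m)"
    and "generalized_seed R n m d (x, \<rho>, B)"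
    and "A = generalized_cluster_algebra R n m d (x, \<rho>, B) \<or>
         A = generalized_upper_cluster_algebra R n m d (x, \<rho>, B)"
  shows "ff_domain (ring_on A) \<and> atomic_domain (ring_on A)"
proof -
  have R: "is_subring R" and fd: "fin_div R (units_of_subring R)"
    using assms(2) is_subring_subfield(1) fin_div_subfield is_subring_Ints fin_div_Ints by auto
  have "is_subring A" using assms(5) is_subring_cluster_algebras by auto
  moreover have "fin_div A (units_of_subring A)"
    using assms(5) fin_div_cluster_algebra[OF assms(4) R fd] fin_div_upper_cluster_algebra[OF assms(4) R fd]
    by auto
  ultimately have "ff_domain (ring_on A)" by (rule fin_div_imp_ff_domain)
  then show ?thesis by (simp add: ff_domain_def)
qed

end
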